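(* Let $X=\{X_n\}_{n\ge 0}$ be a centered Gaussian sequence as described in the context. Assume that there are a symmetric positive function $\rho:\mathbb{R}\to\mathbb{R}$ with $\rho(0)=1$ and a positive constant $C_0$ such that $|E[X_tX_s]|\le C_0\,\rho(|t-s|)$ for all indices $s,t$. Then there is a constant $C>0$, not depending on $n$, such that for all $n>1$ $$d_{TV}(F_n(X),N)\le C\max\left\{\frac{1}{v_n(X)^{3/2}\sqrt n}\Big(\sum_{|k|<n}|\rho(k)|^{3/2}\Big)^2,\ \frac{1}{v_n(X)^2\,n}\Big(\sum_{|k|<n}|\rho(k)|^{4/3}\Big)^3\right\}.$$ In particular, if for some $\beta\ge 1/2$ we have $\rho(t)=O(|t|^{-\beta})$ for large $|t|$, then there exists $C>0$ such that for all $n>1$ $$d_{TV}(F_n(X),N)\le \frac{C}{v_n(X)^2\wedge v_n(X)^{3/2}}\begin{cases}1 & \text{if }\beta=\frac12,\\ n^{\frac32-3\beta} & \text{if }\beta\in(\frac12,\frac23),\\ n^{-1/2}\log(n)^2 & \text{if }\beta=\frac23,\\ n^{-1/2} & \text{if }\beta>\frac23.\end{cases}$$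
   Context: $G=\{G_t\}_{t\ge0}$ is an underlying Gaussian process with associated Hilbert space $\mathcal{H}$, and $X=\{X_n\}_{n\ge0}$ is a mean-zero Gaussian sequence of the form $X_n=I_1(h_n)$ with $h_n\in\mathcal{H}$, where $I_1$ is the Wiener integral with respect to $G$ (so the $X_n$ are jointly Gaussian and centered). No stationarity is assumed. For $n\ge1$ set $$V_n(X):=\frac1{\sqrt n}\sum_{i=1}^n\left(X_i^2-E[X_i^2]\right),\quad v_n(X):=E[V_n(X)^2]=\frac2n\sum_{j,k=1}^n(E[X_jX_k])^2,\quad F_n(X):=\frac{V_n(X)}{\sqrt{v_n(X)}},$$ where $v_n(X)>0$ for the values of $n$ considered, so that $F_n(X)$ is well defined. $N\sim\mathcal N(0,1)$, and for real random variables $d_{TV}(Y,Z)=\sup_{A\in\mathcal B(\mathbb R)}|P[Y\in A]-P[Z\in A]|$. Sums over $|k|<n$ run over integers $k$; $a\wedge b=\min(a,b)$. *)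

theory Defs
  imports "HOL-Probability.Probability"
begin

text \<open>Centered Gaussian random variables, the degenerate law of variance zero included.\<close>

definition centered_gaussian :: "'a measure \<Rightarrow> ('a \<Rightarrow> real) \<Rightarrow> bool" where
  "centered_gaussian M Y \<longleftrightarrow>
     Y \<in> borel_measurable M \<and>
     ((AE \<omega> in M. Y \<omega> = 0) \<or>
      (\<exists>\<sigma>>0. distributed M lborel Y (\<lambda>x. ennreal (normal_density 0 \<sigma> x))))"

text \<open>
  Time runs over the nonnegative reals; the values of \<open>G\<close> at negative times are irrelevant.
\<close>

locale gaussian_process = prob_space M
  for M :: "'a measure" +
  fixes G :: "real \<Rightarrow> 'a \<Rightarrow> real"
  assumes gaussian:
    "finite T \<Longrightarrow> T \<subseteq> {0..} \<Longrightarrow> centered_gaussian M (\<lambda>\<omega>. \<Sum>t\<in>T. c t * G t \<omega>)"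

text \<open>
  The Hilbert space associated with \<open>G\<close> is the completion of the step functions under the inner
  product determined by letting the indicators of \<open>[0,s]\<close> and \<open>[0,t]\<close> have inner product
  \<open>E[G\<^sub>s G\<^sub>t]\<close>. It is presented as a complete inner product space \<open>'h\<close> in which \<open>ind t\<close> is the class
  of the indicator of \<open>[0,t]\<close> and the span of these classes is dense. The Wiener integral \<open>I\<^sub>1\<close> is the
  linear isometry from \<open>'h\<close> into \<open>L\<^sup>2\<close> sending \<open>ind t\<close> to \<open>G\<^sub>t\<close>; \<open>I\<^sub>1 f\<close> is a representative of its
  value at \<open>f\<close>, so identities between values hold almost surely.
\<close>

locale wiener_integral = gaussian_process M G
  for M :: "'a measure" and G :: "real \<Rightarrow> 'a \<Rightarrow> real" +
  fixes ind :: "real \<Rightarrow> 'h::{real_inner, complete_space}"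
    and I\<^sub>1 :: "'h \<Rightarrow> 'a \<Rightarrow> real"
  assumes inner_ind: "0 \<le> s \<Longrightarrow> 0 \<le> t \<Longrightarrow> ind s \<bullet> ind t = expectation (\<lambda>\<omega>. G s \<omega> * G t \<omega>)"
    and dense_ind: "closure (span (ind ` {0..})) = UNIV"
    and measurable_I: "I\<^sub>1 f \<in> borel_measurable M"
    and square_integrable_I: "integrable M (\<lambda>\<omega>. (I\<^sub>1 f \<omega>)\<^sup>2)"
    and linear_I: "AE \<omega> in M. I\<^sub>1 (a *\<^sub>R f + b *\<^sub>R g) \<omega> = a * I\<^sub>1 f \<omega> + b * I\<^sub>1 g \<omega>"
    and isometry_I: "expectation (\<lambda>\<omega>. (I\<^sub>1 f \<omega>)\<^sup>2) = (norm f)\<^sup>2"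
    and I_ind: "0 \<le> t \<Longrightarrow> AE \<omega> in M. I\<^sub>1 (ind t) \<omega> = G t \<omega>"

definition quad_var :: "'a measure \<Rightarrow> (nat \<Rightarrow> 'a \<Rightarrow> real) \<Rightarrow> nat \<Rightarrow> 'a \<Rightarrow> real" where
  "quad_var M X n \<omega> =
     1 / sqrt (real n) * (\<Sum>i=1..n. (X i \<omega>)\<^sup>2 - integral\<^sup>L M (\<lambda>\<omega>'. (X i \<omega>')\<^sup>2))"

definition quad_var_variance :: "'a measure \<Rightarrow> (nat \<Rightarrow> 'a \<Rightarrow> real) \<Rightarrow> nat \<Rightarrow> real" where
  "quad_var_variance M X n = integral\<^sup>L M (\<lambda>\<omega>. (quad_var M X n \<omega>)\<^sup>2)"

definition normalized_quad_var :: "'a measure \<Rightarrow> (nat \<Rightarrow> 'a \<Rightarrow> real) \<Rightarrow> nat \<Rightarrow> 'a \<Rightarrow> real" where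
  "normalized_quad_var M X n \<omega> = quad_var M X n \<omega> / sqrt (quad_var_variance M X n)"

text \<open>\<open>Y\<close> and \<open>Z\<close> may live on different probability spaces \<open>P\<close> and \<open>Q\<close>.\<close>

definition tv_dist :: "'a measure \<Rightarrow> ('a \<Rightarrow> real) \<Rightarrow> 'b measure \<Rightarrow> ('b \<Rightarrow> real) \<Rightarrow> real" where
  "tv_dist P Y Q Z =
     (SUP A\<in>sets (borel :: real measure).
        \<bar>measure P {\<omega>\<in>space P. Y \<omega> \<in> A} - measure Q {\<omega>\<in>space Q. Z \<omega> \<in> A}\<bar>)"

definition decay_rate :: "real \<Rightarrow> nat \<Rightarrow> real" where
  "decay_rate \<beta> n =
     (if \<beta> = 1/2 then 1
      else if 1/2 < \<beta> \<and> \<beta> < 2/3 then real n powr (3/2 - 3 * \<beta>)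
      else if \<beta> = 2/3 then real n powr (-1/2) * (ln (real n))\<^sup>2
      else real n powr (-1/2))"

end

theory Submission
  imports Defs "HOL-Real_Asymp.Real_Asymp"
begin

text \<open>
  The covariance matrix of \<open>X\<^sub>1, \<dots>, X\<^sub>n\<close> is positive semidefinite, so after diagonalization
  \<open>F\<^sub>n = \<Sum>\<^sub>j l\<^sub>j (Z\<^sub>j\<^sup>2 - 1)\<close> with independent standard normal \<open>Z\<^sub>j\<close>, weights \<open>l\<^sub>j \<ge> 0\<close> and
  \<open>2 \<Sum>\<^sub>j l\<^sub>j\<^sup>2 = 1\<close>. Because the weights are nonnegative, the third cumulant controls the fourth and no
  Malliavin calculus is needed: it is enough to prove the total variation Berry-Esseen bound
  \<open>d\<^sub>T\<^sub>V(F\<^sub>n, N) \<le> C \<Sum>\<^sub>j l\<^sub>j\<^sup>3\<close>.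

  If some weight is bounded below, the bound is trivial. Otherwise the characteristic function \<open>f\<close>
  of \<open>F\<^sub>n\<close>, of modulus \<open>\<Prod>\<^sub>j (1 + 4 l\<^sub>j\<^sup>2 t\<^sup>2)\<^sup>-\<^sup>1\<^sup>/\<^sup>4\<close>, decays like a high power of \<open>1 / (1 + t\<^sup>2)\<close>, and
  \<open>f' / f\<close> differs from \<open>-t\<close> by \<open>O(t\<^sup>2 \<Sum>\<^sub>j l\<^sub>j\<^sup>3)\<close>. Hence the difference of \<open>f\<close> and the normal
  characteristic function is \<open>O(\<Sum>\<^sub>j l\<^sub>j\<^sup>3)\<close> in \<open>L\<^sup>1\<close> together with its second derivative. By
  Fourier inversion the difference of the laws has a density that is \<open>O(\<Sum>\<^sub>j l\<^sub>j\<^sup>3 / (1 + x\<^sup>2))\<close>.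

  Finally \<open>\<Sum>\<^sub>j l\<^sub>j\<^sup>3\<close> is a normalized trace of the cube of the covariance matrix, which the arithmetic-geometric
  mean inequality bounds by \<open>n (\<Sum>\<^sub>|\<^sub>k\<^sub>|\<^sub><\<^sub>n \<rho>(k)\<^sup>3\<^sup>/\<^sup>2)\<^sup>2\<close>.
\<close>

section \<open>Orthogonal diagonalization\<close>

text \<open>A bound on characteristic functions alone controls a density only pointwise, whereas
  total variation needs its L^1 norm. Two derivatives in t buy the factor 1 / (1 + x^2), and this is
  why \<open>\<psi>\<close> and \<open>\<psi>'\<close> are estimated as well. The characteristic
  function of Z^2 is a complex square root. No branch is ever chosen: a differential equation yields
  its logarithmic derivative and its square, hence its modulus. The Gram matrix may be singular, so
  joint normality enters only through the characteristic function of \<open>I\<^sub>1 w\<close>. It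
  turns orthogonality in \<open>'h\<close> into a product formula, from which independence follows.
  The decay of \<open>f\<close> is taken as (1 + t^2)^(-4): polynomial factors in t cost at most
  three of these powers, and the last one gives integrability. The exponent 3/2 arises from writing
  x y z as the product of sqrt(x y), sqrt(y z) and sqrt(z x). As for the power of n, the trace of
  the cube is of order n and is divided by (n v)^(3/2), which leaves n^(-1/2).\<close>

definition orthogonal_on :: "'i set \<Rightarrow> ('i \<times> 'i \<Rightarrow> real) \<Rightarrow> bool" where
  "orthogonal_on A u \<longleftrightarrow>
     (\<forall>i\<in>A. \<forall>k\<in>A. (\<Sum>j\<in>A. u (j, i) * u (j, k)) = of_bool (i = k)) \<and>
     (\<forall>i\<in>A. \<forall>k\<in>A. (\<Sum>j\<in>A. u (i, j) * u (k, j)) = of_bool (i = k))"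

text \<open>Matrices are functions on pairs so that Tychonoff applies to the product topology. The
  box is imposed on all pairs, since orthogonality says nothing about entries outside
  \<open>A\<close>; orthogonality itself is a family of closed polynomial conditions.\<close>

lemma compact_orthogonal_on:
  "compact {u :: 'i \<times> 'i \<Rightarrow> real. orthogonal_on A u \<and> (\<forall>p. u p \<in> {-1..1})}" (is "compact ?K")
proof -
  have "compact (UNIV \<rightarrow>\<^sub>E {-1..1::real} :: ('i \<times> 'i \<Rightarrow> real) set)"
    using compactin_PiE[of "\<lambda>_. euclidean" "UNIV :: ('i \<times> 'i) set" "\<lambda>_. {-1..1::real}"]
    by (simp add: euclidean_product_topology)
  moreover have "closed {u :: 'i \<times> 'i \<Rightarrow> real. orthogonal_on A u}"
  proof -
    have "continuous_on UNIV (\<lambda>u :: 'i \<times> 'i \<Rightarrow> real. \<Sum>j\<in>A. u (f j) * u (g j))" for f g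
      by (intro continuous_intros continuous_on_product_coordinates)
    then have "closed {u :: 'i \<times> 'i \<Rightarrow> real. (\<Sum>j\<in>A. u (f j) * u (g j)) = x}" for f g x
      by (intro closed_Collect_eq) auto
    moreover have "{u :: 'i \<times> 'i \<Rightarrow> real. orthogonal_on A u} =
      (\<Inter>i\<in>A. \<Inter>k\<in>A. {u. (\<Sum>j\<in>A. u (j, i) * u (j, k)) = of_bool (i = k)}) \<inter>
      (\<Inter>i\<in>A. \<Inter>k\<in>A. {u. (\<Sum>j\<in>A. u (i, j) * u (k, j)) = of_bool (i = k)})"
      unfolding orthogonal_on_def by blast
    ultimately show ?thesis by (simp only:) (intro closed_Int closed_INT ballI)
  qed
  ultimately have "compact ((UNIV \<rightarrow>\<^sub>E {-1..1}) \<inter> {u :: 'i \<times> 'i \<Rightarrow> real. orthogonal_on A u})"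
    by (rule compact_Int_closed)
  also have "(UNIV \<rightarrow>\<^sub>E {-1..1}) \<inter> {u. orthogonal_on A u} = ?K" by (auto simp: PiE_def Pi_def)
  finally show ?thesis .
qed

text \<open>The Jacobi rotation diagonalizes the 2 by 2 Gram matrix of \<open>x\<close> and
  \<open>y\<close>. It keeps the sum a + b of the squared norms and replaces (a - b)^2 by (a - b)^2
  + 4 e^2, so 2 (a^2 + b^2) = (a + b)^2 + (a - b)^2 grows strictly.\<close>

lemma rotation_increases_norm_power4:
  fixes x y :: "'h::real_inner"
  assumes "x \<bullet> y \<noteq> 0"
  obtains c s where "c\<^sup>2 + s\<^sup>2 = 1"
    "norm (c *\<^sub>R x + s *\<^sub>R y) ^ 4 + norm (c *\<^sub>R y - s *\<^sub>R x) ^ 4 > norm x ^ 4 + norm y ^ 4"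
proof -
  define a b e where "a = x \<bullet> x" and "b = y \<bullet> y" and "e = x \<bullet> y"
  \<comment> \<open>The gap between the two eigenvalues of the Gram matrix. The rotation acts on
    squared norms and inner products with doubled angle, hence the half angle below.\<close>
  define r where "r = sqrt ((a - b)\<^sup>2 + (2 * e)\<^sup>2)"
  have r2: "r\<^sup>2 = (a - b)\<^sup>2 + (2 * e)\<^sup>2" unfolding r_def by simp
  have "r\<^sup>2 > (a - b)\<^sup>2" using assms r2 by (simp add: e_def)
  then have rpos: "r \<noteq> 0" by auto
  have "((a - b) / r)\<^sup>2 + (2 * e / r)\<^sup>2 = 1"
  proof -
    have "((a - b) / r)\<^sup>2 + (2 * e / r)\<^sup>2 = r\<^sup>2 / r\<^sup>2"
      unfolding power_divide by (subst (3) r2) (simp only: add_divide_distrib)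
    then show ?thesis using rpos by simp
  qed
  then obtain \<phi> where \<phi>: "(a - b) / r = cos \<phi>" "2 * e / r = sin \<phi>"
    using sincos_total_2pi by metis
  define c s where "c = cos (\<phi> / 2)" and "s = sin (\<phi> / 2)"
  have cs: "c\<^sup>2 + s\<^sup>2 = 1" by (simp add: c_def s_def)
  have c2: "cos \<phi> = c\<^sup>2 - s\<^sup>2" and s2: "sin \<phi> = 2 * s * c"
    using cos_double[of "\<phi>/2"] sin_double[of "\<phi>/2"] by (simp_all add: c_def s_def)
  define a' b' where "a' = (norm (c *\<^sub>R x + s *\<^sub>R y))\<^sup>2" and "b' = (norm (c *\<^sub>R y - s *\<^sub>R x))\<^sup>2"
  have a': "a' = c\<^sup>2 * a + s\<^sup>2 * b + 2 * c * s * e" and b': "b' = c\<^sup>2 * b + s\<^sup>2 * a - 2 * c * s * e"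
    unfolding a'_def b'_def power2_norm_eq_inner
    by (simp_all add: a_def b_def e_def inner_simps inner_commute power2_eq_square algebra_simps)
  have sum: "a' + b' = a + b"
  proof -
    have "a' + b' = (c\<^sup>2 + s\<^sup>2) * (a + b)" unfolding a' b' by algebra
    then show ?thesis using cs by simp
  qed
  have diff: "a' - b' = r"
  proof -
    have "a' - b' = (c\<^sup>2 - s\<^sup>2) * (a - b) + (2 * s * c) * (2 * e)" unfolding a' b' by algebra
    also have "\<dots> = ((a - b)\<^sup>2 + (2 * e)\<^sup>2) / r"
      unfolding c2[symmetric] s2[symmetric] \<phi>[symmetric] by (simp add: power2_eq_square add_divide_distrib)
    also have "\<dots> = r" unfolding r2[symmetric] using rpos by (simp add: power2_eq_square)
    finally show ?thesis .
  qed
  have id: "2 * (v\<^sup>2 + w\<^sup>2) = (v + w)\<^sup>2 + (v - w)\<^sup>2" for v w :: real by algebra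
  have "2 * (a\<^sup>2 + b\<^sup>2) < 2 * (a'\<^sup>2 + b'\<^sup>2)"
    unfolding id sum diff using \<open>r\<^sup>2 > (a - b)\<^sup>2\<close> by simp
  then show ?thesis
    using that[of c s] cs by (simp add: a'_def b'_def a_def b_def flip: power2_norm_eq_inner)
qed

text \<open>A variational argument: the sum of the fourth powers of the norms attains its maximum
  over the compact set of orthogonal matrices. At a maximizer no inner product of two distinct
  rotated vectors can be nonzero, because a rotation in their plane would increase the sum.\<close>

theorem orthogonal_diagonalization:
  fixes h :: "'i \<Rightarrow> 'h::real_inner"
  assumes A: "finite A"
  obtains u where "orthogonal_on A u"
    "\<And>p q. p \<in> A \<Longrightarrow> q \<in> A \<Longrightarrow> p \<noteq> q \<Longrightarrow> (\<Sum>i\<in>A. u (p, i) *\<^sub>R h i) \<bullet> (\<Sum>i\<in>A. u (q, i) *\<^sub>R h i) = 0"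
proof -
  define K where "K = {u :: 'i \<times> 'i \<Rightarrow> real. orthogonal_on A u \<and> (\<forall>p. u p \<in> {-1..1})}"
  define w where "w u p = (\<Sum>i\<in>A. u (p, i) *\<^sub>R h i)" for u :: "'i \<times> 'i \<Rightarrow> real" and p
  define \<Phi> where "\<Phi> u = (\<Sum>p\<in>A. norm (w u p) ^ 4)" for u
  have "(\<lambda>(i, j). of_bool (i = j)) \<in> K"
    using A by (auto simp: K_def orthogonal_on_def sum.delta of_bool_def if_distrib[of "\<lambda>x. x * _"] cong: if_cong)
  moreover have "continuous_on K \<Phi>"
    unfolding \<Phi>_def w_def
    by (intro continuous_intros continuous_on_product_coordinates[THEN continuous_on_subset]) auto
  ultimately obtain u where u: "u \<in> K" and max: "\<And>v. v \<in> K \<Longrightarrow> \<Phi> v \<le> \<Phi> u"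
    using continuous_attains_sup[of K \<Phi>] compact_orthogonal_on[of A] unfolding K_def by blast
  have ou: "orthogonal_on A u" using u by (simp add: K_def)
  have "w u p \<bullet> w u q = 0" if pq: "p \<in> A" "q \<in> A" "p \<noteq> q" for p q
  proof (rule ccontr)
    assume "w u p \<bullet> w u q \<noteq> 0"
    from rotation_increases_norm_power4[OF this] obtain c s where cs: "c\<^sup>2 + s\<^sup>2 = 1"
      and gt: "norm (c *\<^sub>R w u p + s *\<^sub>R w u q) ^ 4 + norm (c *\<^sub>R w u q - s *\<^sub>R w u p) ^ 4 > norm (w u p) ^ 4 + norm (w u q) ^ 4"
      by blast
    \<comment> \<open>\<open>u\<close> with rows \<open>p\<close> and \<open>q\<close> rotated.
      Entries outside \<open>A\<close> are set to 0, which keeps \<open>v\<close> in the box of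
      \<open>K\<close>.\<close>
    define v where "v = (\<lambda>(j, i). if j \<in> A \<and> i \<in> A then if j = p then c * u (p, i) + s * u (q, i)
      else if j = q then c * u (q, i) - s * u (p, i) else u (j, i) else 0)"
    define R where "R = A - {p, q}"
    have split: "(\<Sum>j\<in>A. f j) = f p + f q + (\<Sum>j\<in>R. f j)" for f :: "'i \<Rightarrow> real"
      using pq A by (simp add: R_def sum.remove[of A p] sum.remove[of "A - {p}" q] insert_commute Diff_insert2[symmetric])
    have vp: "v (p, i) = c * u (p, i) + s * u (q, i)" and vq: "v (q, i) = c * u (q, i) - s * u (p, i)" if "i \<in> A" for i
      using pq that by (auto simp: v_def)
    have vR: "v (j, i) = u (j, i)" if "j \<in> R" "i \<in> A" for i j
      using that by (auto simp: v_def R_def)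
    have cols: "(\<Sum>j\<in>A. v (j, i) * v (j, k)) = of_bool (i = k)" if "i \<in> A" "k \<in> A" for i k
    proof -
      have "(\<Sum>j\<in>A. v (j, i) * v (j, k)) = (c\<^sup>2 + s\<^sup>2) * (u (p, i) * u (p, k) + u (q, i) * u (q, k)) + (\<Sum>j\<in>R. u (j, i) * u (j, k))"
        unfolding split using that by (simp add: vp vq vR) algebra
      also have "\<dots> = (\<Sum>j\<in>A. u (j, i) * u (j, k))" unfolding split cs by simp
      finally show ?thesis using ou that by (simp add: orthogonal_on_def)
    qed
    define g where "g j k = (\<Sum>i\<in>A. u (j, i) * u (k, i))" for j k
    have g: "g j k = of_bool (j = k)" if "j \<in> A" "k \<in> A" for j k
      using ou that by (simp add: orthogonal_on_def g_def)
    \<comment> \<open>Every row of \<open>v\<close> is a combination of at most two rows of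
      \<open>u\<close>. The common form lets one computation cover all pairs of row types.\<close>
    have rowE: thesis if "j \<in> A"
      and found: "\<And>\<alpha> \<beta> j'. (\<And>i. i \<in> A \<Longrightarrow> v (j, i) = \<alpha> * u (j, i) + \<beta> * u (j', i)) \<Longrightarrow> j' \<in> A \<Longrightarrow>
        j = p \<and> \<alpha> = c \<and> \<beta> = s \<and> j' = q \<or> j = q \<and> \<alpha> = c \<and> \<beta> = -s \<and> j' = p \<or> j \<in> R \<and> \<alpha> = 1 \<and> \<beta> = 0 \<and> j' = j \<Longrightarrow> thesis"
      for j thesis
    proof -
      consider "j = p" | "j = q" | "j \<in> R" using \<open>j \<in> A\<close> by (auto simp: R_def)
      then show thesis
      proof cases
        case 1
        show thesis by (rule found[of c s q]) (use 1 pq vp in auto)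
      next
        case 2
        show thesis by (rule found[of c "-s" p]) (use 2 pq vq in auto)
      next
        case 3
        show thesis by (rule found[of 1 0 j]) (use 3 vR \<open>j \<in> A\<close> in auto)
      qed
    qed
    have rows: "(\<Sum>i\<in>A. v (j, i) * v (k, i)) = of_bool (j = k)" if jk: "j \<in> A" "k \<in> A" for j k
    proof -
      obtain \<alpha> \<beta> j' where j: "\<And>i. i \<in> A \<Longrightarrow> v (j, i) = \<alpha> * u (j, i) + \<beta> * u (j', i)" "j' \<in> A" 
        "j = p \<and> \<alpha> = c \<and> \<beta> = s \<and> j' = q \<or> j = q \<and> \<alpha> = c \<and> \<beta> = -s \<and> j' = p \<or> j \<in> R \<and> \<alpha> = 1 \<and> \<beta> = 0 \<and> j' = j"
        by (rule rowE[OF jk(1)]) (rule that; assumption)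
      obtain \<gamma> \<delta> k' where k: "\<And>i. i \<in> A \<Longrightarrow> v (k, i) = \<gamma> * u (k, i) + \<delta> * u (k', i)" "k' \<in> A" 
        "k = p \<and> \<gamma> = c \<and> \<delta> = s \<and> k' = q \<or> k = q \<and> \<gamma> = c \<and> \<delta> = -s \<and> k' = p \<or> k \<in> R \<and> \<gamma> = 1 \<and> \<delta> = 0 \<and> k' = k"
        by (rule rowE[OF jk(2)]) (rule that; assumption)
      have "(\<Sum>i\<in>A. v (j, i) * v (k, i)) = (\<Sum>i\<in>A. \<alpha> * \<gamma> * (u (j, i) * u (k, i)) + \<alpha> * \<delta> * (u (j, i) * u (k', i))
          + \<beta> * \<gamma> * (u (j', i) * u (k, i)) + \<beta> * \<delta> * (u (j', i) * u (k', i)))"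
        by (rule sum.cong) (simp_all add: j(1) k(1) algebra_simps)
      also have "\<dots> = \<alpha> * \<gamma> * g j k + \<alpha> * \<delta> * g j k' + \<beta> * \<gamma> * g j' k + \<beta> * \<delta> * g j' k'"
        by (simp add: g_def sum.distrib sum_distrib_left)
      also have "\<dots> = of_bool (j = k)"
        using j(2,3) k(2,3) jk pq cs by (auto simp: g R_def power2_eq_square)
      finally show ?thesis .
    qed
    have ov: "orthogonal_on A v" using rows cols by (simp add: orthogonal_on_def)
    have "\<bar>v (j, i)\<bar> \<le> 1" for j i
    proof (cases "j \<in> A \<and> i \<in> A")
      case True
      have "(v (j, i))\<^sup>2 \<le> (\<Sum>i\<in>A. (v (j, i))\<^sup>2)"
        using A True by (intro member_le_sum) auto
      also have "\<dots> = 1" using rows[of j j] True by (simp add: power2_eq_square)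
      finally show ?thesis by (simp add: abs_square_le_1)
    qed (auto simp: v_def)
    then have "v \<in> K" using ov by (auto simp: K_def abs_le_iff minus_le_iff)
    then have "\<Phi> v \<le> \<Phi> u" by (rule max)
    moreover have "w v p = c *\<^sub>R w u p + s *\<^sub>R w u q" "w v q = c *\<^sub>R w u q - s *\<^sub>R w u p"
      by (simp_all add: w_def vp vq scaleR_sum_right scaleR_add_left scaleR_diff_left sum.distrib sum_subtractf)
    moreover have "w v j = w u j" if "j \<in> R" for j
      unfolding w_def by (rule sum.cong) (auto simp: vR that)
    ultimately show False
      using gt unfolding \<Phi>_def split by simp
  qed
  then show ?thesis using that ou by (simp add: w_def)
qed

section \<open>Total variation from characteristic functions\<close>

lemma has_bochner_integral_inverse_one_plus_square:
  "has_bochner_integral lborel (\<lambda>x::real. 1 / (1 + x\<^sup>2)) pi"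
  using integrable_inverse_1_plus_square LBINT_inverse_1_plus_square
  by (simp add: has_bochner_integral_iff interval_lebesgue_integral_def set_lebesgue_integral_def
      set_integrable_def inverse_eq_divide)

text \<open>Integration by parts on the whole line; the boundary terms vanish because
  \<open>g\<close> does. Besides trading derivatives for powers of \<open>x\<close>, it serves at
  \<open>x = 0\<close>, where it says that the integral of a derivative is 0.\<close>

lemma LBINT_iexp_mult_derivative:
  fixes g g' :: "real \<Rightarrow> complex" and x :: real
  assumes g: "\<And>t. (g has_vector_derivative g' t) (at t)"
    and cont: "\<And>t. isCont g' t"
    and int: "integrable lborel g" "integrable lborel g'"
    and lim: "(g \<longlongrightarrow> 0) at_top" "(g \<longlongrightarrow> 0) at_bot"
  shows "(CLBINT t. iexp (-(t * x)) * g' t) = \<i> * x * (CLBINT t. iexp (-(t * x)) * g t)"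
proof -
  have g_cont: "isCont g t" for t
    using g has_vector_derivative_continuous by blast
  define H where "H t = iexp (-(t * x)) * g t" for t
  define H' where "H' t = iexp (-(t * x)) * g' t - \<i> * x * (iexp (-(t * x)) * g t)" for t
  have cmod: "cmod (iexp (-(t * x))) = 1" for t
    using norm_exp_i_times[of "-(t*x)"] by simp
  have int1: "integrable lborel (\<lambda>t. iexp (-(t * x)) * g t)"
    by (rule Bochner_Integration.integrable_bound[OF int(1)]) (use int(1) in \<open>auto simp: norm_mult cmod simp del: of_real_mult of_real_minus\<close>)
  have int2: "integrable lborel (\<lambda>t. iexp (-(t * x)) * g' t)"
    by (rule Bochner_Integration.integrable_bound[OF int(2)]) (use int(2) in \<open>auto simp: norm_mult cmod simp del: of_real_mult of_real_minus\<close>)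
  have intH': "integrable lborel H'"
    unfolding H'_def using int1 int2 by auto
  have deriv: "(H has_vector_derivative H' t) (at t)" for t
  proof -
    have "((\<lambda>t. iexp (-(t * x))) has_vector_derivative (-x) *\<^sub>R (\<i> * iexp (-(t * x)))) (at t)"
      by (rule vector_diff_chain_at[where f="\<lambda>t. -(t * x)" and g=iexp, unfolded o_def])
        (auto intro!: derivative_eq_intros)
    from has_vector_derivative_mult[OF this g[of t]] show ?thesis
      unfolding H_def H'_def by (simp add: scaleR_conv_of_real algebra_simps)
  qed
  have limH: "(H \<longlongrightarrow> 0) F" if "(g \<longlongrightarrow> 0) F" for F
    by (rule Lim_null_comparison[where g="\<lambda>t. norm (g t)"])
      (use that in \<open>auto simp: H_def norm_mult cmod tendsto_norm_zero simp del: of_real_mult of_real_minus\<close>)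
  have "(LBINT t=-\<infinity>..\<infinity>. H' t) = 0 - 0"
  proof (rule interval_integral_FTC_integrable)
    show "((H \<circ> real_of_ereal) \<longlongrightarrow> 0) (at_right (- \<infinity>))"
      using limH[OF lim(2)] by (simp add: ereal_tendsto_simps)
    show "((H \<circ> real_of_ereal) \<longlongrightarrow> 0) (at_left \<infinity>)"
      using limH[OF lim(1)] by (simp add: ereal_tendsto_simps)
    show "isCont H' t" for t
      unfolding H'_def using cont g_cont by (intro continuous_intros) auto
  qed (use deriv intH' in \<open>auto simp: set_integrable_def\<close>)
  then have "(CLBINT t. H' t) = 0"
    by (simp add: interval_lebesgue_integral_def set_lebesgue_integral_def)
  then show ?thesis
    using int1 int2 by (simp add: H'_def)
qed

text \<open>The two Levy inversion formulas are subtracted. Neither characteristic function need be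
  integrable, but the difference is, so the truncated integrals converge to an absolutely convergent
  one. Its kernel is an integral over {a<..b}, and Fubini brings that integral outside.\<close>

lemma measure_Ioc_diff_eq_integral:
  fixes M1 M2 :: "real measure" and a b :: real
  assumes "real_distribution M1" "real_distribution M2"
    and int: "integrable lborel (\<lambda>t. char M1 t - char M2 t)"
    and ab: "a \<le> b"
    and atoms: "measure M1 {a} = 0" "measure M1 {b} = 0" "measure M2 {a} = 0" "measure M2 {b} = 0"
  shows "complex_of_real (measure M1 {a<..b} - measure M2 {a<..b}) =
    (CLBINT x. indicator {a<..b} x * (1 / (2 * pi) * (CLBINT t. iexp (-(t * x)) * (char M1 t - char M2 t))))"
proof -
  interpret M1: real_distribution M1 by fact
  interpret M2: real_distribution M2 by fact
  define d where "d t = char M1 t - char M2 t" for t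
  \<comment> \<open>For nonzero t this is the integral of exp(-i t x) over x in {a<..b}. At t = 0
    the division convention gives 0 instead of b - a, which affects only a null set.\<close>
  define k where "k t = (iexp (-(t * a)) - iexp (-(t * b))) / (\<i> * t)" for t :: real
  have d_meas[measurable]: "d \<in> borel_measurable borel"
    unfolding d_def by measurable
  have k_meas[measurable]: "k \<in> borel_measurable borel"
    unfolding k_def by measurable
  have intd: "integrable lborel d" using int by (simp add: d_def[abs_def])
  have cmod: "cmod (iexp (-(t * x))) = 1" for t x
    using norm_exp_i_times[of "-(t*x)"] by simp
  have kb: "cmod (k t) \<le> b - a" for t
  proof (cases "t = 0")
    case False
    then show ?thesis using Levy_Inversion_aux2[of "-b" "-a" t] ab by (simp add: k_def)
  qed (use ab in \<open>simp add: k_def\<close>)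
  have intkd: "integrable lborel (\<lambda>t. k t * d t)"
  proof (rule Bochner_Integration.integrable_bound[where f="\<lambda>t. (b-a) * norm (d t)"])
    show "AE t in lborel. norm (k t * d t) \<le> norm ((b - a) * cmod (d t))"
      using kb ab by (auto simp: norm_mult mult_right_mono)
  qed (use intd in auto)
  have kint: "(CLBINT x:{a<..b}. iexp (-(t * x))) = k t" if "t \<noteq> 0" for t
  proof -
    have D: "((\<lambda>x. - (iexp (-(t * x)) / (\<i> * t))) has_vector_derivative iexp (-(t * x))) (at x within S)" for x S
    proof -
      have "((\<lambda>x. iexp (-(t * x))) has_vector_derivative (-t) *\<^sub>R (\<i> * iexp (-(t * x)))) (at x within S)"
        by (rule has_vector_derivative_at_within,rule vector_diff_chain_at[where f="\<lambda>x. -(t * x)" and g=iexp, unfolded o_def])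
          (auto intro!: derivative_eq_intros)
      then show ?thesis
        using that by (auto intro!: derivative_eq_intros simp: scaleR_conv_of_real)
    qed
    have "(CLBINT x=a..b. iexp (-(t * x))) = - (iexp (-(t * b)) / (\<i> * t)) - - (iexp (-(t * a)) / (\<i> * t))"
      by (rule interval_integral_FTC_finite) (auto intro!: continuous_intros simp del: of_real_mult of_real_minus intro: D)
    then show ?thesis
      using ab by (simp add: interval_integral_Ioc k_def diff_divide_distrib)
  qed
  have ik: "interval_lebesgue_integrable lborel (- real T) (real T) (\<lambda>t. k t * c t)"
    if "c \<in> borel_measurable borel" "\<And>t. cmod (c t) \<le> 1" for c :: "real \<Rightarrow> complex" and T :: nat
  proof -
    have [measurable]: "c \<in> borel_measurable borel" by fact
    have "set_integrable lborel {- real T<..<real T} (\<lambda>t. k t * c t)"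
      unfolding set_integrable_def
    proof (rule integrableI_bounded_set_indicator[where B="b - a"])
      have "cmod (k t * c t) \<le> b - a" for t
        using mult_mono[OF kb[of t] that(2)[of t]] ab by (simp add: norm_mult)
      then show "AE t in lborel. t \<in> {- real T<..<real T} \<longrightarrow> cmod (k t * c t) \<le> b - a" by simp
    qed auto
    then show ?thesis
      by (simp add: interval_lebesgue_integrable_def)
  qed
  have "(\<lambda>T::nat. 1 / (2 * pi) * (CLBINT t=-real T..real T. k t * char M1 t)
      - 1 / (2 * pi) * (CLBINT t=-real T..real T. k t * char M2 t))
      \<longlonglongrightarrow> complex_of_real (measure M1 {a<..b}) - complex_of_real (measure M2 {a<..b})"
    using M1.Levy_Inversion[OF ab atoms(1,2)] M2.Levy_Inversion[OF ab atoms(3,4)]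
    unfolding k_def by (intro tendsto_diff) auto
  moreover have "(1 / (2 * pi) * (CLBINT t=-real T..real T. k t * char M1 t)
      - 1 / (2 * pi) * (CLBINT t=-real T..real T. k t * char M2 t))
      = 1 / (2 * pi) * (CLBINT t=-real T..real T. k t * d t)" for T :: nat
  proof -
    have "(CLBINT t=-real T..real T. k t * d t) = (CLBINT t=-real T..real T. k t * char M1 t) - (CLBINT t=-real T..real T. k t * char M2 t)"
      using interval_lebesgue_integral_diff(2)[OF ik[of "char M1" T] ik[of "char M2" T]]
      by (simp add: d_def M1.cmod_char_le_1 M2.cmod_char_le_1 right_diff_distrib)
    then show ?thesis by (simp only: right_diff_distrib)
  qed
  ultimately have lim1: "(\<lambda>T::nat. 1 / (2 * pi) * (CLBINT t=-real T..real T. k t * d t))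
      \<longlonglongrightarrow> complex_of_real (measure M1 {a<..b} - measure M2 {a<..b})"
    by simp
  have "(\<lambda>T::nat. CLBINT t. indicator {- real T<..<real T} t *\<^sub>R (k t * d t)) \<longlonglongrightarrow> (CLBINT t. k t * d t)"
  proof (rule integral_dominated_convergence[where w="\<lambda>t. norm (k t * d t)"])
    show "AE t in lborel. (\<lambda>T::nat. indicator {- real T<..<real T} t *\<^sub>R (k t * d t)) \<longlonglongrightarrow> k t * d t"
    proof (rule AE_I2, rule tendsto_eventually)
      fix t :: real
      obtain n where "\<bar>t\<bar> < real n" using reals_Archimedean2 by blast
      then have "t \<in> {- real T<..<real T}" if "T \<ge> n" for T
        using that by auto
      then show "eventually (\<lambda>T. indicator {- real T<..<real T} t *\<^sub>R (k t * d t) = k t * d t) sequentially"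
        by (intro eventually_sequentiallyI[of n]) simp
    qed
  qed (use intkd in \<open>auto split: split_indicator\<close>)
  then have "(\<lambda>T::nat. 1 / (2 * pi) * (CLBINT t=-real T..real T. k t * d t)) \<longlonglongrightarrow> 1 / (2 * pi) * (CLBINT t. k t * d t)"
    by (intro tendsto_intros) (simp add: interval_lebesgue_integral_def set_lebesgue_integral_def)
  from LIMSEQ_unique[OF lim1 this]
  have "complex_of_real (measure M1 {a<..b} - measure M2 {a<..b}) = 1 / (2 * pi) * (CLBINT t. k t * d t)" .
  also have "(CLBINT t. k t * d t) = (CLBINT t. (CLBINT x. indicator {a<..b} x *\<^sub>R (iexp (-(t * x)) * d t)))"
  proof (rule integral_cong_AE)
    have "AE t in lborel. t \<noteq> (0::real)"
      by (rule AE_lborel_singleton)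
    then show "AE t in lborel. k t * d t = (CLBINT x. indicator {a<..b} x *\<^sub>R (iexp (-(t * x)) * d t))"
    proof eventually_elim
      case (elim t)
      show ?case
        using kint[OF elim] by (simp add: set_lebesgue_integral_def flip: mult_scaleR_left)
    qed
  qed auto
  also have "\<dots> = (CLBINT x. (CLBINT t. indicator {a<..b} x *\<^sub>R (iexp (-(t * x)) * d t)))"
  proof (rule lborel_pair.Fubini_integral[symmetric, where f="\<lambda>t x. indicator {a<..b} x *\<^sub>R (iexp (-(t * x)) * d t)"])
    show "integrable (lborel \<Otimes>\<^sub>M lborel) (\<lambda>(t, x). indicator {a<..b} x *\<^sub>R (iexp (-(t * x)) * d t))"
    proof (rule lborel_pair.Fubini_integrable)
      have "(\<integral>x. norm (indicator {a<..b} x *\<^sub>R (iexp (-(t * x)) * d t)) \<partial>lborel)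
          = (\<integral>x. indicator {a<..b} x * norm (d t) \<partial>lborel)" for t
        by (intro Bochner_Integration.integral_cong) (auto simp: norm_mult cmod indicator_def simp del: of_real_mult of_real_minus)
      then have "(\<integral>x. norm (indicator {a<..b} x *\<^sub>R (iexp (-(t * x)) * d t)) \<partial>lborel) = (b - a) * norm (d t)" for t
        using ab by simp
      then show "integrable lborel (\<lambda>t. \<integral>x. norm (case (t, x) of (t, x) \<Rightarrow> indicator {a<..b} x *\<^sub>R (iexp (-(t * x)) * d t)) \<partial>lborel)"
        using intd by simp
      have "integrable lborel (\<lambda>x. indicator {a<..b} x *\<^sub>R (iexp (-(t * x)) * d t))" for t
      proof (rule integrableI_bounded_set_indicator[where B="norm (d t)"])
        show "AE x in lborel. x \<in> {a<..b} \<longrightarrow> cmod (iexp (-(t * x)) * d t) \<le> norm (d t)"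
          by (simp add: norm_mult cmod del: of_real_mult of_real_minus)
      qed (use ab in \<open>auto simp: emeasure_lborel_Ioc\<close>)
      then show "AE t in lborel. integrable lborel (\<lambda>x. case (t, x) of (t, x) \<Rightarrow> indicator {a<..b} x *\<^sub>R (iexp (-(t * x)) * d t))"
        by simp
    qed auto
  qed
  also have "1 / (2 * pi) * \<dots> = (CLBINT x. indicator {a<..b} x * (1 / (2 * pi) * (CLBINT t. iexp (-(t * x)) * d t)))"
    by (subst integral_mult_right_zero[symmetric]) (auto intro!: Bochner_Integration.integral_cong simp: scaleR_conv_of_real indicator_def simp del: of_real_mult of_real_minus)
  finally show ?thesis unfolding d_def .
qed

text \<open>Intervals with endpoints that are not atoms determine everything: the atoms are
  countable, so half-lines are limits of such intervals, and half-lines form an intersection-stable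
  generator of the Borel sets.\<close>

lemma abs_measure_diff_le_integral:
  fixes M1 M2 :: "real measure" and r :: "real \<Rightarrow> real"
  assumes "real_distribution M1" "real_distribution M2"
    and r: "integrable lborel r"
    and Ioc: "\<And>a b. a \<le> b \<Longrightarrow> measure M1 {a} = 0 \<Longrightarrow> measure M1 {b} = 0 \<Longrightarrow>
      measure M2 {a} = 0 \<Longrightarrow> measure M2 {b} = 0 \<Longrightarrow>
      measure M1 {a<..b} - measure M2 {a<..b} = (LBINT x:{a<..b}. r x)"
    and A: "A \<in> sets borel"
  shows "\<bar>measure M1 A - measure M2 A\<bar> \<le> (LBINT x. \<bar>r x\<bar>)"
proof -
  interpret M1: real_distribution M1 by fact
  interpret M2: real_distribution M2 by fact
  have rm[measurable]: "r \<in> borel_measurable borel" using r by auto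
  have si: "set_integrable lborel B r" if "B \<in> sets borel" for B
    unfolding set_integrable_def using r that by (intro integrable_mult_indicator) auto
  have atMost: "measure M1 {..x} - measure M2 {..x} = (LBINT y:{..x}. r y)" for x
  proof -
    have "countable ({x. measure M1 {x} \<noteq> 0} \<union> {x. measure M2 {x} \<noteq> 0})"
      by (intro countable_Un M2.countable_support M1.countable_support)
    then have count: "countable {x. measure M1 {x} \<noteq> 0 \<or> measure M2 {x} \<noteq> 0}"
      by (simp add: Un_def)
    have "\<exists>a. a < min x (- real n) \<and> measure M1 {a} = 0 \<and> measure M2 {a} = 0" for n
      using open_minus_countable[OF count, of "{..< min x (- real n)}"] by (auto simp: lt_ex)
    then obtain a where a: "\<And>n. a n < min x (- real n)" "\<And>n. measure M1 {a n} = 0" "\<And>n. measure M2 {a n} = 0"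
      by metis
    have "\<exists>b. x < b \<and> b < x + 1 / (real n + 1) \<and> measure M1 {b} = 0 \<and> measure M2 {b} = 0" for n
      using open_minus_countable[OF count, of "{x <..< x + 1 / (real n + 1)}"] by auto
    then obtain b where b: "\<And>n. x < b n" "\<And>n. b n < x + 1 / (real n + 1)" "\<And>n. measure M1 {b n} = 0" "\<And>n. measure M2 {b n} = 0"
      by metis
    have ind: "(\<lambda>n. indicator {a n<..b n} y :: real) \<longlonglongrightarrow> indicator {..x} y" for y
    proof (rule tendsto_eventually)
      show "eventually (\<lambda>n. indicator {a n<..b n} y = (indicator {..x} y :: real)) sequentially"
      proof (cases "y \<le> x")
        case True
        obtain m where m: "- y < real m" using reals_Archimedean2 by blast
        have "y \<in> {a n<..b n}" if "n \<ge> m" for n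
          using a(1)[of n] b(1)[of n] that m True by auto
        then show ?thesis using True by (intro eventually_sequentiallyI[of m]) auto
      next
        case False
        obtain m :: nat where m: "1 / (real m + 1) < y - x"
          using False nat_approx_posE[of "y - x"] by (auto simp: add.commute)
        have "y \<notin> {a n<..b n}" if "n \<ge> m" for n
        proof -
          have "1 / (real n + 1) \<le> 1 / (real m + 1)" using that by (simp add: frac_le)
          then show ?thesis using b(2)[of n] m by auto
        qed
        then show ?thesis using False by (intro eventually_sequentiallyI[of m]) auto
      qed
    qed
    have lim: "(\<lambda>n. measure M {a n<..b n}) \<longlonglongrightarrow> measure M {..x}" if "real_distribution M" for M
    proof -
      interpret real_distribution M by fact
      have "(\<lambda>n. integral\<^sup>L M (indicator {a n<..b n} :: real \<Rightarrow> real)) \<longlonglongrightarrow> integral\<^sup>L M (indicator {..x})"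
        by (rule integral_dominated_convergence[where w="\<lambda>_. 1"]) (use ind in auto)
      then show ?thesis by simp
    qed
    have "(\<lambda>n. LBINT y:{a n<..b n}. r y) \<longlonglongrightarrow> (LBINT y:{..x}. r y)"
      unfolding set_lebesgue_integral_def
    proof (rule integral_dominated_convergence[where w="\<lambda>y. \<bar>r y\<bar>"])
      show "AE y in lborel. (\<lambda>n. indicator {a n<..b n} y *\<^sub>R r y) \<longlonglongrightarrow> indicator {..x} y *\<^sub>R r y"
        using ind by (intro AE_I2 tendsto_intros)
    qed (use r in \<open>auto simp: indicator_def\<close>)
    moreover have "(LBINT y:{a n<..b n}. r y) = measure M1 {a n<..b n} - measure M2 {a n<..b n}" for n
      using Ioc[of "a n" "b n"] a[of n] b[of n] by simp
    ultimately have "(\<lambda>n. measure M1 {a n<..b n} - measure M2 {a n<..b n}) \<longlonglongrightarrow> (LBINT y:{..x}. r y)"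
      by simp
    from LIMSEQ_unique[OF tendsto_diff[OF lim[OF assms(1)] lim[OF assms(2)]] this] show ?thesis .
  qed
  have "(\<lambda>n. LBINT y:{..real n}. r y) \<longlonglongrightarrow> (LBINT y. r y)"
    unfolding set_lebesgue_integral_def
  proof (rule integral_dominated_convergence[where w="\<lambda>y. \<bar>r y\<bar>"])
    show "AE y in lborel. (\<lambda>n. indicator {..real n} y *\<^sub>R r y) \<longlonglongrightarrow> r y"
    proof (rule AE_I2, rule tendsto_eventually)
      fix y :: real
      obtain m where m: "y < real m" using reals_Archimedean2 by blast
      show "eventually (\<lambda>n. indicator {..real n} y *\<^sub>R r y = r y) sequentially"
        using m by (intro eventually_sequentiallyI[of m]) auto
    qed
  qed (use r in \<open>auto simp: indicator_def\<close>)
  moreover have "(\<lambda>n. measure M1 {..real n} - measure M2 {..real n}) \<longlonglongrightarrow> 1 - 1"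
    using M1.cdf_lim_infty_prob M2.cdf_lim_infty_prob unfolding cdf_def by (intro tendsto_diff)
  \<comment> \<open>Both laws have mass 1, so \<open>r\<close> integrates to 0. The complement case
    of the induction below relies on this.\<close>
  ultimately have total: "(LBINT y. r y) = 0"
    using LIMSEQ_unique unfolding atMost by fastforce
  have eq: "measure M1 B - measure M2 B = (LBINT y:B. r y)" if "B \<in> sets borel" for B
  proof -
    have "Int_stable (range (\<lambda>x::real. {..x}))"
      by (auto simp: Int_stable_def)
    moreover have "range (\<lambda>x::real. {..x}) \<subseteq> Pow UNIV" by simp
    moreover have "B \<in> sigma_sets UNIV (range (\<lambda>x::real. {..x}))"
      using that by (simp add: borel_eq_atMost)
    ultimately show ?thesis
    proof (induction rule: sigma_sets_induct_disjoint)
      case (compl B)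
      have B[measurable]: "B \<in> sets borel" using compl(1) by (simp add: borel_eq_atMost)
      have "(LBINT y:B. r y) + (LBINT y:UNIV - B. r y) = (LBINT y:(B \<union> (UNIV - B)). r y)"
        by (rule set_integral_Un[symmetric]) (auto intro: si)
      also have "\<dots> = 0" using total by (simp add: set_lebesgue_integral_def)
      finally show ?case
        using compl(2) M1.prob_compl[of B] M2.prob_compl[of B] by auto
    next
      case (union A)
      have A[measurable]: "A i \<in> sets borel" for i using union(2) by (auto simp: borel_eq_atMost)
      have "(\<lambda>i. measure M1 (A i) - measure M2 (A i)) sums (measure M1 (\<Union>i. A i) - measure M2 (\<Union>i. A i))"
        using union(1) by (intro sums_diff M1.finite_measure_UNION M2.finite_measure_UNION) auto
      moreover have "(LBINT y:(\<Union>i. A i). r y) = (\<Sum>i. LBINT y:A i. r y)"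
        using union(1) by (intro lebesgue_integral_countable_add si) (auto simp: disjoint_family_on_def)
      ultimately show ?case
        using union(3) sums_unique by simp
    qed (auto simp: atMost set_lebesgue_integral_def)
  qed
  have "\<bar>LBINT y:A. r y\<bar> \<le> (LBINT y. \<bar>r y\<bar>)"
    unfolding set_lebesgue_integral_def
    by (rule order_trans[OF integral_abs_bound integral_mono])
      (use si[OF A] r in \<open>auto simp: set_integrable_def indicator_def\<close>)
  then show ?thesis using eq[OF A] by simp
qed

text \<open>The difference of the laws has density q / (2 pi) with q the transform of
  \<open>d\<close>, and two integrations by parts give (1 + x^2) |q x| <= K pi. Integrating 1 / (1 +
  x^2) yields the second factor pi. The constant \<open>B\<close> is only qualitative: it makes
  \<open>d1\<close> integrable and vanishing at infinity, so that the second integration by parts is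
  legitimate.\<close>

theorem abs_measure_diff_le_char:
  fixes M1 M2 :: "real measure" and d1 d2 :: "real \<Rightarrow> complex" and B K :: real
  defines "d \<equiv> \<lambda>t. char M1 t - char M2 t"
  assumes M: "real_distribution M1" "real_distribution M2"
    and d1: "\<And>t. (d has_vector_derivative d1 t) (at t)"
    and d2: "\<And>t. (d1 has_vector_derivative d2 t) (at t)"
    and cont: "\<And>t. isCont d2 t"
    and B: "\<And>t. cmod (d1 t) \<le> B / (1 + t\<^sup>2)"
    and K: "\<And>t. cmod (d t) + cmod (d2 t) \<le> K / (1 + t\<^sup>2)"
    and A: "A \<in> sets borel"
  shows "\<bar>measure M1 A - measure M2 A\<bar> \<le> pi * K / 2"
proof -
  interpret M1: real_distribution M1 by fact
  interpret M2: real_distribution M2 by fact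
  note int0 = has_bochner_integral_inverse_one_plus_square
  have int0': "integrable lborel (\<lambda>t. c / (1 + t\<^sup>2))" for c :: real
    using integrable_mult_right[OF integrable.intros[OF int0], of c] by simp
  have Kd: "cmod (d t) \<le> K / (1 + t\<^sup>2)" "cmod (d2 t) \<le> K / (1 + t\<^sup>2)" for t
    using K[of t] norm_ge_zero[of "d t"] norm_ge_zero[of "d2 t"] by linarith+
  have cont_d1: "isCont d1 t" and cont_d: "isCont d t" for t
    using d1 d2 has_vector_derivative_continuous by blast+
  have int: "integrable lborel f" if "\<And>t. isCont f t" "\<And>t. cmod (f t) \<le> c / (1 + t\<^sup>2)" for f :: "real \<Rightarrow> complex" and c
  proof (rule Bochner_Integration.integrable_bound[OF int0'[of c]])
    show "f \<in> borel_measurable lborel"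
      using that(1) by (simp add: borel_measurable_continuous_onI continuous_at_imp_continuous_on)
    show "AE t in lborel. cmod (f t) \<le> norm (c / (1 + t\<^sup>2))"
      by (rule AE_I2, rule order_trans[OF that(2)], subst real_norm_def, rule abs_ge_self)
  qed
  have lim: "(f \<longlongrightarrow> 0) at_top" "(f \<longlongrightarrow> 0) at_bot" if "\<And>t. cmod (f t) \<le> c / (1 + t\<^sup>2)" for f :: "real \<Rightarrow> complex" and c
  proof -
    have "((\<lambda>t::real. c / (1 + t\<^sup>2)) \<longlongrightarrow> 0) at_top" "((\<lambda>t::real. c / (1 + t\<^sup>2)) \<longlongrightarrow> 0) at_bot"
      by real_asymp+
    then show "(f \<longlongrightarrow> 0) at_top" "(f \<longlongrightarrow> 0) at_bot"
      using that by (auto intro!: Lim_null_comparison[where g="\<lambda>t. c / (1 + t\<^sup>2)"])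
  qed
  define q where "q x = (CLBINT t. iexp (-(t * x)) * d t)" for x
  have cmod: "cmod (iexp (-(t * x))) = 1" for t x
    using norm_exp_i_times[of "-(t*x)"] by simp
  have D1: "(CLBINT t. iexp (-(t * x)) * d1 t) = \<i> * x * q x" for x
    unfolding q_def
    by (rule LBINT_iexp_mult_derivative[OF d1 cont_d1 int[OF cont_d Kd(1)] int[OF cont_d1 B] lim[OF Kd(1)]])
  have D2: "(CLBINT t. iexp (-(t * x)) * d2 t) = \<i> * x * (\<i> * x * q x)" for x
    unfolding D1[symmetric]
    by (rule LBINT_iexp_mult_derivative[OF d2 cont int[OF cont_d1 B] int[OF cont Kd(2)] lim[OF B]])
  have qb: "cmod (q x) \<le> K * pi / (1 + x\<^sup>2)" for x
  proof -
    have nq: "cmod (CLBINT t. iexp (-(t * x)) * f t) \<le> (LBINT t. cmod (f t))" for f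
      using integral_norm_bound[of lborel "\<lambda>t. iexp (-(t * x)) * f t"] by (simp add: norm_mult cmod del: of_real_mult of_real_minus)
    \<comment> \<open>The summand with x^2 is, up to sign, the transform of
      \<open>d2\<close>.\<close>
    have "(1 + x\<^sup>2) * cmod (q x) = cmod (q x) + cmod (CLBINT t. iexp (-(t * x)) * d2 t)"
      unfolding D2 by (simp add: norm_mult algebra_simps power2_eq_square)
    also have "\<dots> \<le> (LBINT t. cmod (d t)) + (LBINT t. cmod (d2 t))"
      using nq[of d] nq[of d2] by (auto simp: q_def)
    also have "\<dots> = (LBINT t. cmod (d t) + cmod (d2 t))"
      using int[OF cont_d Kd(1)] int[OF cont Kd(2)] by (intro Bochner_Integration.integral_add[symmetric]) auto
    also have "\<dots> \<le> (LBINT t. K / (1 + t\<^sup>2))"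
      using int[OF cont_d Kd(1)] int[OF cont Kd(2)] int0' K by (intro integral_mono) auto
    also have "\<dots> = K * pi"
      using has_bochner_integral_integral_eq[OF has_bochner_integral_mult_right[OF int0, of K]] by simp
    finally show ?thesis
      by (simp add: field_simps add_pos_nonneg)
  qed
  have q_meas[measurable]: "q \<in> borel_measurable borel"
  proof -
    have [measurable]: "d \<in> borel_measurable borel"
      using cont_d by (simp add: borel_measurable_continuous_onI continuous_at_imp_continuous_on)
    show ?thesis unfolding q_def by measurable
  qed
  \<comment> \<open>Differences of measures are real, so the real part of the inversion formula
    suffices and \<open>q\<close> need not be shown to be real.\<close>
  define r where "r x = Re (q x) / (2 * pi)" for x
  have rb: "\<bar>r x\<bar> \<le> (K / 2) / (1 + x\<^sup>2)" for x
  proof -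
    have "\<bar>r x\<bar> = \<bar>Re (q x)\<bar> / (2 * pi)" by (simp add: r_def)
    also have "\<dots> \<le> (K * pi / (1 + x\<^sup>2)) / (2 * pi)"
      by (intro divide_right_mono order_trans[OF abs_Re_le_cmod qb]) simp
    finally show ?thesis by (simp add: mult.commute)
  qed
  have intr: "integrable lborel r"
  proof (rule Bochner_Integration.integrable_bound[OF int0'[of "K/2"]])
    show "AE x in lborel. norm (r x) \<le> norm ((K / 2) / (1 + x\<^sup>2))"
      unfolding real_norm_def by (rule AE_I2, rule order_trans[OF rb abs_ge_self])
  qed (auto simp: r_def[abs_def])
  have intq: "integrable lborel q"
  proof (rule Bochner_Integration.integrable_bound[OF int0'[of "K * pi"]])
    show "AE x in lborel. cmod (q x) \<le> norm (K * pi / (1 + x\<^sup>2))"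
      unfolding real_norm_def by (rule AE_I2, rule order_trans[OF qb abs_ge_self])
  qed auto
  have "\<bar>measure M1 A - measure M2 A\<bar> \<le> (LBINT x. \<bar>r x\<bar>)"
  proof (rule abs_measure_diff_le_integral[OF M intr _ A])
    fix a b :: real assume ab: "a \<le> b" "measure M1 {a} = 0" "measure M1 {b} = 0" "measure M2 {a} = 0" "measure M2 {b} = 0"
    have "complex_of_real (measure M1 {a<..b} - measure M2 {a<..b}) =
      (CLBINT x. indicator {a<..b} x * (1 / (2 * pi) * q x))"
      using measure_Ioc_diff_eq_integral[OF M int[OF cont_d Kd(1), unfolded d_def] ab]
      unfolding q_def d_def by simp
    then have "measure M1 {a<..b} - measure M2 {a<..b} = Re (CLBINT x. indicator {a<..b} x * (1 / (2 * pi) * q x))"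
      by (metis Re_complex_of_real)
    also have "(\<lambda>x. indicator {a<..b} x * (1 / (2 * pi) * q x)) = (\<lambda>x. indicator {a<..b} x *\<^sub>R (1 / (2 * pi) * q x))"
      by (auto simp: indicator_def)
    also have "Re (CLBINT x. indicator {a<..b} x *\<^sub>R (1 / (2 * pi) * q x)) = (LBINT x. Re (indicator {a<..b} x *\<^sub>R (1 / (2 * pi) * q x)))"
      by (rule integral_Re[symmetric], rule integrable_mult_indicator) (use intq in auto)
    also have "\<dots> = (LBINT x:{a<..b}. r x)"
      unfolding set_lebesgue_integral_def by (intro Bochner_Integration.integral_cong) (auto simp: r_def)
    finally show "measure M1 {a<..b} - measure M2 {a<..b} = (LBINT x:{a<..b}. r x)" .
  qed
  also have "\<dots> \<le> (LBINT x. (K / 2) / (1 + x\<^sup>2))"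
    by (rule integral_mono[OF integrable_abs[OF intr] int0' rb])
  also have "\<dots> = pi * K / 2"
    using has_bochner_integral_integral_eq[OF has_bochner_integral_mult_right[OF int0, of "K/2"]] by simp
  finally show ?thesis .
qed

section \<open>Weighted sums of centred chi-squares\<close>

text \<open>The characteristic function of Z^2 for standard normal Z, that is, (1 - 2 i t)^(-1/2).
  Taking it as an expectation avoids choosing a branch of the square root.\<close>

definition square_char :: "real \<Rightarrow> complex" where
  "square_char t = (CLINT x|std_normal_distribution. iexp (t * x\<^sup>2))"

lemma integrable_std_normal_power_iexp:
  "integrable std_normal_distribution (\<lambda>x. of_real (x ^ k) * iexp (t * x\<^sup>2))"
proof (rule Bochner_Integration.integrable_bound[OF integrable_std_normal_distribution_moment[of k]])
  show "AE x in std_normal_distribution. cmod (of_real (x ^ k) * iexp (t * x\<^sup>2)) \<le> norm (x ^ k)"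
    using norm_exp_i_times[of "t * x\<^sup>2" for x] by (simp add: norm_mult del: of_real_mult of_real_power)
qed simp

text \<open>Differentiation under the expectation through the Taylor remainder: pointwise it is at
  most x^4 h^2 / 2, and the fourth moment 3 turns this into 3/2 h^2 = o(h).\<close>

lemma square_char_has_vector_derivative_expectation:
  "(square_char has_vector_derivative (CLINT x|std_normal_distribution. \<i> * of_real (x\<^sup>2) * iexp (t * x\<^sup>2))) (at t)"
  (is "(_ has_vector_derivative ?D) _")
proof -
  interpret real_distribution std_normal_distribution by (rule real_dist_normal_dist)
  have int: "integrable std_normal_distribution (\<lambda>x. iexp (s * x\<^sup>2))" for s
    using integrable_std_normal_power_iexp[of 0 s] by simp
  have int2: "integrable std_normal_distribution (\<lambda>x. \<i> * of_real (x\<^sup>2) * iexp (t * x\<^sup>2))"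
    using integrable_mult_right[OF integrable_std_normal_power_iexp[of 2 t], of \<i>] by (simp add: mult.assoc)
  have int4: "integrable std_normal_distribution (\<lambda>x. x ^ 4 * c)" for c
    using integrable_std_normal_distribution_moment[of 4] by simp
  have bound: "cmod (square_char s - square_char t - (s - t) *\<^sub>R ?D) \<le> 3 / 2 * (s - t)\<^sup>2" for s
  proof -
    define h where "h = s - t"
    have pt: "cmod (iexp (s * x\<^sup>2) - iexp (t * x\<^sup>2) - h *\<^sub>R (\<i> * of_real (x\<^sup>2) * iexp (t * x\<^sup>2))) \<le> x ^ 4 * (h\<^sup>2 / 2)" for x
    proof -
      have "iexp (s * x\<^sup>2) = iexp (t * x\<^sup>2) * iexp (h * x\<^sup>2)"
        by (simp add: h_def algebra_simps flip: exp_add)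
      then have "iexp (s * x\<^sup>2) - iexp (t * x\<^sup>2) - h *\<^sub>R (\<i> * of_real (x\<^sup>2) * iexp (t * x\<^sup>2))
        = iexp (t * x\<^sup>2) * (iexp (h * x\<^sup>2) - (\<Sum>k\<le>1. (\<i> * (h * x\<^sup>2)) ^ k / fact k))"
        by (simp add: scaleR_conv_of_real algebra_simps)
      then have "cmod (iexp (s * x\<^sup>2) - iexp (t * x\<^sup>2) - h *\<^sub>R (\<i> * of_real (x\<^sup>2) * iexp (t * x\<^sup>2)))
        = cmod (iexp (h * x\<^sup>2) - (\<Sum>k\<le>1. (\<i> * (h * x\<^sup>2)) ^ k / fact k))"
        using norm_exp_i_times[of "t * x\<^sup>2"] by (simp add: norm_mult del: of_real_mult of_real_power)
      also have "\<dots> \<le> \<bar>h * x\<^sup>2\<bar> ^ Suc 1 / fact (Suc 1)"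
        using iexp_approx1[of "h * x\<^sup>2" 1] by simp
      also have "\<dots> = x ^ 4 * (h\<^sup>2 / 2)"
        by (simp add: power2_eq_square power4_eq_xxxx abs_mult) 
      finally show ?thesis .
    qed
    have eq: "square_char s - square_char t - h *\<^sub>R ?D =
      (CLINT x|std_normal_distribution. iexp (s * x\<^sup>2) - iexp (t * x\<^sup>2) - h *\<^sub>R (\<i> * of_real (x\<^sup>2) * iexp (t * x\<^sup>2)))"
      unfolding square_char_def using int int2
      by (subst Bochner_Integration.integral_diff, simp, simp, subst Bochner_Integration.integral_diff, simp, simp) simp
    have "cmod (square_char s - square_char t - h *\<^sub>R ?D) \<le> (LINT x|std_normal_distribution. cmod (iexp (s * x\<^sup>2) - iexp (t * x\<^sup>2) - h *\<^sub>R (\<i> * of_real (x\<^sup>2) * iexp (t * x\<^sup>2))))"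
      unfolding eq by (rule integral_norm_bound)
    also have "\<dots> \<le> (LINT x|std_normal_distribution. x ^ 4 * (h\<^sup>2 / 2))"
    proof (rule integral_mono)
      have "integrable std_normal_distribution (\<lambda>x. iexp (s * x\<^sup>2) - iexp (t * x\<^sup>2))"
        by (rule Bochner_Integration.integrable_diff) (rule int)+
      moreover have "integrable std_normal_distribution (\<lambda>x. h *\<^sub>R (\<i> * of_real (x\<^sup>2) * iexp (t * x\<^sup>2)))"
        using int2 by (rule integrable_scaleR_right)
      ultimately have "integrable std_normal_distribution (\<lambda>x. iexp (s * x\<^sup>2) - iexp (t * x\<^sup>2) - h *\<^sub>R (\<i> * of_real (x\<^sup>2) * iexp (t * x\<^sup>2)))"
        by (rule Bochner_Integration.integrable_diff)
      then show "integrable std_normal_distribution (\<lambda>x. cmod (iexp (s * x\<^sup>2) - iexp (t * x\<^sup>2) - h *\<^sub>R (\<i> * of_real (x\<^sup>2) * iexp (t * x\<^sup>2))))"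
        by (rule integrable_norm)
      show "integrable std_normal_distribution (\<lambda>x. x ^ 4 * (h\<^sup>2 / 2))" by (rule int4)
      show "cmod (iexp (s * x\<^sup>2) - iexp (t * x\<^sup>2) - h *\<^sub>R (\<i> * of_real (x\<^sup>2) * iexp (t * x\<^sup>2))) \<le> x ^ 4 * (h\<^sup>2 / 2)" for x
        by (rule pt)
    qed
    also have "\<dots> = 3 / 2 * h\<^sup>2"
      using std_normal_distribution_even_moments(1)[of 2]
      by (simp add: fact_numeral del: integral_density)
    finally show ?thesis unfolding h_def .
  qed
  have "((\<lambda>s. (1 / \<bar>s - t\<bar>) *\<^sub>R (square_char s - (square_char t + (s - t) *\<^sub>R ?D))) \<longlongrightarrow> 0) (at t)"
  proof (rule Lim_null_comparison[where g="\<lambda>s. 3 / 2 * \<bar>s - t\<bar>"])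
    have "cmod ((1 / \<bar>s - t\<bar>) *\<^sub>R (square_char s - (square_char t + (s - t) *\<^sub>R ?D))) \<le> 3 / 2 * \<bar>s - t\<bar>" if "s \<noteq> t" for s
    proof -
      have "cmod ((1 / \<bar>s - t\<bar>) *\<^sub>R (square_char s - (square_char t + (s - t) *\<^sub>R ?D))) =
        (1 / \<bar>s - t\<bar>) * cmod (square_char s - square_char t - (s - t) *\<^sub>R ?D)"
        unfolding norm_scaleR diff_diff_eq by simp
      also have "\<dots> \<le> (1 / \<bar>s - t\<bar>) * (3 / 2 * (s - t)\<^sup>2)"
        by (intro mult_left_mono bound) simp
      also have "\<dots> = 3 / 2 * \<bar>s - t\<bar>"
        using that power2_abs[of "s - t"] by (simp add: power2_eq_square field_simps)
      finally show ?thesis .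
    qed
    then show "\<forall>\<^sub>F s in at t. cmod ((1 / \<bar>s - t\<bar>) *\<^sub>R (square_char s - (square_char t + (s - t) *\<^sub>R ?D))) \<le> 3 / 2 * \<bar>s - t\<bar>"
      by (auto simp: eventually_at_filter)
    show "((\<lambda>s. 3 / 2 * \<bar>s - t\<bar>) \<longlongrightarrow> 0) (at t)"
      by (auto intro!: tendsto_eq_intros)
  qed
  then show ?thesis
    unfolding has_vector_derivative_def has_derivative_at2 by (simp add: bounded_linear_scaleR_left)
qed

text \<open>Stein's identity for the test function x exp(i t x^2): the derivative of x w(x) exp(i t
  x^2), with w the normal density, is (1 - (1 - 2 i t) x^2) w(x) exp(i t x^2), and its integral over
  the line vanishes.\<close>

lemma square_char_integration_by_parts:
  "square_char t = (1 - 2 * \<i> * t) * (CLINT x|std_normal_distribution. of_real (x\<^sup>2) * iexp (t * x\<^sup>2))"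
proof -
  define w where "w x = std_normal_density x" for x
  define c where "c = 1 / sqrt (2 * pi)"
  have w: "w x = exp (- x\<^sup>2 / 2) * c" for x
    by (simp add: w_def c_def std_normal_density_def)
  have wD: "(w has_real_derivative - x * w x) (at x)" for x
    unfolding w[abs_def] by (auto intro!: derivative_eq_intros)
  define g where "g x = (x * w x) *\<^sub>R iexp (t * x\<^sup>2)" for x
  define g' where "g' x = (w x - x\<^sup>2 * w x) *\<^sub>R iexp (t * x\<^sup>2) + (x * w x) *\<^sub>R ((2 * t * x) *\<^sub>R (\<i> * iexp (t * x\<^sup>2)))" for x
  have cm: "cmod (iexp (t * x\<^sup>2)) = 1" for x
    using norm_exp_i_times[of "t * x\<^sup>2"] by simp
  have dens: "integrable lborel (\<lambda>x. w x *\<^sub>R (of_real (x ^ k) * iexp (t * x\<^sup>2)))" for k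
    using integrable_std_normal_power_iexp[of k t]
    by (subst (asm) integrable_density) (auto simp: w_def normal_density_nonneg)
  have deq: "(CLINT x|std_normal_distribution. of_real (x ^ k) * iexp (t * x\<^sup>2)) = (CLBINT x. w x *\<^sub>R (of_real (x ^ k) * iexp (t * x\<^sup>2)))" for k
    unfolding w_def by (subst integral_density) (auto simp: normal_density_nonneg)
  have g'_eq: "g' = (\<lambda>x. w x *\<^sub>R (of_real (x ^ 0) * iexp (t * x\<^sup>2)) - (1 - 2 * \<i> * t) * (w x *\<^sub>R (of_real (x ^ 2) * iexp (t * x\<^sup>2))))"
    by (rule ext) (simp add: g'_def scaleR_conv_of_real algebra_simps power2_eq_square)
  have "(CLBINT x. iexp (-(x * 0)) * g' x) = \<i> * of_real 0 * (CLBINT x. iexp (-(x * 0)) * g x)"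
  proof (rule LBINT_iexp_mult_derivative)
    have "((\<lambda>x. iexp (t * x\<^sup>2)) has_vector_derivative (2 * t * x) *\<^sub>R (\<i> * iexp (t * x\<^sup>2))) (at x)" for x
      by (rule vector_diff_chain_at[where f="\<lambda>x. t * x\<^sup>2" and g=iexp, unfolded o_def])
        (auto intro!: derivative_eq_intros simp flip: has_real_derivative_iff_has_vector_derivative)
    moreover have "((\<lambda>x. x * w x) has_real_derivative w x - x\<^sup>2 * w x) (at x)" for x
      using wD[of x] by (auto intro!: derivative_eq_intros simp: power2_eq_square)
    ultimately show "(g has_vector_derivative g' x) (at x)" for x
      using has_vector_derivative_scaleR unfolding g_def g'_def add.commute[of "(w x - x\<^sup>2 * w x) *\<^sub>R iexp (t * x\<^sup>2)"] by blast
    have "isCont w x" for x using wD DERIV_isCont by blast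
    then show "isCont g' x" for x
      unfolding g'_def by (intro continuous_intros)
    show "integrable lborel g"
      using dens[of 1] by (simp add: g_def[abs_def] scaleR_conv_of_real mult_ac)
    show "integrable lborel g'"
      unfolding g'_eq using dens[of 0] dens[of 2] by (intro Bochner_Integration.integrable_diff integrable_mult_right)
    have ng: "cmod (g x) = \<bar>x * w x\<bar>" for x by (simp add: g_def cm del: of_real_mult of_real_power)
    have "((\<lambda>x. x * w x) \<longlongrightarrow> 0) at_top" "((\<lambda>x. x * w x) \<longlongrightarrow> 0) at_bot"
      unfolding w by real_asymp+
    then show "(g \<longlongrightarrow> 0) at_top" "(g \<longlongrightarrow> 0) at_bot"
      using tendsto_rabs_zero
      by (safe intro!: Lim_null_comparison[where f=g and g="\<lambda>x. \<bar>x * w x\<bar>"] eventuallyI eq_refl[OF ng])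
  qed
  then have "(CLBINT x. g' x) = 0" by simp
  then have "(CLBINT x. w x *\<^sub>R (of_real (x ^ 0) * iexp (t * x\<^sup>2))) = (1 - 2 * \<i> * t) * (CLBINT x. w x *\<^sub>R (of_real (x ^ 2) * iexp (t * x\<^sup>2)))"
    unfolding g'_eq using dens[of 0] dens[of 2]
    by (subst (asm) Bochner_Integration.integral_diff[OF _ integrable_mult_right]) (simp_all only: integral_mult_right_zero right_minus_eq)
  then show ?thesis
    unfolding deq[symmetric] square_char_def by simp
qed

lemma one_minus_2it_nonzero [simp]: "1 - 2 * \<i> * complex_of_real t \<noteq> 0"
  by (simp add: complex_eq_iff)

text \<open>Eliminating the expectation of x^2 exp(i t x^2) from the two preceding facts leaves a
  linear differential equation.\<close>

lemma square_char_has_vector_derivative: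
  "(square_char has_vector_derivative \<i> * square_char t / (1 - 2 * \<i> * t)) (at t)"
proof -
  define m where "m = 1 - 2 * \<i> * complex_of_real t"
  have "m \<noteq> 0" unfolding m_def by (rule one_minus_2it_nonzero)
  then have "(CLINT x|std_normal_distribution. \<i> * of_real (x\<^sup>2) * iexp (t * x\<^sup>2)) = \<i> * square_char t / (1 - 2 * \<i> * t)"
    unfolding square_char_integration_by_parts[of t] mult.assoc integral_mult_right_zero
    unfolding mult.assoc[symmetric] m_def[symmetric] by simp
  then show ?thesis using square_char_has_vector_derivative_expectation[of t] by simp
qed

lemma square_char_0: "square_char 0 = 1"
proof -
  interpret real_distribution std_normal_distribution by (rule real_dist_normal_dist)
  show ?thesis using prob_space by (simp add: square_char_def)
qed

text \<open>By the differential equation the product of the square with 1 - 2 i t has derivative 0,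
  and it equals 1 at the origin. The square already determines the modulus.\<close>

lemma square_char_power2: "(square_char t)\<^sup>2 = 1 / (1 - 2 * \<i> * t)"
proof -
  define A where "A s = (square_char s * square_char s) * (1 - 2 * \<i> * complex_of_real s)" for s
  have lin: "((\<lambda>s. 1 - 2 * \<i> * complex_of_real s) has_vector_derivative - 2 * \<i>) (at s)" for s
    by (auto intro!: derivative_eq_intros)
  have "(A has_vector_derivative 0) (at s)" for s
  proof -
    define m where "m = 1 - 2 * \<i> * complex_of_real s"
    have "m \<noteq> 0" unfolding m_def by (rule one_minus_2it_nonzero)
    then have "square_char s * square_char s * (- 2 * \<i>) + (square_char s * (\<i> * square_char s / m) + \<i> * square_char s / m * square_char s) * m = 0"
      by (simp add: field_simps)
    then show ?thesis
      using has_vector_derivative_mult[OF has_vector_derivative_mult[OF square_char_has_vector_derivative square_char_has_vector_derivative] lin[of s]]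
      unfolding A_def m_def by simp
  qed
  then obtain k where "A s = k" for s
    by (rule has_vector_derivative_zero_constant[of UNIV A, OF convex_UNIV]) auto
  then have "A t = A 0" by simp
  then show ?thesis
    using eq_divide_imp[OF one_minus_2it_nonzero[of t], of "square_char t * square_char t" 1]
    by (simp add: A_def square_char_0 power2_eq_square)
qed

lemma norm_square_char_power4: "cmod (square_char t) ^ 4 = 1 / (1 + 4 * t\<^sup>2)"
proof -
  have "cmod (square_char t) ^ 4 = (cmod ((square_char t)\<^sup>2))\<^sup>2"
    by (simp add: norm_power)
  also have "\<dots> = 1 / (cmod (1 - 2 * \<i> * t))\<^sup>2"
    by (simp add: square_char_power2 norm_divide power_divide)
  also have "(cmod (1 - 2 * \<i> * t))\<^sup>2 = 1 + 4 * t\<^sup>2"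
    unfolding cmod_power2 by (simp add: power2_eq_square)
  finally show ?thesis .
qed

lemma norm_one_minus_2it_ge_1: "1 \<le> cmod (1 - 2 * \<i> * complex_of_real t)"
  using abs_Re_le_cmod[of "1 - 2 * \<i> * complex_of_real t"] by simp

text \<open>Monotonicity of the single factors of |f t|^4 exp(2 t^2).\<close>

lemma exp_divide_one_plus_mono:
  fixes x y :: real
  assumes "0 \<le> x" "x \<le> y"
  shows "exp x / (1 + x) \<le> exp y / (1 + y)"
proof -
  have "1 + y \<le> (1 + x) * (1 + (y - x))"
    using mult_nonneg_nonneg[of x "y - x"] assms by (simp add: algebra_simps)
  also have "\<dots> \<le> (1 + x) * exp (y - x)"
    using assms exp_ge_add_one_self[of "y - x"] by (intro mult_left_mono) auto
  finally have "exp x * (1 + y) \<le> exp x * ((1 + x) * exp (y - x))"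
    by (intro mult_left_mono) auto
  also have "\<dots> = exp y * (1 + x)" by (simp add: exp_diff)
  finally show ?thesis using assms by (simp add: field_simps)
qed

section \<open>Berry-Esseen bound in total variation for weighted chi-square sums\<close>

locale chi_square_weights =
  fixes A :: "'i set" and l :: "'i \<Rightarrow> real"
  assumes finite_A: "finite A"
    and nonneg: "\<And>j. j \<in> A \<Longrightarrow> 0 \<le> l j"
    and variance_1: "(\<Sum>j\<in>A. 2 * (l j)\<^sup>2) = 1"
begin

text \<open>Since Z^2 - 1 has variance 2 and third cumulant 8, \<open>variance_1\<close> makes the
  weighted sum have unit variance, and 8 \<open>L\<close> is its third cumulant.\<close>

definition L :: real where "L = (\<Sum>j\<in>A. l j ^ 3)"

text \<open>The characteristic function of \<open>\<Sum>j\<in>A. l j * (Z\<^sub>j\<^sup>2 - 1)\<close> for independent standard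
  normal \<open>Z\<^sub>j\<close>; \<open>\<psi>\<close> is its logarithmic derivative.\<close>

definition f :: "real \<Rightarrow> complex" where
  "f t = (\<Prod>j\<in>A. square_char (l j * t) * iexp (-(l j * t)))"

definition \<psi> :: "real \<Rightarrow> complex" where
  "\<psi> t = (\<Sum>j\<in>A. - (2 * (l j)\<^sup>2 * t) / (1 - 2 * \<i> * of_real (l j * t)))"

definition \<psi>' :: "real \<Rightarrow> complex" where
  "\<psi>' t = (\<Sum>j\<in>A. - (2 * (l j)\<^sup>2) / (1 - 2 * \<i> * of_real (l j * t))\<^sup>2)"

lemma L_nonneg: "0 \<le> L"
  unfolding L_def by (intro sum_nonneg zero_le_power nonneg)

lemma variance_1_complex: "(\<Sum>j\<in>A. complex_of_real (2 * (l j)\<^sup>2)) = 1"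
  using arg_cong[OF variance_1, of complex_of_real] by (simp only: of_real_sum of_real_1)

lemma f_0: "f 0 = 1"
  by (simp add: f_def square_char_0)

text \<open>For one factor the centring cancels the constant term of the logarithmic derivative:
  with m = 1 - 2 i l t one has i l / m - i l = - 2 l^2 t / m.\<close>

lemma f_has_vector_derivative: "(f has_vector_derivative f t * \<psi> t) (at t)"
proof -
  define a where "a j t = square_char (l j * t) * iexp (-(l j * t))" for j t
  define c where "c j t = - (2 * (l j)\<^sup>2 * t) / (1 - 2 * \<i> * of_real (l j * t))" for j t
  have a: "(a j has_vector_derivative a j t * c j t) (at t)" for j t
  proof -
    define m where "m = 1 - 2 * \<i> * complex_of_real (l j * t)"
    have m: "m \<noteq> 0" unfolding m_def by (rule one_minus_2it_nonzero)
    have "((\<lambda>t. square_char (l j * t)) has_vector_derivative l j *\<^sub>R (\<i> * square_char (l j * t) / m)) (at t)"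
      unfolding m_def
      by (rule vector_diff_chain_at[where f="\<lambda>t. l j * t" and g=square_char, unfolded o_def, OF _ square_char_has_vector_derivative])
        (auto intro!: derivative_eq_intros simp flip: has_real_derivative_iff_has_vector_derivative)
    moreover have "((\<lambda>t. iexp (-(l j * t))) has_vector_derivative (- l j) *\<^sub>R (\<i> * iexp (-(l j * t)))) (at t)"
      by (rule vector_diff_chain_at[where f="\<lambda>t. -(l j * t)" and g=iexp, unfolded o_def])
        (auto intro!: derivative_eq_intros simp flip: has_real_derivative_iff_has_vector_derivative)
    ultimately have *: "(a j has_vector_derivative
        square_char (l j * t) * ((- l j) *\<^sub>R (\<i> * iexp (-(l j * t)))) + l j *\<^sub>R (\<i> * square_char (l j * t) / m) * iexp (-(l j * t))) (at t)"
      unfolding a_def by (rule has_vector_derivative_mult)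
    have "- complex_of_real (l j) * \<i> + l j * \<i> / m = c j t"
      using m by (simp add: c_def m_def[symmetric] field_simps) (simp add: m_def algebra_simps power2_eq_square)
    moreover have "square_char (l j * t) * ((- l j) *\<^sub>R (\<i> * iexp (-(l j * t)))) + l j *\<^sub>R (\<i> * square_char (l j * t) / m) * iexp (-(l j * t))
      = a j t * (- complex_of_real (l j) * \<i> + l j * \<i> / m)"
      unfolding a_def scaleR_conv_of_real by (simp add: algebra_simps del: of_real_mult of_real_minus) simp
    ultimately show ?thesis using * by simp
  qed
  have "((\<lambda>t. \<Prod>j\<in>B. a j t) has_vector_derivative (\<Prod>j\<in>B. a j t) * (\<Sum>j\<in>B. c j t)) (at t)" if "finite B" for B
    using that
  proof induction
    case (insert j B)
    have eq: "a j t * ((\<Prod>j\<in>B. a j t) * (\<Sum>j\<in>B. c j t)) + a j t * c j t * (\<Prod>j\<in>B. a j t) = (a j t * (\<Prod>j\<in>B. a j t)) * (c j t + (\<Sum>j\<in>B. c j t))"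
      by (simp only: algebra_simps)
    show ?case
      using has_vector_derivative_mult[OF a[of j t] insert.IH] insert.hyps unfolding eq by simp
  qed simp
  from this[OF finite_A] show ?thesis
    unfolding f_def \<psi>_def a_def c_def .
qed

lemma \<psi>_has_vector_derivative: "(\<psi> has_vector_derivative \<psi>' t) (at t)"
  unfolding \<psi>_def \<psi>'_def
proof (rule has_vector_derivative_sum)
  fix j
  define k where "k = complex_of_real (l j)"
  have nz: "1 - 2 * \<i> * (k * complex_of_real s) \<noteq> 0" for s
    using one_minus_2it_nonzero[of "l j * s"] by (simp add: k_def mult.assoc)
  have "((\<lambda>z. - (2 * k\<^sup>2 * z) / (1 - 2 * \<i> * (k * z))) has_field_derivative
      - (2 * k\<^sup>2) / (1 - 2 * \<i> * (k * of_real t))\<^sup>2) (at (of_real t))"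
    using nz[of t] by (auto intro!: derivative_eq_intros simp: power2_eq_square field_simps)
  from has_vector_derivative_real_field[OF this]
  show "((\<lambda>t. of_real (- (2 * (l j)\<^sup>2 * t)) / (1 - 2 * \<i> * of_real (l j * t))) has_vector_derivative
    of_real (- (2 * (l j)\<^sup>2)) / (1 - 2 * \<i> * of_real (l j * t))\<^sup>2) (at t)"
    by (simp add: k_def o_def)
qed

lemma isCont_\<psi>': "isCont \<psi>' t"
  unfolding \<psi>'_def using one_minus_2it_nonzero
  by (intro continuous_intros) (simp del: of_real_mult)

text \<open>By \<open>variance_1\<close> the summand t spreads over the weights as 2 l^2 t, so each
  weight contributes 2 l^2 t (1 - 1/m) with |1 - 1/m| <= |m - 1| = 2 l |t|. Nonnegativity of the
  weights turns |l|^3 into l^3, hence \<open>L\<close>.\<close>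

lemma norm_\<psi>_plus_le: "cmod (\<psi> t + t) \<le> 4 * t\<^sup>2 * L"
proof -
  have "\<psi> t + t = \<psi> t + t * (\<Sum>j\<in>A. complex_of_real (2 * (l j)\<^sup>2))"
    by (simp only: variance_1_complex mult_1_right)
  also have "\<dots> = (\<Sum>j\<in>A. (2 * (l j)\<^sup>2 * t) * (1 - 1 / (1 - 2 * \<i> * of_real (l j * t))))"
    by (simp add: \<psi>_def sum_distrib_left algebra_simps flip: sum.distrib)
  also have "cmod \<dots> \<le> (\<Sum>j\<in>A. 4 * t\<^sup>2 * l j ^ 3)"
  proof (rule order_trans[OF norm_sum sum_mono])
    fix j assume j: "j \<in> A"
    define m where "m = 1 - 2 * \<i> * complex_of_real (l j * t)"
    have m: "m \<noteq> 0" "1 \<le> cmod m" unfolding m_def by (rule one_minus_2it_nonzero norm_one_minus_2it_ge_1)+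
    have "1 - 1 / m = (m - 1) / m" using m by (simp add: field_simps)
    then have "cmod (1 - 1 / m) = cmod (m - 1) / cmod m" by (simp add: norm_divide)
    also have "\<dots> \<le> cmod (m - 1)" using m by (simp add: divide_le_eq mult_left_mono[of 1 "cmod m" "cmod (m - 1)", simplified])
    also have "\<dots> = 2 * l j * \<bar>t\<bar>" using nonneg[OF j] by (simp add: m_def norm_mult abs_mult)
    finally have "cmod (1 - 1 / m) \<le> 2 * l j * \<bar>t\<bar>" .
    then have "cmod ((2 * (l j)\<^sup>2 * t) * (1 - 1 / m)) \<le> \<bar>2 * (l j)\<^sup>2 * t\<bar> * (2 * l j * \<bar>t\<bar>)"
      unfolding norm_mult norm_of_real by (intro mult_left_mono) auto
    also have "\<dots> = 4 * t\<^sup>2 * l j ^ 3"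
      by (simp add: abs_mult power2_eq_square power3_eq_cube)
    finally show "cmod ((2 * (l j)\<^sup>2 * t) * (1 - 1 / (1 - 2 * \<i> * of_real (l j * t)))) \<le> 4 * t\<^sup>2 * l j ^ 3"
      unfolding m_def .
  qed
  also have "\<dots> = 4 * t\<^sup>2 * L" by (simp add: L_def sum_distrib_left)
  finally show ?thesis .
qed

lemma norm_\<psi>_le: "cmod (\<psi> t) \<le> \<bar>t\<bar>"
proof -
  have "cmod (\<psi> t) \<le> (\<Sum>j\<in>A. 2 * (l j)\<^sup>2 * \<bar>t\<bar>)"
    unfolding \<psi>_def
  proof (rule order_trans[OF norm_sum sum_mono])
    fix j
    have "cmod (- (2 * (l j)\<^sup>2 * t) / (1 - 2 * \<i> * of_real (l j * t))) = 2 * (l j)\<^sup>2 * \<bar>t\<bar> / cmod (1 - 2 * \<i> * of_real (l j * t))"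
      unfolding norm_divide by (simp add: norm_mult norm_power)
    also have "\<dots> \<le> 2 * (l j)\<^sup>2 * \<bar>t\<bar> / 1"
      using norm_one_minus_2it_ge_1[of "l j * t"] less_le_trans[OF zero_less_one norm_one_minus_2it_ge_1[of "l j * t"]]
      by (intro divide_left_mono mult_pos_pos mult_nonneg_nonneg) auto
    finally show "cmod (of_real (- (2 * (l j)\<^sup>2 * t)) / (1 - 2 * \<i> * of_real (l j * t))) \<le> 2 * (l j)\<^sup>2 * \<bar>t\<bar>" by simp
  qed
  also have "\<dots> = \<bar>t\<bar>" using variance_1 by (simp flip: sum_distrib_right)
  finally show ?thesis .
qed

text \<open>As for \<open>norm_\<psi>_plus_le\<close>, now with 1 - 1/m^2 = (m - 1)(m + 1) / m^2 and
  |m + 1| <= 2 |m|^2, the latter because |m| >= 1.\<close>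

lemma norm_\<psi>'_plus_1_le: "cmod (\<psi>' t + 1) \<le> 8 * \<bar>t\<bar> * L"
proof -
  have "\<psi>' t + 1 = \<psi>' t + (\<Sum>j\<in>A. complex_of_real (2 * (l j)\<^sup>2))"
    by (simp only: variance_1_complex)
  also have "\<dots> = (\<Sum>j\<in>A. (2 * (l j)\<^sup>2) * (1 - 1 / (1 - 2 * \<i> * of_real (l j * t))\<^sup>2))"
    by (simp add: \<psi>'_def algebra_simps flip: sum.distrib)
  also have "cmod \<dots> \<le> (\<Sum>j\<in>A. 8 * \<bar>t\<bar> * l j ^ 3)"
  proof (rule order_trans[OF norm_sum sum_mono])
    fix j assume j: "j \<in> A"
    define m where "m = 1 - 2 * \<i> * complex_of_real (l j * t)"
    have m: "m \<noteq> 0" "1 \<le> cmod m" unfolding m_def by (rule one_minus_2it_nonzero norm_one_minus_2it_ge_1)+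
    have "cmod m \<le> cmod m * cmod m" using mult_left_mono[OF m(2), of "cmod m"] by simp
    then have m2: "cmod m + 1 \<le> 2 * (cmod m * cmod m)" using m(2) by linarith
    have "1 - 1 / m\<^sup>2 = (m - 1) * (m + 1) / (m * m)" using m by (simp add: field_simps power2_eq_square)
    then have "cmod (1 - 1 / m\<^sup>2) = cmod (m - 1) * cmod (m + 1) / (cmod m * cmod m)" by (simp add: norm_divide norm_mult)
    also have "\<dots> \<le> cmod (m - 1) * (2 * (cmod m * cmod m)) / (cmod m * cmod m)"
      using order_trans[OF norm_triangle_ineq[of m 1]] m2 by (intro divide_right_mono mult_left_mono) auto
    also have "\<dots> = 2 * cmod (m - 1)" using m by simp
    also have "\<dots> = 4 * l j * \<bar>t\<bar>" using nonneg[OF j] by (simp add: m_def norm_mult abs_mult)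
    finally have "cmod (1 - 1 / m\<^sup>2) \<le> 4 * l j * \<bar>t\<bar>" .
    then have "cmod ((2 * (l j)\<^sup>2) * (1 - 1 / m\<^sup>2)) \<le> \<bar>2 * (l j)\<^sup>2\<bar> * (4 * l j * \<bar>t\<bar>)"
      unfolding norm_mult norm_of_real by (intro mult_left_mono) auto
    also have "\<dots> = 8 * \<bar>t\<bar> * l j ^ 3"
      by (simp add: power2_eq_square power3_eq_cube)
    finally show "cmod ((2 * (l j)\<^sup>2) * (1 - 1 / (1 - 2 * \<i> * of_real (l j * t))\<^sup>2)) \<le> 8 * \<bar>t\<bar> * l j ^ 3"
      unfolding m_def .
  qed
  also have "\<dots> = 8 * \<bar>t\<bar> * L" by (simp add: L_def sum_distrib_left)
  finally show ?thesis .
qed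

lemma norm_f_power4: "cmod (f t) ^ 4 = (\<Prod>j\<in>A. 1 / (1 + 4 * (l j * t)\<^sup>2))"
proof -
  have "cmod (f t) = (\<Prod>j\<in>A. cmod (square_char (l j * t)))"
    unfolding f_def prod_norm[symmetric] norm_mult
    using norm_exp_i_times[of "-(l j * t)" for j] by (simp del: of_real_mult of_real_minus)
  then have "cmod (f t) ^ 4 = (\<Prod>j\<in>A. cmod (square_char (l j * t)) ^ 4)"
    by (simp only: prod_power_distrib)
  then show ?thesis by (simp only: norm_square_char_power4)
qed

text \<open>In the mean value estimate for f exp(t^2 / 2), the intermediate point may thus be
  replaced by the endpoint, and the growing exponential cancels afterwards. The reason is that
  \<open>variance_1\<close> splits exp(2 t^2) over the factors of |f t|^4, each of which becomes e^x
  / (1 + x) with x = 4 (l t)^2.\<close>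

lemma norm_f_exp_mono:
  assumes "\<bar>s\<bar> \<le> \<bar>t\<bar>"
  shows "cmod (f s) * exp (s\<^sup>2 / 2) \<le> cmod (f t) * exp (t\<^sup>2 / 2)"
proof -
  have "(cmod (f t) * exp (t\<^sup>2 / 2)) ^ 4 = (\<Prod>j\<in>A. exp (4 * (l j * t)\<^sup>2) / (1 + 4 * (l j * t)\<^sup>2))" for t
  proof -
    have "exp (t\<^sup>2 / 2) ^ 4 = exp (2 * t\<^sup>2 * (\<Sum>j\<in>A. 2 * (l j)\<^sup>2))"
      unfolding variance_1 by (simp flip: exp_of_nat_mult)
    also have "\<dots> = (\<Prod>j\<in>A. exp (4 * (l j * t)\<^sup>2))"
      using finite_A by (simp add: sum_distrib_left exp_sum power_mult_distrib mult_ac)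
    finally have e4: "exp (t\<^sup>2 / 2) ^ 4 = (\<Prod>j\<in>A. exp (4 * (l j * t)\<^sup>2))" .
    show ?thesis
      unfolding power_mult_distrib[of "cmod (f t)"] norm_f_power4 e4 prod.distrib[symmetric] by simp
  qed
  moreover have "(\<Prod>j\<in>A. exp (4 * (l j * s)\<^sup>2) / (1 + 4 * (l j * s)\<^sup>2)) \<le> (\<Prod>j\<in>A. exp (4 * (l j * t)\<^sup>2) / (1 + 4 * (l j * t)\<^sup>2))"
  proof (rule prod_mono, safe)
    fix j
    have "s\<^sup>2 \<le> t\<^sup>2" using assms by (simp add: abs_le_square_iff)
    then show "exp (4 * (l j * s)\<^sup>2) / (1 + 4 * (l j * s)\<^sup>2) \<le> exp (4 * (l j * t)\<^sup>2) / (1 + 4 * (l j * t)\<^sup>2)"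
      by (intro exp_divide_one_plus_mono) (auto simp: power_mult_distrib intro: mult_left_mono)
  qed (auto simp: add_nonneg_nonneg)
  ultimately have "(cmod (f s) * exp (s\<^sup>2 / 2)) ^ 4 \<le> (cmod (f t) * exp (t\<^sup>2 / 2)) ^ 4" by simp
  then show ?thesis by (subst (asm) power_mono_iff) auto
qed

text \<open>Mean value theorem for \<open>f t * exp (t\<^sup>2 / 2)\<close>, whose derivative carries the factor \<open>\<psi> t + t\<close>.\<close>

lemma norm_f_diff_le: "cmod (f t - exp (- t\<^sup>2 / 2)) \<le> 4 * \<bar>t\<bar> ^ 3 * L * cmod (f t)"
proof -
  define u where "u s = f s * of_real (exp (s\<^sup>2 / 2))" for s
  define B where "B = cmod (f t) * exp (t\<^sup>2 / 2) * (4 * t\<^sup>2 * L)"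
  have u: "(u has_vector_derivative u s * (\<psi> s + s)) (at s)" for s
  proof -
    have "((\<lambda>s. exp (s\<^sup>2 / 2)) has_real_derivative s * exp (s\<^sup>2 / 2)) (at s)"
      by (auto intro!: derivative_eq_intros)
    then have "((\<lambda>s. of_real (exp (s\<^sup>2 / 2))) has_vector_derivative complex_of_real (s * exp (s\<^sup>2 / 2))) (at s)"
      by (intro has_vector_derivative_of_real) (simp add: has_real_derivative_iff_has_vector_derivative)
    from has_vector_derivative_mult[OF f_has_vector_derivative this] show ?thesis
      unfolding u_def by (simp add: algebra_simps del: exp_of_real of_real_exp)
  qed
  have "cmod (u t - u 0) \<le> B * norm (t - 0)"
  proof (rule differentiable_bound[where S="{-\<bar>t\<bar>..\<bar>t\<bar>}" and f'="\<lambda>s h. h *\<^sub>R (u s * (\<psi> s + s))"])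
    fix s assume s: "s \<in> {-\<bar>t\<bar>..\<bar>t\<bar>}"
    show "(u has_derivative (\<lambda>h. h *\<^sub>R (u s * (\<psi> s + s)))) (at s within {-\<bar>t\<bar>..\<bar>t\<bar>})"
      using u[of s] by (simp add: has_vector_derivative_def has_derivative_at_withinI)
    have st: "\<bar>s\<bar> \<le> \<bar>t\<bar>" using s by auto
    have "cmod (u s) \<le> cmod (f t) * exp (t\<^sup>2 / 2)"
      using norm_f_exp_mono[OF st] by (simp add: u_def norm_mult)
    moreover have "cmod (\<psi> s + s) \<le> 4 * t\<^sup>2 * L"
      using norm_\<psi>_plus_le[of s] mult_right_mono[of "4 * s\<^sup>2" "4 * t\<^sup>2" L] L_nonneg st
      by (simp add: abs_le_square_iff)
    ultimately have "cmod (u s * (\<psi> s + s)) \<le> B"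
      unfolding B_def norm_mult by (intro mult_mono) auto
    then show "onorm (\<lambda>h. h *\<^sub>R (u s * (\<psi> s + s))) \<le> B"
      by (intro onorm_le) (simp add: mult.commute[of B] mult_left_mono)
  qed auto
  then have "cmod (u t - 1) \<le> B * \<bar>t\<bar>" by (simp add: u_def f_0)
  then have X: "exp (- t\<^sup>2 / 2) * cmod (u t - 1) \<le> exp (- t\<^sup>2 / 2) * (B * \<bar>t\<bar>)"
    by (intro mult_left_mono) auto
  have e: "exp (- t\<^sup>2 / 2) * exp (t\<^sup>2 / 2) = 1" by (simp flip: exp_add)
  have "f t - exp (- t\<^sup>2 / 2) = of_real (exp (- t\<^sup>2 / 2)) * (u t - 1)"
    using arg_cong[OF e, of complex_of_real] unfolding of_real_mult u_def
    by (simp add: algebra_simps del: exp_of_real of_real_exp)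
  then have E1: "cmod (f t - exp (- t\<^sup>2 / 2)) = exp (- t\<^sup>2 / 2) * cmod (u t - 1)"
    by (simp add: norm_mult del: exp_of_real of_real_exp)
  have E2: "exp (- t\<^sup>2 / 2) * (B * \<bar>t\<bar>) = (exp (- t\<^sup>2 / 2) * exp (t\<^sup>2 / 2)) * (4 * \<bar>t\<bar> ^ 3 * L * cmod (f t))"
    by (simp add: B_def power3_eq_cube power2_eq_square) 
  show ?thesis
    using X unfolding E1 E2 e by simp
qed

text \<open>Bernoulli's inequality x^a <= 1 + a (x - 1) needs an exponent a <= 1. The threshold 1/32
  permits a = 32 l^2, and x = 1 + t^2 / 8 then gives exactly the factor 1 + 4 (l t)^2. The exponents
  sum to 16, so |f t|^4 <= x^(-16). The constant 4096 is 8^4, from x >= (1 + t^2) / 8.\<close>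

lemma norm_f_le:
  assumes small: "\<And>j. j \<in> A \<Longrightarrow> (l j)\<^sup>2 \<le> 1 / 32"
  shows "cmod (f t) \<le> 4096 / (1 + t\<^sup>2) ^ 4"
proof -
  define x where "x = 1 + t\<^sup>2 / 8"
  have x1: "x \<ge> 1" by (simp add: x_def)
  have bern: "x powr (32 * (l j)\<^sup>2) \<le> 1 + 4 * (l j * t)\<^sup>2" if "j \<in> A" for j
  proof -
    have "(1 + t\<^sup>2 / 8) powr (32 * (l j)\<^sup>2) \<le> 1 + (32 * (l j)\<^sup>2) * (t\<^sup>2 / 8)"
      using Youngs_inequality_0[of "32 * (l j)\<^sup>2" "1 - 32 * (l j)\<^sup>2" "1 + t\<^sup>2 / 8" 1] small[OF that]
      by (simp add: algebra_simps add_pos_nonneg)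
    then show ?thesis by (simp add: x_def power_mult_distrib mult.commute)
  qed
  have "x ^ 16 = x powr (\<Sum>j\<in>A. 32 * (l j)\<^sup>2)"
  proof -
    have "(\<Sum>j\<in>A. 32 * (l j)\<^sup>2) = 16" using variance_1 by (simp flip: sum_distrib_left)
    then show ?thesis using x1 by (simp add: powr_numeral)
  qed
  also have "\<dots> = (\<Prod>j\<in>A. x powr (32 * (l j)\<^sup>2))"
    using x1 finite_A by (simp add: powr_sum)
  also have "\<dots> \<le> (\<Prod>j\<in>A. 1 + 4 * (l j * t)\<^sup>2)"
    by (intro prod_mono) (simp add: bern)
  finally have "cmod (f t) ^ 4 \<le> 1 / x ^ 16"
    using x1 unfolding norm_f_power4 prod_dividef by (simp add: frac_le)
  also have "\<dots> = (1 / x ^ 4) ^ 4" by (simp add: power_divide flip: power_mult)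
  finally have "cmod (f t) \<le> 1 / x ^ 4"
    by (subst (asm) power_mono_iff) (use x1 in auto)
  also have "\<dots> \<le> 1 / ((1 + t\<^sup>2) / 8) ^ 4"
  proof (rule divide_left_mono)
    show "((1 + t\<^sup>2) / 8) ^ 4 \<le> x ^ 4" by (rule power_mono) (auto simp: x_def)
    have "1 + t\<^sup>2 > 0" by (simp add: add_pos_nonneg)
    then show "0 < x ^ 4 * ((1 + t\<^sup>2) / 8) ^ 4" using x1 by simp
  qed simp
  also have "\<dots> = 4096 / (1 + t\<^sup>2) ^ 4" by (simp add: power_divide)
  finally show ?thesis .
qed


text \<open>The constant is 2 * 4096 * 28: the decay of \<open>f\<close> gives 4096, the polynomial
  terms of the difference and of its second derivative give 16 + 8 + 4 = 28, and Fourier inversion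
  gives pi / 2 < 2.\<close>

theorem abs_measure_diff_std_normal_le:
  assumes M: "real_distribution M" and char: "char M = f" and B: "B \<in> sets borel"
  shows "\<bar>measure M B - measure std_normal_distribution B\<bar> \<le> 229376 * L"
proof (cases "\<forall>j\<in>A. (l j)\<^sup>2 \<le> 1 / 32")
  case False
  interpret real_distribution M by (rule M)
  interpret S: real_distribution std_normal_distribution by (rule real_dist_normal_dist)
  from False obtain j where j: "j \<in> A" "(l j)\<^sup>2 > 1 / 32" by auto
  \<comment> \<open>Since 36 > 32, a weight beyond the threshold exceeds 1/6. Then \<open>L\<close>
    is at least 1/216 and the claimed bound exceeds 1.\<close>
  have "(1 / 6)\<^sup>2 < (l j)\<^sup>2" using j(2) by (simp add: power2_eq_square)
  then have "1 / 6 < l j" using nonneg[OF j(1)] by (rule power_less_imp_less_base)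
  then have "(1 / 6) ^ 3 \<le> l j ^ 3" by (intro power_mono) auto
  also have "\<dots> \<le> L"
    unfolding L_def using finite_A j nonneg by (intro member_le_sum) auto
  finally have "1 \<le> 229376 * L" by (simp add: power3_eq_cube)
  moreover have "\<bar>measure M B - measure std_normal_distribution B\<bar> \<le> 1"
    using prob_le_1[of B] S.prob_le_1[of B] measure_nonneg[of M B] measure_nonneg[of std_normal_distribution B] by linarith
  ultimately show ?thesis by linarith
next
  case True
  define g where "g t = complex_of_real (exp (- t\<^sup>2 / 2))" for t
  have g1: "(g has_vector_derivative - (t * g t)) (at t)" for t
  proof -
    have "((\<lambda>t. exp (- t\<^sup>2 / 2)) has_real_derivative - (t * exp (- t\<^sup>2 / 2))) (at t)"
      by (auto intro!: derivative_eq_intros)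
    then have "((\<lambda>t. of_real (exp (- t\<^sup>2 / 2))) has_vector_derivative complex_of_real (- (t * exp (- t\<^sup>2 / 2)))) (at t)"
      by (intro has_vector_derivative_of_real) (simp add: has_real_derivative_iff_has_vector_derivative)
    then show ?thesis unfolding g_def by (simp del: exp_of_real of_real_exp)
  qed
  define d where "d t = f t - g t" for t
  define d1 where "d1 t = f t * \<psi> t + t * g t" for t
  define d2 where "d2 t = f t * ((\<psi> t)\<^sup>2 + \<psi>' t) + (1 - t\<^sup>2) * g t" for t
  have id_D: "(complex_of_real has_vector_derivative 1) (at t)" for t
    by (auto intro!: derivative_eq_intros)
  have d1: "(d has_vector_derivative d1 t) (at t)" for t
    using has_vector_derivative_diff[OF f_has_vector_derivative g1] unfolding d_def d1_def by simp
  have d2: "(d1 has_vector_derivative d2 t) (at t)" for t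
    using has_vector_derivative_add[OF has_vector_derivative_mult[OF f_has_vector_derivative \<psi>_has_vector_derivative]
        has_vector_derivative_mult[OF id_D g1], of t]
    unfolding d1_def d2_def by (simp add: algebra_simps power2_eq_square)
  have cont: "isCont d2 t" for t
  proof -
    have "isCont f t" "isCont \<psi> t" "isCont g t"
      using f_has_vector_derivative \<psi>_has_vector_derivative g1 has_vector_derivative_continuous by blast+
    then show ?thesis unfolding d2_def using isCont_\<psi>' by (intro continuous_intros) auto
  qed
  have fb: "cmod (f t) \<le> 4096 / (1 + t\<^sup>2) ^ 4" for t
    using True by (intro norm_f_le) auto
  have db: "cmod (d t) \<le> 4 * \<bar>t\<bar> ^ 3 * L * cmod (f t)" for t
    using norm_f_diff_le[of t] by (simp add: d_def g_def)
  \<comment> \<open>Of the four powers of 1 / (1 + t^2) in the bound on \<open>f\<close>, three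
    absorb the polynomial \<open>p\<close> and one remains.\<close>
  have decay: "cmod (f t) * (c * L * p) \<le> 4096 * c * L / (1 + t\<^sup>2)"
    if "p \<le> (1 + t\<^sup>2) ^ 3" "0 \<le> p" "0 \<le> c" for t c p
  proof -
    have "cmod (f t) * (c * L * p) \<le> (4096 / (1 + t\<^sup>2) ^ 4) * (c * L * (1 + t\<^sup>2) ^ 3)"
      using that L_nonneg by (intro mult_mono[OF fb] mult_left_mono) auto
    also have "\<dots> = 4096 * c * L / (1 + t\<^sup>2)"
    proof -
      define y where "y = 1 + t\<^sup>2"
      have "y \<noteq> 0" using add_pos_nonneg[of 1 "t\<^sup>2"] by (simp add: y_def)
      moreover have "y ^ 4 = y * y ^ 3" by (simp add: eval_nat_numeral)
      ultimately show ?thesis unfolding y_def[symmetric] by simp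
    qed
    finally show ?thesis .
  qed
  have pw: "\<bar>t\<bar> ^ k \<le> (1 + t\<^sup>2) ^ 3" if "k \<le> 6" for k and t :: real
  proof -
    have le: "(t\<^sup>2) ^ 3 \<le> (1 + t\<^sup>2) ^ 3" by (rule power_mono) auto
    have ge1: "1 \<le> (1 + t\<^sup>2) ^ 3" by (rule one_le_power) simp
    show ?thesis
    proof (cases "\<bar>t\<bar> \<le> 1")
      case True
      then have "\<bar>t\<bar> ^ k \<le> 1" by (simp add: power_le_one)
      then show ?thesis using ge1 by (rule order_trans)
    next
      case False
      then have "\<bar>t\<bar> ^ k \<le> \<bar>t\<bar> ^ 6" using that by (intro power_increasing) auto
      also have "\<dots> = (t\<^sup>2) ^ 3" by (simp flip: power_mult)
      finally show ?thesis using le by (rule order_trans)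
    qed
  qed
  have "\<bar>measure M B - measure std_normal_distribution B\<bar> \<le> pi * (114688 * L) / 2"
  proof (rule abs_measure_diff_le_char[OF M real_dist_normal_dist _ d2 cont _ _ B])
    have eq: "(\<lambda>t. char M t - char std_normal_distribution t) = d"
      by (simp add: d_def g_def char char_std_normal_distribution fun_eq_iff)
    show "((\<lambda>t. char M t - char std_normal_distribution t) has_vector_derivative d1 t) (at t)" for t
      unfolding eq by (rule d1)
    show "cmod (d1 t) \<le> (4096 * 8 * L) / (1 + t\<^sup>2)" for t
    proof -
      \<comment> \<open>Regrouped so that each term has a factor of order \<open>L\<close>, either
        \<psi> t + t or \<open>d t\<close>.\<close>
      have "d1 t = f t * (\<psi> t + t) - t * d t" by (simp add: d1_def d_def algebra_simps)
      then have "cmod (d1 t) \<le> cmod (f t) * cmod (\<psi> t + t) + \<bar>t\<bar> * cmod (d t)"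
        using norm_triangle_ineq4[of "f t * (\<psi> t + t)" "t * d t"] by (simp add: norm_mult)
      also have "\<dots> \<le> cmod (f t) * (4 * t\<^sup>2 * L) + \<bar>t\<bar> * (4 * \<bar>t\<bar> ^ 3 * L * cmod (f t))"
        by (intro add_mono mult_left_mono norm_\<psi>_plus_le db) auto
      also have "\<dots> = cmod (f t) * (4 * L * \<bar>t\<bar> ^ 2) + cmod (f t) * (4 * L * \<bar>t\<bar> ^ 4)"
      proof -
        have "F * (4 * a\<^sup>2 * L) + a * (4 * a ^ 3 * L * F) = F * (4 * L * a\<^sup>2) + F * (4 * L * a ^ 4)" for a F
          by algebra
        from this[of "cmod (f t)" "\<bar>t\<bar>"] show ?thesis unfolding power2_abs .
      qed
      also have "\<dots> \<le> 4096 * 4 * L / (1 + t\<^sup>2) + 4096 * 4 * L / (1 + t\<^sup>2)"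
        by (intro add_mono decay pw) auto
      also have "\<dots> = (4096 * 8 * L) / (1 + t\<^sup>2)" by (simp flip: add_divide_distrib)
      finally show ?thesis .
    qed
    show "cmod (char M t - char std_normal_distribution t) + cmod (d2 t) \<le> (114688 * L) / (1 + t\<^sup>2)" for t
    proof -
      \<comment> \<open>The same regrouping one order higher: \<psi>^2 + \<psi>' is compared with
        its Gaussian counterpart t^2 - 1, obtained by putting - t for \<psi>.\<close>
      have "d2 t = f t * ((\<psi> t + t) * (\<psi> t - t) + (\<psi>' t + 1)) + (t\<^sup>2 - 1) * d t"
        by (simp add: d2_def d_def algebra_simps power2_eq_square)
      then have "cmod (d2 t) \<le> cmod (f t) * cmod ((\<psi> t + t) * (\<psi> t - t) + (\<psi>' t + 1)) + cmod (complex_of_real (t\<^sup>2 - 1)) * cmod (d t)"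
        using norm_triangle_ineq[of "f t * ((\<psi> t + t) * (\<psi> t - t) + (\<psi>' t + 1))" "(t\<^sup>2 - 1) * d t"]
        by (simp only: norm_mult)
      also have "\<dots> \<le> cmod (f t) * (cmod (\<psi> t + t) * cmod (\<psi> t - t) + cmod (\<psi>' t + 1)) + cmod (complex_of_real (t\<^sup>2 - 1)) * cmod (d t)"
        using norm_triangle_ineq[of "(\<psi> t + t) * (\<psi> t - t)" "\<psi>' t + 1"]
        by (intro add_right_mono mult_left_mono) (simp_all only: norm_mult norm_ge_zero)
      also have "\<dots> \<le> cmod (f t) * ((4 * t\<^sup>2 * L) * (2 * \<bar>t\<bar>) + 8 * \<bar>t\<bar> * L) + (t\<^sup>2 + 1) * (4 * \<bar>t\<bar> ^ 3 * L * cmod (f t))"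
      proof (intro add_mono mult_left_mono mult_mono norm_\<psi>_plus_le norm_\<psi>'_plus_1_le db)
        show "cmod (\<psi> t - t) \<le> 2 * \<bar>t\<bar>"
          using norm_triangle_ineq4[of "\<psi> t" t] norm_\<psi>_le[of t] by simp
        show "cmod (complex_of_real (t\<^sup>2 - 1)) \<le> t\<^sup>2 + 1"
          unfolding norm_of_real by (simp add: abs_if)
      qed (use L_nonneg in auto)
      finally have "cmod (char M t - char std_normal_distribution t) + cmod (d2 t) \<le>
        4 * \<bar>t\<bar> ^ 3 * L * cmod (f t) + (cmod (f t) * ((4 * t\<^sup>2 * L) * (2 * \<bar>t\<bar>) + 8 * \<bar>t\<bar> * L) + (t\<^sup>2 + 1) * (4 * \<bar>t\<bar> ^ 3 * L * cmod (f t)))"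
        using db[of t] fun_cong[OF eq, of t] by simp
      also have "\<dots> = cmod (f t) * (16 * L * \<bar>t\<bar> ^ 3) + cmod (f t) * (8 * L * \<bar>t\<bar> ^ 1) + cmod (f t) * (4 * L * \<bar>t\<bar> ^ 5)"
      proof -
        have "4 * a ^ 3 * L * F + (F * ((4 * a\<^sup>2 * L) * (2 * a) + 8 * a * L) + (a\<^sup>2 + 1) * (4 * a ^ 3 * L * F))
          = F * (16 * L * a ^ 3) + F * (8 * L * a ^ 1) + F * (4 * L * a ^ 5)" for a F
          by algebra
        from this[of "\<bar>t\<bar>" "cmod (f t)"] show ?thesis unfolding power2_abs .
      qed
      also have "\<dots> \<le> 4096 * 16 * L / (1 + t\<^sup>2) + 4096 * 8 * L / (1 + t\<^sup>2) + 4096 * 4 * L / (1 + t\<^sup>2)"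
        by (intro add_mono decay pw) auto
      also have "\<dots> = (114688 * L) / (1 + t\<^sup>2)" by (simp flip: add_divide_distrib)
      finally show ?thesis .
    qed
  qed
  also have "\<dots> \<le> 4 * (114688 * L) / 2"
    using L_nonneg pi_less_4 by (intro divide_right_mono mult_right_mono) auto
  finally show ?thesis by simp
qed

end

section \<open>Independence from characteristic functions\<close>

context prob_space
begin

text \<open>Because the weight is bounded below by 1, normalizing it gives a probability density.
  The hypothesis says that \<open>X\<close> has the same characteristic function under the new
  measure as under the old one; by Levy's uniqueness theorem the laws agree, so the factorization
  passes from exponentials to every \<open>g\<close>.\<close>

lemma factor_bounded_real_weight:
  fixes X W :: "'a \<Rightarrow> real" and g :: "real \<Rightarrow> complex"
  assumes [measurable]: "X \<in> borel_measurable M" "W \<in> borel_measurable M" "g \<in> borel_measurable borel"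
    and W: "\<And>\<omega>. 1 \<le> W \<omega>" "\<And>\<omega>. W \<omega> \<le> B"
    and char: "\<And>y. (CLINT \<omega>|M. iexp (y * X \<omega>) * W \<omega>) = (CLINT \<omega>|M. iexp (y * X \<omega>)) * expectation W"
  shows "(CLINT \<omega>|M. g (X \<omega>) * W \<omega>) = (CLINT \<omega>|M. g (X \<omega>)) * expectation W"
proof -
  have intW: "integrable M W"
  proof (rule integrable_const_bound[where B=B])
    have "\<bar>W \<omega>\<bar> \<le> B" for \<omega> using W[of \<omega>] by linarith
    then show "AE \<omega> in M. norm (W \<omega>) \<le> B" by simp
  qed simp
  have e1: "1 \<le> expectation W"
    using integral_mono[OF _ intW, of "\<lambda>_. 1"] W prob_space by simp
  define e where "e = expectation W"
  have e: "0 < e" using e1 by (simp add: e_def)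
  define M' where "M' = density M (\<lambda>\<omega>. ennreal (W \<omega> / e))"
  have nn: "0 \<le> W \<omega> / e" for \<omega> using W(1)[of \<omega>] e by simp
  have dens: "(CLINT \<omega>|M'. k \<omega>) = (CLINT \<omega>|M. k \<omega> * W \<omega>) / e" if [measurable]: "k \<in> borel_measurable M" for k :: "'a \<Rightarrow> complex"
  proof -
    have "(CLINT \<omega>|M'. k \<omega>) = (CLINT \<omega>|M. (W \<omega> / e) *\<^sub>R k \<omega>)"
      unfolding M'_def using nn by (subst integral_density) auto
    also have "\<dots> = (CLINT \<omega>|M. k \<omega> * W \<omega> / e)"
      by (intro Bochner_Integration.integral_cong) (auto simp: scaleR_conv_of_real)
    finally show ?thesis by simp
  qed
  interpret M': prob_space M'
  proof
    have "emeasure M' (space M') = (\<integral>\<^sup>+ \<omega>. ennreal (W \<omega> / e) \<partial>M)"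
      unfolding M'_def by (subst emeasure_density) (auto intro!: nn_integral_cong)
    also have "\<dots> = ennreal (\<integral>\<omega>. W \<omega> / e \<partial>M)"
      using intW nn by (intro nn_integral_eq_integral) auto
    also have "(\<integral>\<omega>. W \<omega> / e \<partial>M) = 1" using e by (simp add: e_def)
    finally show "emeasure M' (space M') = 1" by simp
  qed
  have Xm'[measurable]: "X \<in> borel_measurable M'" by (simp add: M'_def)
  have eq: "distr M' borel X = distr M borel X"
  proof (rule Levy_uniqueness)
    show "char (distr M' borel X) = char (distr M borel X)"
    proof
      fix y
      have "char (distr M' borel X) y = (CLINT \<omega>|M'. iexp (y * X \<omega>))"
        unfolding char_def by (subst integral_distr) auto
      also have "\<dots> = (CLINT \<omega>|M. iexp (y * X \<omega>) * W \<omega>) / e"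
        by (rule dens) measurable
      also have "\<dots> = (CLINT \<omega>|M. iexp (y * X \<omega>))"
        using e unfolding char e_def[symmetric] by simp
      also have "\<dots> = char (distr M borel X) y"
        unfolding char_def by (subst integral_distr) auto
      finally show "char (distr M' borel X) y = char (distr M borel X) y" .
    qed
  qed auto
  have "(CLINT \<omega>|M. g (X \<omega>) * W \<omega>) / e = (CLINT \<omega>|M'. g (X \<omega>))"
    by (subst dens) auto
  also have "\<dots> = (CLINT x|distr M' borel X. g x)"
    by (subst integral_distr) auto
  also have "\<dots> = (CLINT \<omega>|M. g (X \<omega>))"
    unfolding eq by (subst integral_distr) auto
  finally show ?thesis using e by (simp add: e_def[symmetric] field_simps)
qed

text \<open>Reduction to a real weight bounded below. The hypothesis is conjugated at - y to cover
  the conjugate of \<open>Z\<close>; averaging the two covers the real part of \<open>Z\<close>, and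
  the imaginary part follows by rotation.\<close>

lemma factor_bounded_weight:
  fixes X :: "'a \<Rightarrow> real" and Z :: "'a \<Rightarrow> complex" and g :: "real \<Rightarrow> complex"
  assumes [measurable]: "X \<in> borel_measurable M" "Z \<in> borel_measurable M" "g \<in> borel_measurable borel"
    and Z: "\<And>\<omega>. cmod (Z \<omega>) \<le> B"
    and g: "\<And>x. cmod (g x) \<le> K"
    and char: "\<And>y. (CLINT \<omega>|M. iexp (y * X \<omega>) * Z \<omega>) = (CLINT \<omega>|M. iexp (y * X \<omega>)) * (CLINT \<omega>|M. Z \<omega>)"
  shows "(CLINT \<omega>|M. g (X \<omega>) * Z \<omega>) = (CLINT \<omega>|M. g (X \<omega>)) * (CLINT \<omega>|M. Z \<omega>)"
proof -
  have real_part: "(CLINT \<omega>|M. g (X \<omega>) * Re (Z \<omega>)) = (CLINT \<omega>|M. g (X \<omega>)) * (LINT \<omega>|M. Re (Z \<omega>))"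
    if [measurable]: "Z \<in> borel_measurable M" and Z: "\<And>\<omega>. cmod (Z \<omega>) \<le> B"
      and char: "\<And>y. (CLINT \<omega>|M. iexp (y * X \<omega>) * Z \<omega>) = (CLINT \<omega>|M. iexp (y * X \<omega>)) * (CLINT \<omega>|M. Z \<omega>)"
    for Z :: "'a \<Rightarrow> complex"
  proof -
    have cm: "cmod (iexp (y * x)) = 1" for y x using norm_exp_i_times[of "y * x"] by simp
    have [measurable]: "cnj \<in> borel_measurable borel"
      by (intro borel_measurable_continuous_onI continuous_intros)
    have intZ: "integrable M Z" using Z by (intro integrable_const_bound[where B=B]) auto
    have inteZ: "integrable M (\<lambda>\<omega>. iexp (y * X \<omega>) * Z \<omega>)" for y
      using Z by (intro integrable_const_bound[where B=B]) (auto simp: norm_mult cm simp del: of_real_mult)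
    have intecZ: "integrable M (\<lambda>\<omega>. iexp (y * X \<omega>) * cnj (Z \<omega>))" for y
      using Z by (intro integrable_const_bound[where B=B]) (auto simp: norm_mult cm simp del: of_real_mult)
    have inte: "integrable M (\<lambda>\<omega>. iexp (y * X \<omega>))" for y
      by (intro integrable_const_bound[where B=1]) (auto simp: cm simp del: of_real_mult)
    have intg: "integrable M (\<lambda>\<omega>. g (X \<omega>))"
      using g by (intro integrable_const_bound[where B=K]) auto
    have ReB: "\<bar>Re (Z \<omega>)\<bar> \<le> B" for \<omega> using abs_Re_le_cmod[of "Z \<omega>"] Z[of \<omega>] by linarith
    have intRe: "integrable M (\<lambda>\<omega>. Re (Z \<omega>))"
      using ReB by (intro integrable_const_bound[where B=B]) auto
    have intgRe: "integrable M (\<lambda>\<omega>. g (X \<omega>) * Re (Z \<omega>))"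
      using ReB g order_trans[OF norm_ge_zero g]
      by (intro integrable_const_bound[where B="K*B"]) (auto simp: norm_mult intro!: mult_mono)
    \<comment> \<open>The shift by B + 1 lifts the real part to at least 1. It is harmless because
      constants factor trivially.\<close>
    define W where "W \<omega> = Re (Z \<omega>) + (B + 1)" for \<omega>
    have charc: "(CLINT \<omega>|M. iexp (y * X \<omega>) * cnj (Z \<omega>)) = (CLINT \<omega>|M. iexp (y * X \<omega>)) * cnj (CLINT \<omega>|M. Z \<omega>)" for y
    proof -
      have "(CLINT \<omega>|M. iexp (y * X \<omega>) * cnj (Z \<omega>)) = (CLINT \<omega>|M. cnj (iexp (- y * X \<omega>) * Z \<omega>))"
        by (intro Bochner_Integration.integral_cong) (auto simp: exp_cnj)
      also have "\<dots> = cnj (CLINT \<omega>|M. iexp (- y * X \<omega>) * Z \<omega>)"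
        by (rule Bochner_Integration.integral_cnj)
      also have "\<dots> = cnj (CLINT \<omega>|M. iexp (- y * X \<omega>)) * cnj (CLINT \<omega>|M. Z \<omega>)"
        by (simp only: char complex_cnj_mult)
      also have "cnj (CLINT \<omega>|M. iexp (- y * X \<omega>)) = (CLINT \<omega>|M. iexp (y * X \<omega>))"
        unfolding Bochner_Integration.integral_cnj[symmetric]
        by (intro Bochner_Integration.integral_cong) (auto simp: exp_cnj)
      finally show ?thesis .
    qed
    have charW: "(CLINT \<omega>|M. iexp (y * X \<omega>) * W \<omega>) = (CLINT \<omega>|M. iexp (y * X \<omega>)) * expectation W" for y
    proof -
      have "(CLINT \<omega>|M. iexp (y * X \<omega>) * W \<omega>) = (CLINT \<omega>|M. (iexp (y * X \<omega>) * Z \<omega> + iexp (y * X \<omega>) * cnj (Z \<omega>)) / 2 + iexp (y * X \<omega>) * (B + 1))"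
        by (intro Bochner_Integration.integral_cong)
          (auto simp: W_def complex_eq_iff Re_exp Im_exp algebra_simps simp del: of_real_mult)
      also have "\<dots> = (CLINT \<omega>|M. iexp (y * X \<omega>)) * (((CLINT \<omega>|M. Z \<omega>) + cnj (CLINT \<omega>|M. Z \<omega>)) / 2 + (B + 1))"
        using inteZ[of y] intecZ[of y] inte[of y] by (simp add: char charc distrib_left add_divide_distrib del: of_real_mult)
      also have "((CLINT \<omega>|M. Z \<omega>) + cnj (CLINT \<omega>|M. Z \<omega>)) / 2 + (B + 1) = expectation W"
        using intRe integral_Re[OF intZ] prob_space by (simp add: W_def[abs_def] complex_eq_iff)
      finally show ?thesis .
    qed
    have W: "1 \<le> W \<omega>" "W \<omega> \<le> 2 * B + 1" for \<omega>
      using ReB[of \<omega>] by (auto simp: W_def)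
    have [measurable]: "W \<in> borel_measurable M" unfolding W_def by measurable
    have "(CLINT \<omega>|M. g (X \<omega>) * W \<omega>) = (CLINT \<omega>|M. g (X \<omega>)) * expectation W"
      by (rule factor_bounded_real_weight[OF _ _ _ W charW]) measurable
    moreover have "(CLINT \<omega>|M. g (X \<omega>) * W \<omega>) = (CLINT \<omega>|M. g (X \<omega>) * Re (Z \<omega>)) + (CLINT \<omega>|M. g (X \<omega>)) * (B + 1)"
    proof -
      have "(CLINT \<omega>|M. g (X \<omega>) * W \<omega>) = (CLINT \<omega>|M. g (X \<omega>) * Re (Z \<omega>) + g (X \<omega>) * (B + 1))"
        by (intro Bochner_Integration.integral_cong) (auto simp: W_def algebra_simps)
      then show ?thesis using intgRe intg by simp
    qed
    moreover have "expectation W = (LINT \<omega>|M. Re (Z \<omega>)) + (B + 1)"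
      using intRe prob_space by (simp add: W_def[abs_def])
    ultimately show ?thesis by (simp add: algebra_simps)
  qed
  have intZ: "integrable M Z" using Z by (intro integrable_const_bound[where B=B]) auto
  have intgp: "integrable M (\<lambda>\<omega>. g (X \<omega>) * p \<omega>)" if [measurable]: "p \<in> borel_measurable M" and "\<And>\<omega>. cmod (p \<omega>) \<le> B" for p
    using that(2) g order_trans[OF norm_ge_zero g]
    by (intro integrable_const_bound[where B="K*B"]) (auto simp: norm_mult intro!: mult_mono)
  have Im: "(CLINT \<omega>|M. g (X \<omega>) * Im (Z \<omega>)) = (CLINT \<omega>|M. g (X \<omega>)) * (LINT \<omega>|M. Im (Z \<omega>))"
  proof -
    \<comment> \<open>The imaginary part of \<open>Z\<close> is the real part of - i
      \<open>Z\<close>.\<close>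
    have "(CLINT \<omega>|M. iexp (y * X \<omega>) * (- \<i> * Z \<omega>)) = (CLINT \<omega>|M. iexp (y * X \<omega>)) * (CLINT \<omega>|M. - \<i> * Z \<omega>)" for y
      using char[of y] by (simp add: mult.left_commute[of _ \<i>] del: of_real_mult)
    from real_part[OF _ _ this] show ?thesis using Z by (simp add: norm_mult)
  qed
  have "(CLINT \<omega>|M. g (X \<omega>) * Z \<omega>) = (CLINT \<omega>|M. g (X \<omega>) * Re (Z \<omega>) + \<i> * (g (X \<omega>) * Im (Z \<omega>)))"
    by (intro Bochner_Integration.integral_cong refl) (subst (1) complex_eq, simp add: algebra_simps)
  also have "\<dots> = (CLINT \<omega>|M. g (X \<omega>)) * ((LINT \<omega>|M. Re (Z \<omega>)) + \<i> * (LINT \<omega>|M. Im (Z \<omega>)))"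
    using order_trans[OF abs_Re_le_cmod Z] order_trans[OF abs_Im_le_cmod Z]
    by (subst Bochner_Integration.integral_add) (auto intro!: intgp integrable_mult_right simp: real_part[OF _ Z char] Im algebra_simps)
  also have "(LINT \<omega>|M. Re (Z \<omega>)) + \<i> * (LINT \<omega>|M. Im (Z \<omega>)) = (CLINT \<omega>|M. Z \<omega>)"
    using integral_Re[OF intZ] integral_Im[OF intZ] by (simp add: complex_eq_iff)
  finally show ?thesis .
qed

text \<open>Kac's theorem: a joint characteristic function of product form forces independence. The
  exponentials are replaced by arbitrary bounded functions one index at a time.\<close>

theorem expectation_prod_eq_prod_expectation:
  fixes Y :: "'i \<Rightarrow> 'a \<Rightarrow> real" and G :: "'i \<Rightarrow> real \<Rightarrow> complex"
  assumes A: "finite A"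
    and Y: "\<And>j. j \<in> A \<Longrightarrow> Y j \<in> borel_measurable M"
    and char: "\<And>a. (CLINT \<omega>|M. (\<Prod>j\<in>A. iexp (a j * Y j \<omega>))) = (\<Prod>j\<in>A. CLINT \<omega>|M. iexp (a j * Y j \<omega>))"
    and G: "\<And>j. j \<in> A \<Longrightarrow> G j \<in> borel_measurable borel" "\<And>j x. j \<in> A \<Longrightarrow> cmod (G j x) \<le> 1"
  shows "(CLINT \<omega>|M. (\<Prod>j\<in>A. G j (Y j \<omega>))) = (\<Prod>j\<in>A. CLINT \<omega>|M. G j (Y j \<omega>))"
proof -
  have cm: "cmod (iexp (y * x)) = 1" for y x using norm_exp_i_times[of "y * x"] by simp
  have "(CLINT \<omega>|M. (\<Prod>j\<in>A. G j (Y j \<omega>))) = (\<Prod>j\<in>A. CLINT \<omega>|M. G j (Y j \<omega>))"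
    if "finite B" "B \<subseteq> A" "\<And>j. j \<in> A \<Longrightarrow> G j \<in> borel_measurable borel" "\<And>j x. j \<in> A \<Longrightarrow> cmod (G j x) \<le> 1"
      "\<And>j. j \<in> A - B \<Longrightarrow> \<exists>a. G j = (\<lambda>x. iexp (a * x))" for B G
    using that
  proof (induction arbitrary: G)
    case empty
    then obtain a where a: "\<And>j. j \<in> A \<Longrightarrow> G j = (\<lambda>x. iexp (a j * x))"
      by (metis Diff_empty)
    then show ?case using char[of a] by (simp cong: prod.cong)
  next
    case (insert k B)
    have k: "k \<in> A" using insert by auto
    note [measurable] = Y[OF k] insert.prems(2)[OF k]
    define Z where "Z \<omega> = (\<Prod>j\<in>A - {k}. G j (Y j \<omega>))" for \<omega>
    have Zm[measurable]: "Z \<in> borel_measurable M"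
      unfolding Z_def using insert.prems(2) Y by (intro borel_measurable_prod) (auto intro: measurable_compose)
    have ZB: "cmod (Z \<omega>) \<le> 1" for \<omega>
      unfolding Z_def prod_norm[symmetric] using insert.prems(3) by (intro prod_le_1) auto
    have split: "(\<Prod>j\<in>A. h j) = h k * (\<Prod>j\<in>A - {k}. h j)" for h :: "'i \<Rightarrow> complex"
      using A k by (rule prod.remove)
    have IH: "(CLINT \<omega>|M. iexp (y * Y k \<omega>) * Z \<omega>) = (CLINT \<omega>|M. iexp (y * Y k \<omega>)) * (\<Prod>j\<in>A - {k}. CLINT \<omega>|M. G j (Y j \<omega>))" for y
    proof -
      define G' where "G' = G(k := (\<lambda>x. iexp (y * x)))"
      have "(CLINT \<omega>|M. (\<Prod>j\<in>A. G' j (Y j \<omega>))) = (\<Prod>j\<in>A. CLINT \<omega>|M. G' j (Y j \<omega>))"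
        by (rule insert.IH) (use insert.prems in \<open>auto simp: G'_def cm simp del: of_real_mult\<close>)
      moreover have "(\<Prod>j\<in>A - {k}. G' j (Y j \<omega>)) = Z \<omega>" for \<omega>
        unfolding Z_def by (rule prod.cong) (auto simp: G'_def)
      moreover have "(\<Prod>j\<in>A - {k}. CLINT \<omega>|M. G' j (Y j \<omega>)) = (\<Prod>j\<in>A - {k}. CLINT \<omega>|M. G j (Y j \<omega>))"
        by (rule prod.cong) (auto simp: G'_def)
      moreover have "G' k = (\<lambda>x. iexp (y * x))" by (simp add: G'_def)
      ultimately show ?thesis unfolding split by simp
    qed
    have EZ: "(CLINT \<omega>|M. Z \<omega>) = (\<Prod>j\<in>A - {k}. CLINT \<omega>|M. G j (Y j \<omega>))"
      using IH[of 0] prob_space by simp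
    show ?case
      unfolding split EZ[symmetric] unfolding Z_def[symmetric]
      by (rule factor_bounded_weight[where B=1 and K=1])
        (use ZB IH EZ insert.prems(3)[OF k] in auto)
  qed
  from this[OF A order_refl G] show ?thesis by simp
qed

end

section \<open>Wiener integrals and their quadratic forms\<close>

lemma (in prob_space) expectation_abs_le_sqrt:
  fixes Y :: "'a \<Rightarrow> real"
  assumes [measurable]: "Y \<in> borel_measurable M" and Y2: "integrable M (\<lambda>\<omega>. (Y \<omega>)\<^sup>2)"
  shows "integrable M Y" "expectation (\<lambda>\<omega>. \<bar>Y \<omega>\<bar>) \<le> sqrt (expectation (\<lambda>\<omega>. (Y \<omega>)\<^sup>2))"
proof -
  show int: "integrable M Y"
    using Y2 by (rule square_integrable_imp_integrable[rotated]) simp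
  have "variance (\<lambda>\<omega>. \<bar>Y \<omega>\<bar>) = expectation (\<lambda>\<omega>. \<bar>Y \<omega>\<bar>\<^sup>2) - (expectation (\<lambda>\<omega>. \<bar>Y \<omega>\<bar>))\<^sup>2"
    using int Y2 by (intro variance_eq) auto
  then have "(expectation (\<lambda>\<omega>. \<bar>Y \<omega>\<bar>))\<^sup>2 \<le> expectation (\<lambda>\<omega>. (Y \<omega>)\<^sup>2)"
    using variance_positive[of "\<lambda>\<omega>. \<bar>Y \<omega>\<bar>"] by simp
  then show "expectation (\<lambda>\<omega>. \<bar>Y \<omega>\<bar>) \<le> sqrt (expectation (\<lambda>\<omega>. (Y \<omega>)\<^sup>2))"
    by (rule real_le_rsqrt)
qed

lemma (in prob_space) centered_gaussian_char:
  assumes "centered_gaussian M Y"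
  shows "(CLINT \<omega>|M. iexp (y * Y \<omega>)) = exp (- (y\<^sup>2 * expectation (\<lambda>\<omega>. (Y \<omega>)\<^sup>2)) / 2)"
proof -
  have [measurable]: "Y \<in> borel_measurable M" using assms by (simp add: centered_gaussian_def)
  consider "AE \<omega> in M. Y \<omega> = 0" | \<sigma> where "\<sigma> > 0" "distributed M lborel Y (\<lambda>x. ennreal (normal_density 0 \<sigma> x))"
    using assms by (auto simp: centered_gaussian_def)
  then show ?thesis
  proof cases
    case 1
    have "(CLINT \<omega>|M. iexp (y * Y \<omega>)) = (CLINT \<omega>|M. 1)"
      using 1 by (intro integral_cong_AE) auto
    moreover have "expectation (\<lambda>\<omega>. (Y \<omega>)\<^sup>2) = expectation (\<lambda>_. 0)"
      using 1 by (intro integral_cong_AE) auto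
    ultimately show ?thesis using prob_space by simp
  next
    case 2
    have var: "expectation (\<lambda>\<omega>. (Y \<omega>)\<^sup>2) = \<sigma>\<^sup>2"
      using normal_distributed_variance[OF 2] normal_distributed_expectation[OF 2] by simp
    define Z where "Z \<omega> = (Y \<omega> - 0) / \<sigma>" for \<omega>
    have Z: "distributed M lborel Z (\<lambda>x. ennreal (std_normal_density x))"
      using normal_standard_normal_convert[OF 2(1), of Y 0] 2(2) by (simp add: Z_def[abs_def])
    have Zm[measurable]: "Z \<in> borel_measurable M" by (simp add: Z_def[abs_def])
    have dZ: "distr M borel Z = std_normal_distribution"
      using distributed_distr_eq_density[OF Z] by (simp cong: distr_cong)
    have "(CLINT \<omega>|M. iexp (y * Y \<omega>)) = (CLINT \<omega>|M. iexp ((y * \<sigma>) * Z \<omega>))"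
      using 2(1) by (simp add: Z_def)
    also have "\<dots> = char (distr M borel Z) (y * \<sigma>)"
      unfolding char_def by (subst integral_distr) auto
    also have "\<dots> = exp (- ((y * \<sigma>)\<^sup>2) / 2)"
      unfolding dZ char_std_normal_distribution ..
    finally show ?thesis unfolding var by (simp add: power_mult_distrib)
  qed
qed

section \<open>Law and moments of the Wiener integral\<close>

context wiener_integral
begin

declare measurable_I [measurable]

lemma I_sum:
  assumes "finite T"
  shows "AE \<omega> in M. I\<^sub>1 (\<Sum>t\<in>T. c t *\<^sub>R g t) \<omega> = (\<Sum>t\<in>T. c t * I\<^sub>1 (g t) \<omega>)"
  using assms
proof induction
  case empty
  show ?case using linear_I[of 0 0 0 0] by simp
next
  case (insert t T)
  show ?case
    using insert.IH linear_I[of "c t" "g t" 1 "\<Sum>t\<in>T. c t *\<^sub>R g t"]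
    by eventually_elim (use insert.hyps in simp)
qed

lemma I_char_span:
  assumes "w \<in> span (ind ` {0..})"
  shows "(CLINT \<omega>|M. iexp (y * I\<^sub>1 w \<omega>)) = exp (- (y\<^sup>2 * (norm w)\<^sup>2) / 2)"
proof -
  from assms obtain S r where S: "finite S" "S \<subseteq> ind ` {0..}" "w = (\<Sum>a\<in>S. r a *\<^sub>R a)"
    unfolding span_explicit by blast
  \<comment> \<open>Different times may have the same class, so one time is chosen for each vector;
    this makes the sum reindexable over times.\<close>
  then obtain T where T: "T \<subseteq> {0..}" "inj_on ind T" "S = ind ` T"
    unfolding subset_image_inj by blast
  have fT: "finite T" using S(1) T by (simp add: finite_image_iff)
  have w: "w = (\<Sum>t\<in>T. r (ind t) *\<^sub>R ind t)"
    unfolding S(3) T(3) using T(2) by (simp add: sum.reindex)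
  define Y where "Y \<omega> = (\<Sum>t\<in>T. r (ind t) * G t \<omega>)" for \<omega>
  have Y: "centered_gaussian M Y"
    unfolding Y_def[abs_def] using fT T(1) by (rule gaussian)
  have [measurable]: "Y \<in> borel_measurable M" using Y by (simp add: centered_gaussian_def)
  have "AE \<omega> in M. \<forall>t\<in>T. I\<^sub>1 (ind t) \<omega> = G t \<omega>"
    using fT T(1) I_ind by (intro AE_finite_allI) auto
  with I_sum[OF fT, of "\<lambda>t. r (ind t)" ind]
  have eq: "AE \<omega> in M. I\<^sub>1 w \<omega> = Y \<omega>"
    by eventually_elim (simp add: Y_def w)
  have "(CLINT \<omega>|M. iexp (y * I\<^sub>1 w \<omega>)) = (CLINT \<omega>|M. iexp (y * Y \<omega>))"
    using eq by (intro integral_cong_AE) auto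
  moreover have "expectation (\<lambda>\<omega>. (Y \<omega>)\<^sup>2) = expectation (\<lambda>\<omega>. (I\<^sub>1 w \<omega>)\<^sup>2)"
    using eq by (intro integral_cong_AE) auto
  ultimately show ?thesis
    using centered_gaussian_char[OF Y, of y] by (simp add: isometry_I)
qed

text \<open>Extension from the dense span by continuity: |exp(i y a) - exp(i y b)| <= |y| |a - b|,
  and the L^1 norm of the integral of v - w is at most its L^2 norm, which the isometry identifies
  with the norm of v - w.\<close>

lemma I_char: "(CLINT \<omega>|M. iexp (y * I\<^sub>1 w \<omega>)) = exp (- (y\<^sup>2 * (norm w)\<^sup>2) / 2)"
proof -
  have "w \<in> closure (span (ind ` {0..}))" using dense_ind by simp
  then obtain v where v: "\<And>n. v n \<in> span (ind ` {0..})" "v \<longlonglongrightarrow> w"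
    unfolding closure_sequential by blast
  have inte: "integrable M (\<lambda>\<omega>. iexp (y * I\<^sub>1 g \<omega>))" for g
    using norm_exp_i_times[of "y * I\<^sub>1 g \<omega>" for \<omega>] by (intro integrable_const_bound[where B=1]) auto
  have bound: "cmod ((CLINT \<omega>|M. iexp (y * I\<^sub>1 (v n) \<omega>)) - (CLINT \<omega>|M. iexp (y * I\<^sub>1 w \<omega>))) \<le> \<bar>y\<bar> * norm (v n - w)" for n
  proof -
    have intd: "integrable M (I\<^sub>1 (v n - w))"
      by (rule expectation_abs_le_sqrt(1)[OF measurable_I square_integrable_I])
    have "cmod (iexp (y * a) - iexp (y * b)) \<le> \<bar>y\<bar> * \<bar>a - b\<bar>" for a b
    proof -
      have "iexp (y * a) - iexp (y * b) = iexp (y * b) * (iexp (y * (a - b)) - 1)"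
        by (simp add: right_diff_distrib exp_diff)
      then have "cmod (iexp (y * a) - iexp (y * b)) = cmod (iexp (y * (a - b)) - 1)"
        using norm_exp_i_times[of "y * b"] by (simp add: norm_mult del: of_real_mult)
      also have "\<dots> \<le> \<bar>y * (a - b)\<bar>" using iexp_approx1[of "y * (a - b)" 0] by simp
      finally show ?thesis by (simp add: abs_mult)
    qed
    moreover have "AE \<omega> in M. I\<^sub>1 (v n - w) \<omega> = I\<^sub>1 (v n) \<omega> - I\<^sub>1 w \<omega>"
      using linear_I[of 1 "v n" "-1" w] by simp
    ultimately have pt: "AE \<omega> in M. cmod (iexp (y * I\<^sub>1 (v n) \<omega>) - iexp (y * I\<^sub>1 w \<omega>)) \<le> \<bar>y\<bar> * \<bar>I\<^sub>1 (v n - w) \<omega>\<bar>"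
      by (auto elim!: eventually_mono simp del: of_real_mult)
    have eq: "(CLINT \<omega>|M. iexp (y * I\<^sub>1 (v n) \<omega>)) - (CLINT \<omega>|M. iexp (y * I\<^sub>1 w \<omega>))
      = (CLINT \<omega>|M. iexp (y * I\<^sub>1 (v n) \<omega>) - iexp (y * I\<^sub>1 w \<omega>))"
      by (rule Bochner_Integration.integral_diff[OF inte inte, symmetric])
    have "cmod (CLINT \<omega>|M. iexp (y * I\<^sub>1 (v n) \<omega>) - iexp (y * I\<^sub>1 w \<omega>)) \<le> (LINT \<omega>|M. cmod (iexp (y * I\<^sub>1 (v n) \<omega>) - iexp (y * I\<^sub>1 w \<omega>)))"
      by (rule integral_norm_bound)
    moreover have "(LINT \<omega>|M. cmod (iexp (y * I\<^sub>1 (v n) \<omega>) - iexp (y * I\<^sub>1 w \<omega>))) \<le> (LINT \<omega>|M. \<bar>y\<bar> * \<bar>I\<^sub>1 (v n - w) \<omega>\<bar>)"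
      using pt by (rule integral_mono_AE[rotated 2])
        (use intd in \<open>auto intro!: integrable_norm Bochner_Integration.integrable_diff inte simp del: of_real_mult\<close>)
    moreover have "(LINT \<omega>|M. \<bar>y\<bar> * \<bar>I\<^sub>1 (v n - w) \<omega>\<bar>) \<le> \<bar>y\<bar> * norm (v n - w)"
      using expectation_abs_le_sqrt(2)[OF measurable_I square_integrable_I, of "v n - w"]
      by (simp add: isometry_I mult_left_mono)
    ultimately show ?thesis unfolding eq by linarith
  qed
  have "(\<lambda>n. (CLINT \<omega>|M. iexp (y * I\<^sub>1 (v n) \<omega>)) - (CLINT \<omega>|M. iexp (y * I\<^sub>1 w \<omega>))) \<longlonglongrightarrow> 0"
  proof (rule Lim_null_comparison[OF eventuallyI[OF bound]])
    have "(\<lambda>n. \<bar>y\<bar> * norm (v n - w)) \<longlonglongrightarrow> \<bar>y\<bar> * norm (w - w)"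
      by (intro tendsto_intros v)
    then show "(\<lambda>n. \<bar>y\<bar> * norm (v n - w)) \<longlonglongrightarrow> 0" by simp
  qed
  then have "(\<lambda>n. CLINT \<omega>|M. iexp (y * I\<^sub>1 (v n) \<omega>)) \<longlonglongrightarrow> (CLINT \<omega>|M. iexp (y * I\<^sub>1 w \<omega>))"
    using Lim_null by blast
  moreover have "(\<lambda>n. complex_of_real (exp (- (y\<^sup>2 * (norm (v n))\<^sup>2) / 2))) \<longlonglongrightarrow> complex_of_real (exp (- (y\<^sup>2 * (norm w)\<^sup>2) / 2))"
    by (intro tendsto_intros v) auto
  ultimately show ?thesis
    unfolding I_char_span[OF v(1)] by (rule LIMSEQ_unique)
qed

text \<open>Written as an image law rather than a density so that the degenerate case of norm 0 is
  included.\<close>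

lemma distr_I: "distr M borel (I\<^sub>1 w) = distr std_normal_distribution borel (\<lambda>x. norm w * x)"
proof (rule Levy_uniqueness)
  interpret S: real_distribution std_normal_distribution by (rule real_dist_normal_dist)
  show "real_distribution (distr M borel (I\<^sub>1 w))"
    by (rule real_distribution_distr) simp
  show "real_distribution (distr std_normal_distribution borel (\<lambda>x. norm w * x))"
    by (rule S.real_distribution_distr) simp
  show "char (distr M borel (I\<^sub>1 w)) = char (distr std_normal_distribution borel (\<lambda>x. norm w * x))"
  proof
    fix y
    have "char (distr M borel (I\<^sub>1 w)) y = exp (- (y\<^sup>2 * (norm w)\<^sup>2) / 2)"
      unfolding char_def I_char[symmetric] by (subst integral_distr) auto
    also have "\<dots> = char std_normal_distribution (y * norm w)"
      by (simp add: char_std_normal_distribution power_mult_distrib)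
    also have "\<dots> = char (distr std_normal_distribution borel (\<lambda>x. norm w * x)) y"
      unfolding char_def by (subst integral_distr) (auto simp: mult.assoc)
    finally show "char (distr M borel (I\<^sub>1 w)) y = char (distr std_normal_distribution borel (\<lambda>x. norm w * x)) y" .
  qed
qed

lemma expectation_iexp_I_square: "(CLINT \<omega>|M. iexp (t * (I\<^sub>1 w \<omega>)\<^sup>2)) = square_char ((norm w)\<^sup>2 * t)"
proof -
  have "(CLINT \<omega>|M. iexp (t * (I\<^sub>1 w \<omega>)\<^sup>2)) = (CLINT x|distr M borel (I\<^sub>1 w). iexp (t * x\<^sup>2))"
    by (subst integral_distr) auto
  also have "\<dots> = square_char ((norm w)\<^sup>2 * t)"
    unfolding distr_I square_char_def by (subst integral_distr) (auto simp: power_mult_distrib mult_ac)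
  finally show ?thesis .
qed

lemma I_power4: "integrable M (\<lambda>\<omega>. (I\<^sub>1 w \<omega>) ^ 4)" "expectation (\<lambda>\<omega>. (I\<^sub>1 w \<omega>) ^ 4) = 3 * norm w ^ 4"
proof -
  have int: "integrable std_normal_distribution (\<lambda>x. (norm w * x) ^ 4)"
    using integrable_std_normal_distribution_moment[of 4] unfolding power_mult_distrib by simp
  have "integrable (distr M borel (I\<^sub>1 w)) (\<lambda>x. x ^ 4)"
    unfolding distr_I using int by (subst integrable_distr_eq) auto
  then show "integrable M (\<lambda>\<omega>. (I\<^sub>1 w \<omega>) ^ 4)"
    by (subst (asm) integrable_distr_eq) auto
  have "expectation (\<lambda>\<omega>. (I\<^sub>1 w \<omega>) ^ 4) = (LINT x|distr M borel (I\<^sub>1 w). x ^ 4)"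
    by (subst integral_distr) auto
  also have "\<dots> = (LINT x|std_normal_distribution. norm w ^ 4 * x ^ 4)"
    unfolding distr_I by (subst integral_distr) (auto simp: power_mult_distrib)
  also have "\<dots> = 3 * norm w ^ 4"
    using std_normal_distribution_even_moments(1)[of 2] integral_mult_right_zero[of std_normal_distribution "norm w ^ 4" "\<lambda>x. x ^ 4"]
    by (simp add: fact_numeral del: integral_mult_right_zero integral_mult_right)
  finally show "expectation (\<lambda>\<omega>. (I\<^sub>1 w \<omega>) ^ 4) = 3 * norm w ^ 4" .
qed

lemma expectation_I_mult:
  shows "integrable M (\<lambda>\<omega>. I\<^sub>1 v \<omega> * I\<^sub>1 w \<omega>)" "expectation (\<lambda>\<omega>. I\<^sub>1 v \<omega> * I\<^sub>1 w \<omega>) = v \<bullet> w"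
proof -
  have ae: "AE \<omega> in M. I\<^sub>1 v \<omega> * I\<^sub>1 w \<omega> = ((I\<^sub>1 (v + w) \<omega>)\<^sup>2 - (I\<^sub>1 v \<omega>)\<^sup>2 - (I\<^sub>1 w \<omega>)\<^sup>2) / 2"
    using linear_I[of 1 v 1 w] by eventually_elim (simp add: power2_eq_square algebra_simps)
  show "integrable M (\<lambda>\<omega>. I\<^sub>1 v \<omega> * I\<^sub>1 w \<omega>)"
    by (subst integrable_cong_AE[OF _ _ ae]) (auto intro!: square_integrable_I Bochner_Integration.integrable_diff)
  have "expectation (\<lambda>\<omega>. I\<^sub>1 v \<omega> * I\<^sub>1 w \<omega>) = expectation (\<lambda>\<omega>. ((I\<^sub>1 (v + w) \<omega>)\<^sup>2 - (I\<^sub>1 v \<omega>)\<^sup>2 - (I\<^sub>1 w \<omega>)\<^sup>2) / 2)"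
    by (rule integral_cong_AE[OF _ _ ae]) auto
  also have "\<dots> = ((norm (v + w))\<^sup>2 - (norm v)\<^sup>2 - (norm w)\<^sup>2) / 2"
    by (simp add: square_integrable_I isometry_I)
  also have "\<dots> = v \<bullet> w"
    by (simp add: power2_norm_eq_inner inner_add_left inner_add_right inner_commute)
  finally show "expectation (\<lambda>\<omega>. I\<^sub>1 v \<omega> * I\<^sub>1 w \<omega>) = v \<bullet> w" .
qed

text \<open>By polarization of the fourth moment: \<open>(a + b)^4 + (a - b)^4 = 2 a^4 + 12 a^2 b^2 + 2 b^4\<close>.\<close>

lemma expectation_I_square_mult_square:
  shows "integrable M (\<lambda>\<omega>. (I\<^sub>1 v \<omega>)\<^sup>2 * (I\<^sub>1 w \<omega>)\<^sup>2)"
    and "expectation (\<lambda>\<omega>. (I\<^sub>1 v \<omega>)\<^sup>2 * (I\<^sub>1 w \<omega>)\<^sup>2) = (norm v)\<^sup>2 * (norm w)\<^sup>2 + 2 * (v \<bullet> w)\<^sup>2"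
proof -
  have pol: "a\<^sup>2 * b\<^sup>2 = ((a + b) ^ 4 + (a - b) ^ 4 - 2 * a ^ 4 - 2 * b ^ 4) / 12" for a b :: real
    by (simp add: eval_nat_numeral algebra_simps)
  have ae: "AE \<omega> in M. (I\<^sub>1 v \<omega>)\<^sup>2 * (I\<^sub>1 w \<omega>)\<^sup>2 =
      ((I\<^sub>1 (v + w) \<omega>) ^ 4 + (I\<^sub>1 (v - w) \<omega>) ^ 4 - 2 * (I\<^sub>1 v \<omega>) ^ 4 - 2 * (I\<^sub>1 w \<omega>) ^ 4) / 12"
    using linear_I[of 1 v 1 w] linear_I[of 1 v "-1" w]
    by eventually_elim (simp add: pol)
  show "integrable M (\<lambda>\<omega>. (I\<^sub>1 v \<omega>)\<^sup>2 * (I\<^sub>1 w \<omega>)\<^sup>2)"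
    by (subst integrable_cong_AE[OF _ _ ae]) (auto intro!: I_power4 Bochner_Integration.integrable_diff Bochner_Integration.integrable_add)
  have n4: "norm x ^ 4 = (x \<bullet> x)\<^sup>2" for x :: 'h
    by (simp flip: power2_norm_eq_inner)
  have "expectation (\<lambda>\<omega>. (I\<^sub>1 v \<omega>)\<^sup>2 * (I\<^sub>1 w \<omega>)\<^sup>2) =
      expectation (\<lambda>\<omega>. ((I\<^sub>1 (v + w) \<omega>) ^ 4 + (I\<^sub>1 (v - w) \<omega>) ^ 4 - 2 * (I\<^sub>1 v \<omega>) ^ 4 - 2 * (I\<^sub>1 w \<omega>) ^ 4) / 12)"
    by (rule integral_cong_AE[OF _ _ ae]) auto
  also have "\<dots> = (3 * norm (v + w) ^ 4 + 3 * norm (v - w) ^ 4 - 2 * (3 * norm v ^ 4) - 2 * (3 * norm w ^ 4)) / 12"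
    by (simp add: I_power4)
  also have "\<dots> = (norm v)\<^sup>2 * (norm w)\<^sup>2 + 2 * (v \<bullet> w)\<^sup>2"
    unfolding n4 power2_norm_eq_inner
    by (simp add: inner_add_left inner_add_right inner_diff_left inner_diff_right inner_commute[of w v] power2_eq_square algebra_simps)
  finally show "expectation (\<lambda>\<omega>. (I\<^sub>1 v \<omega>)\<^sup>2 * (I\<^sub>1 w \<omega>)\<^sup>2) = (norm v)\<^sup>2 * (norm w)\<^sup>2 + 2 * (v \<bullet> w)\<^sup>2" .
qed

end

section \<open>Traces of powers of the Gram matrix\<close>

lemma orthogonal_on_sum_square:
  assumes A: "finite A" and u: "orthogonal_on A u"
  shows "(\<Sum>p\<in>A. (\<Sum>i\<in>A. u (p, i) * x i)\<^sup>2) = (\<Sum>i\<in>A. (x i)\<^sup>2)"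
proof -
  have "(\<Sum>p\<in>A. (\<Sum>i\<in>A. u (p, i) * x i)\<^sup>2) = (\<Sum>p\<in>A. \<Sum>i\<in>A. \<Sum>k\<in>A. (u (p, i) * u (p, k)) * (x i * x k))"
    by (simp add: power2_eq_square sum_product mult_ac)
  also have "\<dots> = (\<Sum>i\<in>A. \<Sum>k\<in>A. \<Sum>p\<in>A. (u (p, i) * u (p, k)) * (x i * x k))"
    by (subst sum.swap, rule sum.cong[OF refl], rule sum.swap)
  also have "\<dots> = (\<Sum>i\<in>A. \<Sum>k\<in>A. of_bool (i = k) * (x i * x k))"
    using u by (simp add: orthogonal_on_def flip: sum_distrib_right)
  also have "\<dots> = (\<Sum>i\<in>A. (x i)\<^sup>2)"
    using A by (intro sum.cong refl) (simp add: of_bool_def if_distrib[of "\<lambda>x. x * _"] power2_eq_square sum.delta cong: if_cong)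
  finally show ?thesis .
qed

context
  fixes A :: "'i set" and u :: "'i \<times> 'i \<Rightarrow> real" and h w :: "'i \<Rightarrow> 'h::real_inner"
  assumes A: "finite A" and u: "orthogonal_on A u"
    and w: "\<And>p. w p = (\<Sum>i\<in>A. u (p, i) *\<^sub>R h i)"
    and orth: "\<And>p q. p \<in> A \<Longrightarrow> q \<in> A \<Longrightarrow> p \<noteq> q \<Longrightarrow> w p \<bullet> w q = 0"
begin

text \<open>The spectral decomposition of the Gram matrix, with the squared norms of the rotated
  vectors as eigenvalues. Orthonormality of the columns of \<open>u\<close> recovers each
  \<open>h j\<close> from the \<open>w p\<close>, and orthogonality kills the mixed terms.\<close>

lemma inner_eq_sum_diagonal:
  assumes ik: "i \<in> A" "k \<in> A"
  shows "h i \<bullet> h k = (\<Sum>p\<in>A. (norm (w p))\<^sup>2 * (u (p, i) * u (p, k)))"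
proof -
  have h: "h j = (\<Sum>p\<in>A. u (p, j) *\<^sub>R w p)" if "j \<in> A" for j
  proof -
    have "(\<Sum>p\<in>A. u (p, j) *\<^sub>R w p) = (\<Sum>k\<in>A. \<Sum>p\<in>A. (u (p, j) * u (p, k)) *\<^sub>R h k)"
      unfolding w by (subst sum.swap) (simp add: scaleR_sum_right)
    also have "\<dots> = (\<Sum>k\<in>A. of_bool (j = k) *\<^sub>R h k)"
      using u that by (simp add: orthogonal_on_def flip: scaleR_sum_left)
    also have "\<dots> = h j"
      using A that by (simp add: of_bool_def if_distrib[of "\<lambda>x. x *\<^sub>R _"] sum.delta cong: if_cong)
    finally show ?thesis ..
  qed
  have "h i \<bullet> h k = (\<Sum>p\<in>A. \<Sum>q\<in>A. (u (p, i) * u (q, k)) * (w p \<bullet> w q))"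
    unfolding h[OF ik(1)] h[OF ik(2)]
    by (simp add: inner_sum_left inner_sum_right sum_distrib_left) (subst sum.swap, simp add: mult_ac)
  also have "\<dots> = (\<Sum>p\<in>A. \<Sum>q\<in>A. if q = p then (norm (w p))\<^sup>2 * (u (p, i) * u (p, k)) else 0)"
    using orth by (intro sum.cong refl) (auto simp: dot_square_norm)
  also have "\<dots> = (\<Sum>p\<in>A. (norm (w p))\<^sup>2 * (u (p, i) * u (p, k)))"
    using A by (simp add: sum.delta)
  finally show ?thesis .
qed

text \<open>Matrices diagonal in the same basis multiply by multiplying eigenvalues, since the rows
  of \<open>u\<close> are orthonormal. The eigenvalues are arbitrary so that the rule can be
  iterated.\<close>

lemma sum_diagonal_mult:
  "(\<Sum>m\<in>A. (\<Sum>p\<in>A. a p * (u (p, i) * u (p, m))) * (\<Sum>p\<in>A. b p * (u (p, m) * u (p, k)))) =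
    (\<Sum>p\<in>A. (a p * b p) * (u (p, i) * u (p, k)))"
proof -
  have "(\<Sum>m\<in>A. (\<Sum>p\<in>A. a p * (u (p, i) * u (p, m))) * (\<Sum>p\<in>A. b p * (u (p, m) * u (p, k))))
    = (\<Sum>m\<in>A. \<Sum>p\<in>A. \<Sum>q\<in>A. (a p * b q * u (p, i) * u (q, k)) * (u (p, m) * u (q, m)))"
    by (simp add: sum_product mult_ac)
  also have "\<dots> = (\<Sum>p\<in>A. \<Sum>q\<in>A. \<Sum>m\<in>A. (a p * b q * u (p, i) * u (q, k)) * (u (p, m) * u (q, m)))"
    by (subst sum.swap, rule sum.cong[OF refl], rule sum.swap)
  also have "\<dots> = (\<Sum>p\<in>A. \<Sum>q\<in>A. (a p * b q * u (p, i) * u (q, k)) * of_bool (p = q))"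
    using u by (simp add: orthogonal_on_def flip: sum_distrib_left)
  also have "\<dots> = (\<Sum>p\<in>A. (a p * b p) * (u (p, i) * u (p, k)))"
    using A by (intro sum.cong refl) (simp add: of_bool_def if_distrib[of "\<lambda>x. _ * x"] sum.delta mult_ac cong: if_cong)
  finally show ?thesis .
qed

lemma sum_diagonal_trace: "(\<Sum>i\<in>A. \<Sum>p\<in>A. a p * (u (p, i) * u (p, i))) = (\<Sum>p\<in>A. a p)"
proof -
  have "(\<Sum>i\<in>A. \<Sum>p\<in>A. a p * (u (p, i) * u (p, i))) = (\<Sum>p\<in>A. a p * (\<Sum>i\<in>A. u (p, i) * u (p, i)))"
    by (subst sum.swap) (simp add: sum_distrib_left)
  also have "\<dots> = (\<Sum>p\<in>A. a p)"
    using u by (intro sum.cong refl) (simp add: orthogonal_on_def)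
  finally show ?thesis .
qed

text \<open>Equality of traces. It identifies the centring constants of the quadratic form before
  and after rotation.\<close>

lemma sum_norm_square_diagonal: "(\<Sum>p\<in>A. (norm (w p))\<^sup>2) = (\<Sum>i\<in>A. (norm (h i))\<^sup>2)"
proof -
  have "(\<Sum>i\<in>A. (norm (h i))\<^sup>2) = (\<Sum>i\<in>A. \<Sum>p\<in>A. (norm (w p))\<^sup>2 * (u (p, i) * u (p, i)))"
    unfolding dot_square_norm[symmetric, of "h _"] by (rule sum.cong[OF refl]) (rule inner_eq_sum_diagonal)
  also have "\<dots> = (\<Sum>p\<in>A. (norm (w p))\<^sup>2)" by (rule sum_diagonal_trace)
  finally show ?thesis ..
qed

lemma sum_inner_mult_diagonal:
  assumes ik: "i \<in> A" "k \<in> A"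
  shows "(\<Sum>m\<in>A. (h i \<bullet> h m) * (h m \<bullet> h k)) = (\<Sum>p\<in>A. ((norm (w p))\<^sup>2 * (norm (w p))\<^sup>2) * (u (p, i) * u (p, k)))"
proof -
  have "(\<Sum>m\<in>A. (h i \<bullet> h m) * (h m \<bullet> h k)) = (\<Sum>m\<in>A. (\<Sum>p\<in>A. (norm (w p))\<^sup>2 * (u (p, i) * u (p, m))) * (\<Sum>p\<in>A. (norm (w p))\<^sup>2 * (u (p, m) * u (p, k))))"
    using ik by (intro sum.cong[OF refl]) (simp only: inner_eq_sum_diagonal)
  then show ?thesis by (simp only: sum_diagonal_mult)
qed

text \<open>Both sides are the trace of the square of the Gram matrix; this fixes the variance
  normalization of the weights.\<close>

lemma sum_inner_square_diagonal: "(\<Sum>i\<in>A. \<Sum>k\<in>A. (h i \<bullet> h k)\<^sup>2) = (\<Sum>p\<in>A. ((norm (w p))\<^sup>2)\<^sup>2)"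
proof -
  have "(\<Sum>i\<in>A. \<Sum>k\<in>A. (h i \<bullet> h k)\<^sup>2) = (\<Sum>i\<in>A. \<Sum>k\<in>A. (h i \<bullet> h k) * (h k \<bullet> h i))"
    by (simp add: power2_eq_square inner_commute)
  also have "\<dots> = (\<Sum>i\<in>A. \<Sum>p\<in>A. ((norm (w p))\<^sup>2 * (norm (w p))\<^sup>2) * (u (p, i) * u (p, i)))"
    by (rule sum.cong[OF refl]) (simp only: sum_inner_mult_diagonal)
  also have "\<dots> = (\<Sum>p\<in>A. ((norm (w p))\<^sup>2)\<^sup>2)"
    unfolding sum_diagonal_trace by (simp add: power2_eq_square)
  finally show ?thesis .
qed

text \<open>Both sides are the trace of the cube of the Gram matrix, obtained by multiplying its
  square by the matrix once more.\<close>

lemma sum_inner_cube_diagonal: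
  "(\<Sum>i\<in>A. \<Sum>k\<in>A. \<Sum>m\<in>A. (h i \<bullet> h m) * (h m \<bullet> h k) * (h k \<bullet> h i)) = (\<Sum>p\<in>A. ((norm (w p))\<^sup>2) ^ 3)"
proof -
  have "(\<Sum>i\<in>A. \<Sum>k\<in>A. \<Sum>m\<in>A. (h i \<bullet> h m) * (h m \<bullet> h k) * (h k \<bullet> h i))
    = (\<Sum>i\<in>A. \<Sum>k\<in>A. (\<Sum>m\<in>A. (h i \<bullet> h m) * (h m \<bullet> h k)) * (h k \<bullet> h i))"
    by (simp add: sum_distrib_right)
  also have "\<dots> = (\<Sum>i\<in>A. \<Sum>p\<in>A. ((norm (w p))\<^sup>2 * (norm (w p))\<^sup>2 * (norm (w p))\<^sup>2) * (u (p, i) * u (p, i)))"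
  proof (rule sum.cong[OF refl])
    fix i assume i: "i \<in> A"
    have "(\<Sum>k\<in>A. (\<Sum>m\<in>A. (h i \<bullet> h m) * (h m \<bullet> h k)) * (h k \<bullet> h i)) =
      (\<Sum>k\<in>A. (\<Sum>p\<in>A. ((norm (w p))\<^sup>2 * (norm (w p))\<^sup>2) * (u (p, i) * u (p, k))) * (\<Sum>p\<in>A. (norm (w p))\<^sup>2 * (u (p, k) * u (p, i))))"
      using i by (intro sum.cong[OF refl]) (simp only: sum_inner_mult_diagonal inner_eq_sum_diagonal)
    then show "(\<Sum>k\<in>A. (\<Sum>m\<in>A. (h i \<bullet> h m) * (h m \<bullet> h k)) * (h k \<bullet> h i)) =
      (\<Sum>p\<in>A. ((norm (w p))\<^sup>2 * (norm (w p))\<^sup>2 * (norm (w p))\<^sup>2) * (u (p, i) * u (p, i)))"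
      by (simp only: sum_diagonal_mult)
  qed
  also have "\<dots> = (\<Sum>p\<in>A. ((norm (w p))\<^sup>2) ^ 3)"
    unfolding sum_diagonal_trace by (simp add: power3_eq_cube)
  finally show ?thesis .
qed

end

section \<open>Quadratic forms of Wiener integrals as weighted chi-square sums\<close>

context wiener_integral
begin

text \<open>For orthogonal vectors the squared norm of a combination is a sum by Pythagoras, so its
  Gaussian characteristic function is a product. The factorization for exponentials then extends to
  all bounded functions.\<close>

lemma I_orthogonal_expectation_prod:
  assumes A: "finite A" and orth: "\<And>p q. p \<in> A \<Longrightarrow> q \<in> A \<Longrightarrow> p \<noteq> q \<Longrightarrow> w p \<bullet> w q = 0"
    and G: "\<And>p. p \<in> A \<Longrightarrow> H p \<in> borel_measurable borel" "\<And>p x. p \<in> A \<Longrightarrow> cmod (H p x) \<le> 1"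
  shows "(CLINT \<omega>|M. (\<Prod>p\<in>A. H p (I\<^sub>1 (w p) \<omega>))) = (\<Prod>p\<in>A. CLINT \<omega>|M. H p (I\<^sub>1 (w p) \<omega>))"
proof (rule expectation_prod_eq_prod_expectation[OF A _ _ G])
  fix a :: "'b \<Rightarrow> real"
  define v where "v = (\<Sum>p\<in>A. a p *\<^sub>R w p)"
  have "(CLINT \<omega>|M. (\<Prod>p\<in>A. iexp (a p * I\<^sub>1 (w p) \<omega>))) = (CLINT \<omega>|M. iexp (1 * I\<^sub>1 v \<omega>))"
    using I_sum[OF A, of a w] A
    by (intro integral_cong_AE) (auto elim!: eventually_mono simp: v_def sum_distrib_left exp_sum)
  also have "\<dots> = exp (- (norm v)\<^sup>2 / 2)" using I_char[of 1 v] by simp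
  also have "(norm v)\<^sup>2 = (\<Sum>p\<in>A. (norm (a p *\<^sub>R w p))\<^sup>2)"
    unfolding v_def by (rule norm_sum_Pythagorean[OF A]) (use orth in \<open>auto simp: pairwise_def orthogonal_def\<close>)
  also have "exp (- (\<Sum>p\<in>A. (norm (a p *\<^sub>R w p))\<^sup>2) / 2) = (\<Prod>p\<in>A. exp (- ((a p)\<^sup>2 * (norm (w p))\<^sup>2) / 2))"
    using A by (simp add: power_mult_distrib sum_divide_distrib flip: exp_sum sum_negf)
  also have "complex_of_real \<dots> = (\<Prod>p\<in>A. CLINT \<omega>|M. iexp (a p * I\<^sub>1 (w p) \<omega>))"
    unfolding I_char by (rule of_real_prod)
  finally show "(CLINT \<omega>|M. (\<Prod>p\<in>A. iexp (a p * I\<^sub>1 (w p) \<omega>))) = (\<Prod>p\<in>A. CLINT \<omega>|M. iexp (a p * I\<^sub>1 (w p) \<omega>))" .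
qed simp

text \<open>After rotation \<open>F\<close> is a sum of independent centred squares with weights
  norm(w p)^2 / s. The assumption on \<open>s\<close> is exactly their variance normalization, and
  \<open>L\<close> becomes the trace of the cube over s^3.\<close>

theorem quadratic_form_abs_measure_diff_le:
  fixes h :: "'i \<Rightarrow> 'h" and F :: "'a \<Rightarrow> real"
  assumes A: "finite A" and s: "s > 0" "s\<^sup>2 = 2 * (\<Sum>i\<in>A. \<Sum>k\<in>A. (h i \<bullet> h k)\<^sup>2)"
    and F[measurable]: "F \<in> borel_measurable M"
    and F_eq: "AE \<omega> in M. F \<omega> = (\<Sum>i\<in>A. (I\<^sub>1 (h i) \<omega>)\<^sup>2 - (norm (h i))\<^sup>2) / s"
    and B: "B \<in> sets borel"
  shows "\<bar>measure (distr M borel F) B - measure std_normal_distribution B\<bar> \<le>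
    229376 * ((\<Sum>i\<in>A. \<Sum>k\<in>A. \<Sum>m\<in>A. (h i \<bullet> h m) * (h m \<bullet> h k) * (h k \<bullet> h i)) / s ^ 3)"
proof -
  obtain u where u: "orthogonal_on A u"
    and "\<And>p q. p \<in> A \<Longrightarrow> q \<in> A \<Longrightarrow> p \<noteq> q \<Longrightarrow> (\<Sum>i\<in>A. u (p, i) *\<^sub>R h i) \<bullet> (\<Sum>i\<in>A. u (q, i) *\<^sub>R h i) = 0"
    using orthogonal_diagonalization[OF A, of h] by blast
  moreover define w where "w p = (\<Sum>i\<in>A. u (p, i) *\<^sub>R h i)" for p
  ultimately have orth: "\<And>p q. p \<in> A \<Longrightarrow> q \<in> A \<Longrightarrow> p \<noteq> q \<Longrightarrow> w p \<bullet> w q = 0" by simp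
  define l where "l p = (norm (w p))\<^sup>2 / s" for p
  interpret chi_square_weights A l
  proof
    show "(\<Sum>p\<in>A. 2 * (l p)\<^sup>2) = 1"
    proof -
      have D: "s\<^sup>2 = 2 * (\<Sum>p\<in>A. ((norm (w p))\<^sup>2)\<^sup>2)"
        unfolding s(2) by (rule arg_cong[OF sum_inner_square_diagonal[OF A u w_def orth]])
      have "(\<Sum>p\<in>A. 2 * (l p)\<^sup>2) = 2 * (\<Sum>p\<in>A. ((norm (w p))\<^sup>2)\<^sup>2) / s\<^sup>2"
        by (simp add: l_def power_divide sum_distrib_left sum_divide_distrib)
      also have "\<dots> = 1"
        using s(1) unfolding D[symmetric] by simp
      finally show ?thesis .
    qed
  qed (use A s in \<open>auto simp: l_def\<close>)
  have L: "L = (\<Sum>i\<in>A. \<Sum>k\<in>A. \<Sum>m\<in>A. (h i \<bullet> h m) * (h m \<bullet> h k) * (h k \<bullet> h i)) / s ^ 3"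
  proof -
    have "L = (\<Sum>p\<in>A. ((norm (w p))\<^sup>2) ^ 3) / s ^ 3"
      by (simp add: L_def l_def power_divide sum_divide_distrib)
    also have "(\<Sum>p\<in>A. ((norm (w p))\<^sup>2) ^ 3) = (\<Sum>i\<in>A. \<Sum>k\<in>A. \<Sum>m\<in>A. (h i \<bullet> h m) * (h m \<bullet> h k) * (h k \<bullet> h i))"
      by (rule sum_inner_cube_diagonal[OF A u w_def orth, symmetric])
    finally show ?thesis .
  qed
  have N: "(\<Sum>p\<in>A. (norm (w p))\<^sup>2) = (\<Sum>i\<in>A. (norm (h i))\<^sup>2)"
    by (rule sum_norm_square_diagonal[OF A u w_def orth])
  have cm: "cmod (iexp (y * x)) = 1" for y x using norm_exp_i_times[of "y * x"] by simp
  have "char (distr M borel F) t = f t" for t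
  proof -
    \<comment> \<open>The factor of exp(i t F) contributed by the rotated vector \<open>w p\<close>,
      centring included.\<close>
    define H where "H p x = iexp (t / s * x\<^sup>2) * iexp (- (l p * t))" for p x
    have Hm[measurable]: "H p \<in> borel_measurable borel" for p unfolding H_def by measurable
    have "AE \<omega> in M. \<forall>p\<in>A. I\<^sub>1 (w p) \<omega> = (\<Sum>i\<in>A. u (p, i) * I\<^sub>1 (h i) \<omega>)"
      unfolding w_def by (intro AE_finite_allI A I_sum)
    with F_eq have eq: "AE \<omega> in M. iexp (t * F \<omega>) = (\<Prod>p\<in>A. H p (I\<^sub>1 (w p) \<omega>))"
    proof eventually_elim
      case (elim \<omega>)
      have "(\<Sum>p\<in>A. (I\<^sub>1 (w p) \<omega>)\<^sup>2) = (\<Sum>p\<in>A. (\<Sum>i\<in>A. u (p, i) * I\<^sub>1 (h i) \<omega>)\<^sup>2)"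
        using elim(2) by simp
      also have "\<dots> = (\<Sum>i\<in>A. (I\<^sub>1 (h i) \<omega>)\<^sup>2)" by (rule orthogonal_on_sum_square[OF A u])
      finally have "t * F \<omega> = t / s * ((\<Sum>p\<in>A. (I\<^sub>1 (w p) \<omega>)\<^sup>2) - (\<Sum>p\<in>A. (norm (w p))\<^sup>2))"
        unfolding elim(1) N by (simp add: sum_subtractf)
      also have "\<dots> = (\<Sum>p\<in>A. t / s * (I\<^sub>1 (w p) \<omega>)\<^sup>2 + - (l p * t))"
        by (simp add: l_def sum_subtractf sum_distrib_left right_diff_distrib mult.commute)
      also have "iexp \<dots> = (\<Prod>p\<in>A. H p (I\<^sub>1 (w p) \<omega>))"
        unfolding H_def exp_add[symmetric] distrib_left[symmetric] of_real_add[symmetric]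
        unfolding of_real_sum sum_distrib_left using A by (rule exp_sum)
      finally show ?case .
    qed
    have "char (distr M borel F) t = (CLINT \<omega>|M. iexp (t * F \<omega>))"
      unfolding char_def by (subst integral_distr) auto
    also have "\<dots> = (CLINT \<omega>|M. (\<Prod>p\<in>A. H p (I\<^sub>1 (w p) \<omega>)))"
      using eq by (intro integral_cong_AE) auto
    also have "\<dots> = (\<Prod>p\<in>A. CLINT \<omega>|M. H p (I\<^sub>1 (w p) \<omega>))"
    proof (rule I_orthogonal_expectation_prod[OF A orth Hm])
      have "cmod (H p x) = cmod (iexp (t / s * x\<^sup>2)) * cmod (iexp (- l p * t))" for p x
        unfolding H_def norm_mult by simp
      then show "cmod (H p x) \<le> 1" for p x by (simp only: cm)
    qed
    also have "\<dots> = f t"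
      unfolding f_def
    proof (rule prod.cong[OF refl])
      fix p
      have "(CLINT \<omega>|M. H p (I\<^sub>1 (w p) \<omega>)) = (CLINT \<omega>|M. iexp (t / s * (I\<^sub>1 (w p) \<omega>)\<^sup>2)) * iexp (- (l p * t))"
        unfolding H_def by (rule integral_mult_left_zero)
      also have "\<dots> = square_char (l p * t) * iexp (- (l p * t))"
        unfolding expectation_iexp_I_square by (simp add: l_def)
      finally show "(CLINT \<omega>|M. H p (I\<^sub>1 (w p) \<omega>)) = square_char (l p * t) * iexp (- (l p * t))" .
    qed
    finally show ?thesis .
  qed
  then have "char (distr M borel F) = f" ..
  from abs_measure_diff_std_normal_le[OF _ this B] show ?thesis
    unfolding L by simp
qed

end

section \<open>Quadratic variations\<close>

text \<open>The arithmetic-geometric mean inequality for sqrt(x y), sqrt(y z) and sqrt(z x). Each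
  summand on the right involves only two of the variables, so that triple sums of it
  decouple.\<close>

lemma mult3_le_powr:
  fixes x y z :: real
  assumes "0 \<le> x" "0 \<le> y" "0 \<le> z"
  shows "x * y * z \<le> (x powr (3/2) * y powr (3/2) + y powr (3/2) * z powr (3/2) + z powr (3/2) * x powr (3/2)) / 3"
proof -
  have amgm: "3 * (p * q * r) \<le> p ^ 3 + q ^ 3 + r ^ 3" if "0 \<le> p" "0 \<le> q" "0 \<le> r" for p q r :: real
  proof -
    have "2 * (p ^ 3 + q ^ 3 + r ^ 3 - 3 * (p * q * r)) = (p + q + r) * ((p - q)\<^sup>2 + (q - r)\<^sup>2 + (r - p)\<^sup>2)"
      by algebra
    also have "\<dots> \<ge> 0" using that by simp
    finally show ?thesis by simp
  qed
  have powr: "t powr (3/2) = sqrt t ^ 3" if "0 \<le> t" for t :: real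
    using that powr_powr[of t "1/2" 3] by (simp add: powr_half_sqrt)
  have "x * y * z = (sqrt x * sqrt y) * (sqrt y * sqrt z) * (sqrt z * sqrt x)"
    using assms by (simp add: algebra_simps)
  then show ?thesis
    using amgm[of "sqrt x * sqrt y" "sqrt y * sqrt z" "sqrt z * sqrt x"] assms
    by (simp add: powr power_mult_distrib)
qed

text \<open>The discrete Young inequality behind the third cumulant bound.\<close>

lemma triple_sum_le:
  fixes r :: "int \<Rightarrow> real"
  assumes nonneg: "\<And>k. 0 \<le> r k" and even: "\<And>k. r (- k) = r k"
  shows "(\<Sum>i=1..n. \<Sum>k=1..n. \<Sum>m=1..n. r (int i - int m) * r (int m - int k) * r (int k - int i))
    \<le> real n * (\<Sum>k\<in>{k. \<bar>k\<bar> < int n}. r k powr (3/2))\<^sup>2"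
proof -
  define R where "R i k = r (int i - int k) powr (3/2)" for i k
  have sym: "R i k = R k i" for i k using even[of "int i - int k"] by (simp add: R_def)
  have R0: "0 \<le> R i k" for i k by (simp add: R_def)
  define S where "S = (\<Sum>k\<in>{k. \<bar>k\<bar> < int n}. r k powr (3/2))"
  define s where "s j = (\<Sum>i=1..n. R i j)" for j
  have s': "(\<Sum>i=1..n. R j i) = s j" for j unfolding s_def by (rule sum.cong[OF refl sym])
  have s0: "0 \<le> s j" for j unfolding s_def by (intro sum_nonneg R0)
  have fin: "finite {k. \<bar>k\<bar> < int n}"
    by (rule finite_subset[of _ "{- int n..int n}"]) auto
  have sS: "s j \<le> S" if "j \<in> {1..n}" for j
  proof -
    have "s j = (\<Sum>k\<in>(\<lambda>i. int i - int j) ` {1..n}. r k powr (3/2))"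
      unfolding s_def R_def by (subst sum.reindex) (auto simp: inj_on_def)
    also have "\<dots> \<le> S"
      unfolding S_def using that by (intro sum_mono2 fin) auto
    finally show ?thesis .
  qed
  have "(\<Sum>i=1..n. \<Sum>k=1..n. \<Sum>m=1..n. r (int i - int m) * r (int m - int k) * r (int k - int i))
    \<le> (\<Sum>i=1..n. \<Sum>k=1..n. \<Sum>m=1..n. (R i m * R m k + R m k * R k i + R k i * R i m) / 3)"
    unfolding R_def by (intro sum_mono mult3_le_powr nonneg)
  also have "\<dots> = ((\<Sum>i=1..n. \<Sum>k=1..n. \<Sum>m=1..n. R i m * R m k) + (\<Sum>i=1..n. \<Sum>k=1..n. \<Sum>m=1..n. R m k * R k i)
      + (\<Sum>i=1..n. \<Sum>k=1..n. \<Sum>m=1..n. R k i * R i m)) / 3"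
    by (simp only: sum_divide_distrib[symmetric] sum.distrib)
  \<comment> \<open>In each of the three sums one index is shared by both factors; summing out the
    other two leaves the square of the row sum \<open>s\<close> at that index.\<close>
  also have "(\<Sum>i=1..n. \<Sum>k=1..n. \<Sum>m=1..n. R i m * R m k) = (\<Sum>m=1..n. s m * s m)"
  proof -
    have "(\<Sum>i=1..n. \<Sum>k=1..n. \<Sum>m=1..n. R i m * R m k) = (\<Sum>i=1..n. \<Sum>m=1..n. R i m * s m)"
      unfolding s'[symmetric] sum_distrib_left by (rule sum.cong[OF refl], rule sum.swap)
    also have "\<dots> = (\<Sum>m=1..n. s m * s m)"
      by (subst sum.swap) (simp add: s_def sum_distrib_right)
    finally show ?thesis .
  qed
  also have "(\<Sum>i=1..n. \<Sum>k=1..n. \<Sum>m=1..n. R m k * R k i) = (\<Sum>k=1..n. s k * s k)"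
  proof -
    have "(\<Sum>i=1..n. \<Sum>k=1..n. \<Sum>m=1..n. R m k * R k i) = (\<Sum>i=1..n. \<Sum>k=1..n. s k * R k i)"
      by (simp add: s_def sum_distrib_right)
    also have "\<dots> = (\<Sum>k=1..n. s k * s k)"
      by (subst sum.swap) (simp only: s' sum_distrib_left[symmetric])
    finally show ?thesis .
  qed
  also have "(\<Sum>i=1..n. \<Sum>k=1..n. \<Sum>m=1..n. R k i * R i m) = (\<Sum>i=1..n. s i * s i)"
    by (simp only: sum_distrib_left[symmetric] s' sum_distrib_right[symmetric] s_def[symmetric])
  also have "((\<Sum>m=1..n. s m * s m) + (\<Sum>k=1..n. s k * s k) + (\<Sum>i=1..n. s i * s i)) / 3 = (\<Sum>i=1..n. s i * s i)"
    by simp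
  also have "\<dots> \<le> (\<Sum>i=1..n. S * S)"
    by (intro sum_mono mult_mono sS s0 order_trans[OF s0 sS])
  finally show ?thesis by (simp add: S_def power2_eq_square)
qed

section \<open>Variance and normal approximation of the quadratic variation\<close>

context wiener_integral
begin

text \<open>The covariance of the squares of two centred jointly Gaussian variables is twice the
  squared covariance. The variance is multiplied by n so that the identity has no division and also
  holds for n = 0.\<close>

lemma quad_var_variance_eq:
  fixes X :: "nat \<Rightarrow> 'a \<Rightarrow> real"
  assumes X[measurable]: "\<And>n. X n \<in> borel_measurable M"
    and XI: "\<And>n. AE \<omega> in M. X n \<omega> = I\<^sub>1 (h n) \<omega>"
  shows "AE \<omega> in M. quad_var M X n \<omega> = 1 / sqrt (real n) * (\<Sum>i=1..n. (I\<^sub>1 (h i) \<omega>)\<^sup>2 - (norm (h i))\<^sup>2)"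
    and "real n * quad_var_variance M X n = 2 * (\<Sum>i=1..n. \<Sum>k=1..n. (h i \<bullet> h k)\<^sup>2)"
proof -
  have EX: "integral\<^sup>L M (\<lambda>\<omega>. (X i \<omega>)\<^sup>2) = (norm (h i))\<^sup>2" for i
  proof -
    have "integral\<^sup>L M (\<lambda>\<omega>. (X i \<omega>)\<^sup>2) = integral\<^sup>L M (\<lambda>\<omega>. (I\<^sub>1 (h i) \<omega>)\<^sup>2)"
      by (rule integral_cong_AE) (use XI[of i] in \<open>auto elim!: eventually_mono\<close>)
    then show ?thesis by (simp add: isometry_I)
  qed
  have "AE \<omega> in M. \<forall>i\<in>{1..n}. X i \<omega> = I\<^sub>1 (h i) \<omega>"
    using XI by (intro AE_finite_allI) auto
  then show ae: "AE \<omega> in M. quad_var M X n \<omega> = 1 / sqrt (real n) * (\<Sum>i=1..n. (I\<^sub>1 (h i) \<omega>)\<^sup>2 - (norm (h i))\<^sup>2)"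
    by eventually_elim (auto simp: quad_var_def EX intro!: sum.cong)
  have [measurable]: "quad_var M X n \<in> borel_measurable M"
    unfolding quad_var_def[abs_def] by measurable
  define Y where "Y i \<omega> = (I\<^sub>1 (h i) \<omega>)\<^sup>2 - (norm (h i))\<^sup>2" for i \<omega>
  have YY: "Y i \<omega> * Y k \<omega> = (I\<^sub>1 (h i) \<omega>)\<^sup>2 * (I\<^sub>1 (h k) \<omega>)\<^sup>2 - (norm (h k))\<^sup>2 * (I\<^sub>1 (h i) \<omega>)\<^sup>2
      - (norm (h i))\<^sup>2 * (I\<^sub>1 (h k) \<omega>)\<^sup>2 + (norm (h i))\<^sup>2 * (norm (h k))\<^sup>2" for i k \<omega>
    by (simp add: Y_def algebra_simps)
  have intY: "integrable M (\<lambda>\<omega>. Y i \<omega> * Y k \<omega>)" for i k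
    unfolding YY using expectation_I_square_mult_square(1) square_integrable_I by auto
  have EY: "expectation (\<lambda>\<omega>. Y i \<omega> * Y k \<omega>) = 2 * (h i \<bullet> h k)\<^sup>2" for i k
    unfolding YY using expectation_I_square_mult_square[of "h i" "h k"] square_integrable_I prob_space
    by (simp add: isometry_I)
  have "quad_var_variance M X n = expectation (\<lambda>\<omega>. (1 / sqrt (real n) * (\<Sum>i=1..n. Y i \<omega>))\<^sup>2)"
    unfolding quad_var_variance_def
    by (rule integral_cong_AE) (use ae in \<open>auto elim!: eventually_mono simp: Y_def\<close>)
  also have "\<dots> = expectation (\<lambda>\<omega>. 1 / real n * (\<Sum>i=1..n. \<Sum>k=1..n. Y i \<omega> * Y k \<omega>))"
    by (simp add: power_mult_distrib power_divide power2_eq_square[of "sum _ _"] sum_product)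
  also have "\<dots> = 1 / real n * (\<Sum>i=1..n. \<Sum>k=1..n. 2 * (h i \<bullet> h k)\<^sup>2)"
    using intY by (simp add: EY)
  finally show "real n * quad_var_variance M X n = 2 * (\<Sum>i=1..n. \<Sum>k=1..n. (h i \<bullet> h k)\<^sup>2)"
    by (cases "n = 0") (simp_all add: sum_distrib_left)
qed

text \<open>Here s = sqrt(n v), so s^3 = v^(3/2) sqrt(n) n, and the last factor n cancels the n from
  the triple sum. The covariance bound is used three times, hence the cube of
  \<open>C\<^sub>0\<close>.\<close>

theorem tv_dist_normalized_quad_var_le:
  fixes X :: "nat \<Rightarrow> 'a \<Rightarrow> real" and \<rho> :: "real \<Rightarrow> real"
  assumes X[measurable]: "\<And>n. X n \<in> borel_measurable M"
    and XI: "\<And>n. AE \<omega> in M. X n \<omega> = I\<^sub>1 (h n) \<omega>"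
    and Q: "prob_space Q" and N: "distributed Q lborel N (\<lambda>x. ennreal (std_normal_density x))"
    and even: "\<And>x. \<rho> (- x) = \<rho> x" and pos: "\<And>x. \<rho> x > 0" and C0: "C\<^sub>0 > 0"
    and cov: "\<And>s t. \<bar>integral\<^sup>L M (\<lambda>\<omega>. X t \<omega> * X s \<omega>)\<bar> \<le> C\<^sub>0 * \<rho> \<bar>real t - real s\<bar>"
    and n: "n > 0" and v: "quad_var_variance M X n > 0"
  shows "tv_dist M (normalized_quad_var M X n) Q N \<le> 229376 * C\<^sub>0 ^ 3 *
    (1 / (quad_var_variance M X n powr (3/2) * sqrt (real n)) * (\<Sum>k\<in>{k::int. \<bar>k\<bar> < int n}. \<bar>\<rho> (of_int k)\<bar> powr (3/2))\<^sup>2)"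
    (is "_ \<le> _ * (1 / (?v powr _ * _) * ?S\<^sup>2)")
proof -
  interpret Q: prob_space Q by fact
  define F where "F = normalized_quad_var M X n"
  have F[measurable]: "F \<in> borel_measurable M"
    unfolding F_def normalized_quad_var_def[abs_def] quad_var_def[abs_def] by measurable
  define s where "s = sqrt (real n) * sqrt ?v"
  have s0: "s > 0" using n v by (simp add: s_def)
  have s2: "s\<^sup>2 = 2 * (\<Sum>i\<in>{1..n}. \<Sum>k\<in>{1..n}. (h i \<bullet> h k)\<^sup>2)"
    using quad_var_variance_eq(2)[where X=X and h=h and n=n, OF X XI] v by (simp add: s_def power_mult_distrib)
  have F_eq: "AE \<omega> in M. F \<omega> = (\<Sum>i\<in>{1..n}. (I\<^sub>1 (h i) \<omega>)\<^sup>2 - (norm (h i))\<^sup>2) / s"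
    using quad_var_variance_eq(1)[where X=X and h=h and n=n, OF X XI]
    by eventually_elim (simp add: F_def normalized_quad_var_def s_def)
  have c: "\<bar>h i \<bullet> h k\<bar> \<le> C\<^sub>0 * \<rho> (of_int (int i - int k))" for i k
  proof -
    have "integral\<^sup>L M (\<lambda>\<omega>. X i \<omega> * X k \<omega>) = expectation (\<lambda>\<omega>. I\<^sub>1 (h i) \<omega> * I\<^sub>1 (h k) \<omega>)"
    proof (rule integral_cong_AE)
      show "AE \<omega> in M. X i \<omega> * X k \<omega> = I\<^sub>1 (h i) \<omega> * I\<^sub>1 (h k) \<omega>"
        using XI[of i] XI[of k] by eventually_elim simp
    qed auto
    moreover have "\<rho> \<bar>real i - real k\<bar> = \<rho> (of_int (int i - int k))"
      using even[of "real i - real k"] by (simp add: abs_if)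
    ultimately show ?thesis using cov[of i k] by (simp add: expectation_I_mult(2))
  qed
  define T where "T = (\<Sum>i\<in>{1..n}. \<Sum>k\<in>{1..n}. \<Sum>m\<in>{1..n}. (h i \<bullet> h m) * (h m \<bullet> h k) * (h k \<bullet> h i))"
  have "T \<le> (\<Sum>i\<in>{1..n}. \<Sum>k\<in>{1..n}. \<Sum>m\<in>{1..n}. C\<^sub>0 ^ 3 * (\<rho> (of_int (int i - int m)) * \<rho> (of_int (int m - int k)) * \<rho> (of_int (int k - int i))))"
    unfolding T_def
  proof (intro sum_mono)
    fix i k m
    have "(h i \<bullet> h m) * (h m \<bullet> h k) * (h k \<bullet> h i) \<le> \<bar>h i \<bullet> h m\<bar> * \<bar>h m \<bullet> h k\<bar> * \<bar>h k \<bullet> h i\<bar>"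
      unfolding abs_mult[symmetric] by (rule abs_ge_self)
    also have "\<dots> \<le> (C\<^sub>0 * \<rho> (of_int (int i - int m))) * (C\<^sub>0 * \<rho> (of_int (int m - int k))) * (C\<^sub>0 * \<rho> (of_int (int k - int i)))"
      using C0 pos[THEN less_imp_le] by (intro mult_mono c mult_nonneg_nonneg abs_ge_zero) auto
    finally show "(h i \<bullet> h m) * (h m \<bullet> h k) * (h k \<bullet> h i) \<le> C\<^sub>0 ^ 3 * (\<rho> (of_int (int i - int m)) * \<rho> (of_int (int m - int k)) * \<rho> (of_int (int k - int i)))"
      by (simp add: power3_eq_cube mult_ac)
  qed
  also have "\<dots> = C\<^sub>0 ^ 3 * (\<Sum>i\<in>{1..n}. \<Sum>k\<in>{1..n}. \<Sum>m\<in>{1..n}. \<rho> (of_int (int i - int m)) * \<rho> (of_int (int m - int k)) * \<rho> (of_int (int k - int i)))"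
    by (simp only: sum_distrib_left)
  also have "\<dots> \<le> C\<^sub>0 ^ 3 * (real n * (\<Sum>k\<in>{k. \<bar>k\<bar> < int n}. \<rho> (of_int k) powr (3/2))\<^sup>2)"
    using C0 pos[THEN less_imp_le] even by (intro mult_left_mono triple_sum_le[where r="\<lambda>k. \<rho> (of_int k)"]) auto
  also have "(\<Sum>k\<in>{k. \<bar>k\<bar> < int n}. \<rho> (of_int k) powr (3/2)) = ?S"
    using pos by (simp add: abs_of_pos)
  finally have T: "T \<le> C\<^sub>0 ^ 3 * (real n * ?S\<^sup>2)" .
  have s3: "s ^ 3 = (?v powr (3/2) * sqrt (real n)) * real n"
  proof -
    have "?v powr (3/2) = sqrt ?v ^ 3"
      using v powr_powr[of ?v "1/2" 3] by (simp add: powr_half_sqrt)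
    moreover have "sqrt (real n) ^ 3 = sqrt (real n) * real n" by (simp add: power3_eq_cube)
    ultimately show ?thesis by (simp add: s_def power_mult_distrib)
  qed
  have "T / s ^ 3 \<le> C\<^sub>0 ^ 3 * (real n * ?S\<^sup>2) / s ^ 3"
    using T s0 by (intro divide_right_mono) auto
  also have "\<dots> = C\<^sub>0 ^ 3 * (1 / (?v powr (3/2) * sqrt (real n)) * ?S\<^sup>2)"
    unfolding s3 using n by simp
  finally have bound: "229376 * (T / s ^ 3) \<le> 229376 * C\<^sub>0 ^ 3 * (1 / (?v powr (3/2) * sqrt (real n)) * ?S\<^sup>2)"
    by simp
  have Nm[measurable]: "N \<in> borel_measurable Q" using distributed_measurable[OF N] by simp
  have dN: "distr Q borel N = std_normal_distribution"
    using distributed_distr_eq_density[OF N] by (simp cong: distr_cong)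
  show ?thesis
    unfolding tv_dist_def F_def[symmetric]
  proof (rule cSUP_least)
    fix B :: "real set" assume B: "B \<in> sets borel"
    have "measure M {\<omega>\<in>space M. F \<omega> \<in> B} = measure (distr M borel F) B"
      using B by (subst measure_distr) (auto intro!: arg_cong[where f="measure M"])
    moreover have "measure Q {\<omega>\<in>space Q. N \<omega> \<in> B} = measure std_normal_distribution B"
      unfolding dN[symmetric] using B by (subst measure_distr) (auto intro!: arg_cong[where f="measure Q"])
    ultimately show "\<bar>measure M {\<omega>\<in>space M. F \<omega> \<in> B} - measure Q {\<omega>\<in>space Q. N \<omega> \<in> B}\<bar> \<le>
      229376 * C\<^sub>0 ^ 3 * (1 / (?v powr (3/2) * sqrt (real n)) * ?S\<^sup>2)"
      using quadratic_form_abs_measure_diff_le[OF _ s0 s2 F F_eq B] bound unfolding T_def by simp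
  qed auto
qed

end

section \<open>Power-law correlations\<close>

text \<open>A telescoping form of the comparison with the integral of x^(-\<gamma>). The induction
  step follows from concavity of the power 1 - \<gamma>, applied to the ratio of consecutive
  integers.\<close>

lemma sum_powr_minus_le:
  fixes \<gamma> :: real
  assumes "0 < \<gamma>" "\<gamma> < 1"
  shows "(\<Sum>k=1..m. real k powr (- \<gamma>)) \<le> real m powr (1 - \<gamma>) / (1 - \<gamma>)"
proof (induction m)
  case (Suc m)
  define x where "x = real (Suc m)"
  have x: "x \<ge> 1" "real m = x - 1" by (simp_all add: x_def)
  have step: "real m powr (1 - \<gamma>) + (1 - \<gamma>) * x powr (- \<gamma>) \<le> x powr (1 - \<gamma>)"
  proof (cases "m = 0")
    case True
    then show ?thesis using assms by (simp add: x_def)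
  next
    case False
    have "(real m / x) powr (1 - \<gamma>) * 1 powr \<gamma> \<le> (1 - \<gamma>) * (real m / x) + \<gamma> * 1"
      using assms False x by (intro Youngs_inequality_0) auto
    moreover have "(1 - \<gamma>) * (real m / x) + \<gamma> * 1 = 1 - (1 - \<gamma>) / x"
    proof -
      have "real m / x = 1 - 1 / x" using x by (simp add: diff_divide_distrib)
      then show ?thesis by (simp only:) (simp add: algebra_simps diff_divide_distrib)
    qed
    ultimately have "(real m / x) powr (1 - \<gamma>) \<le> 1 - (1 - \<gamma>) / x"
      by simp
    then have "x powr (1 - \<gamma>) * (real m / x) powr (1 - \<gamma>) \<le> x powr (1 - \<gamma>) * (1 - (1 - \<gamma>) / x)"
      by (intro mult_left_mono) auto
    moreover have "x powr (1 - \<gamma>) * (real m / x) powr (1 - \<gamma>) = real m powr (1 - \<gamma>)"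
      using x by (simp add: powr_divide)
    moreover have "x powr (1 - \<gamma>) * (1 - (1 - \<gamma>) / x) = x powr (1 - \<gamma>) - (1 - \<gamma>) * x powr (- \<gamma>)"
    proof -
      have "x powr (1 - \<gamma>) = x * x powr (- \<gamma>)"
        using x powr_add[of x 1 "- \<gamma>"] by simp
      then have "x powr (1 - \<gamma>) * ((1 - \<gamma>) / x) = (1 - \<gamma>) * x powr (- \<gamma>)" using x by simp
      then show ?thesis by (simp only: right_diff_distrib mult_1_right)
    qed
    ultimately show ?thesis by linarith
  qed
  have "(\<Sum>k=1..Suc m. real k powr (- \<gamma>)) \<le> real m powr (1 - \<gamma>) / (1 - \<gamma>) + x powr (- \<gamma>)"
    using Suc by (simp add: x_def)
  also have "\<dots> = (real m powr (1 - \<gamma>) + (1 - \<gamma>) * x powr (- \<gamma>)) / (1 - \<gamma>)"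
    using assms by (simp add: add_divide_distrib)
  also have "\<dots> \<le> x powr (1 - \<gamma>) / (1 - \<gamma>)"
    using step assms by (intro divide_right_mono) auto
  finally show ?case by (simp add: x_def)
qed simp

text \<open>Telescoping, with ln y <= y - 1 at y = m / (m + 1).\<close>

lemma sum_inverse_le_ln:
  assumes "m > 0"
  shows "(\<Sum>k=1..m. 1 / real k) \<le> 1 + ln (real m)"
  using assms
proof (induction m rule: nat_induct_non_zero)
  case (Suc m)
  have "ln (real m / real (Suc m)) \<le> real m / real (Suc m) - 1"
    using Suc by (intro ln_le_minus_one) auto
  also have "real m / real (Suc m) - 1 = - (1 / real (Suc m))"
    by (simp add: divide_simps)
  also have "ln (real m / real (Suc m)) = ln (real m) - ln (real (Suc m))"
    using Suc.hyps by (intro ln_divide_pos) auto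
  finally have "1 / real (Suc m) \<le> ln (real (Suc m)) - ln (real m)" by linarith
  moreover have "(\<Sum>k=1..Suc m. 1 / real k) = (\<Sum>k=1..m. 1 / real k) + 1 / real (Suc m)"
    by simp
  ultimately show ?case using Suc.IH by linarith
qed simp

text \<open>The exponent 3/2 \<beta> crosses the summability threshold 1 at \<beta> = 2/3, which
  separates the regimes. The value \<beta> = 1/2 belongs to the power regime, since 3/2 - 3 \<beta>
  is then 0 and the rate is the constant 1.\<close>

lemma sum_powr_square_le_decay_rate:
  assumes \<beta>: "1/2 \<le> \<beta>"
  obtains c where "0 < c" "\<And>n. n > 1 \<Longrightarrow> (1 + (\<Sum>k=1..n. real k powr (- (3/2 * \<beta>))))\<^sup>2 / sqrt (real n) \<le> c * decay_rate \<beta> n"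
proof -
  define \<gamma> where "\<gamma> = 3/2 * \<beta>"
  define S where "S n = 1 + (\<Sum>k=1..n. real k powr (- \<gamma>))" for n :: nat
  have S0: "0 \<le> S n" for n unfolding S_def by (intro add_nonneg_nonneg sum_nonneg) auto
  have sq: "(S n)\<^sup>2 / sqrt (real n) \<le> a\<^sup>2 * (s\<^sup>2 * real n powr (- 1/2))"
    if "S n \<le> a * s" "n > 1" for n a s
  proof -
    have "(S n)\<^sup>2 / sqrt (real n) \<le> (a * s)\<^sup>2 / sqrt (real n)"
      using that S0 by (intro divide_right_mono power_mono) auto
    also have "\<dots> = a\<^sup>2 * (s\<^sup>2 * real n powr (- 1/2))"
    proof -
      have "real n powr (- 1/2) = 1 / sqrt (real n)"
        using powr_minus_divide[of "real n" "1/2"] by (simp add: powr_half_sqrt)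
      then show ?thesis by (simp add: power_mult_distrib)
    qed
    finally show ?thesis .
  qed
  have "\<exists>c>0. \<forall>n>1. (S n)\<^sup>2 / sqrt (real n) \<le> c * decay_rate \<beta> n"
  proof -
    consider "\<beta> < 2/3" | "\<beta> = 2/3" | "\<beta> > 2/3" by linarith
    then show ?thesis
    proof cases
      case 1
      have \<gamma>: "0 < \<gamma>" "\<gamma> < 1" using \<beta> 1 by (auto simp: \<gamma>_def)
      define a where "a = 1 + 1 / (1 - \<gamma>)"
      have "(S n)\<^sup>2 / sqrt (real n) \<le> a\<^sup>2 * decay_rate \<beta> n" if n: "n > 1" for n
      proof -
        have "1 \<le> real n powr (1 - \<gamma>)" using n \<gamma> by (intro ge_one_powr_ge_zero) auto
        then have "S n \<le> a * real n powr (1 - \<gamma>)"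
          using sum_powr_minus_le[OF \<gamma>, of n] by (simp add: S_def a_def distrib_right)
        from sq[OF this n] have "(S n)\<^sup>2 / sqrt (real n) \<le> a\<^sup>2 * ((real n powr (1 - \<gamma>))\<^sup>2 * real n powr (- 1/2))" .
        also have "(real n powr (1 - \<gamma>))\<^sup>2 * real n powr (- 1/2) = real n powr (3/2 - 3 * \<beta>)"
          using n by (simp add: power2_eq_square \<gamma>_def flip: powr_add)
        also have "\<dots> = decay_rate \<beta> n"
          using \<beta> 1 n by (auto simp: decay_rate_def)
        finally show ?thesis .
      qed
      moreover have "a > 0" unfolding a_def using \<gamma> by (intro add_pos_pos divide_pos_pos) auto
      then have "a\<^sup>2 > 0" by simp
      ultimately show ?thesis by blast
    next
      case 2
      \<comment> \<open>For n >= 2 the term 2 / ln 2 times ln n dominates 2, the sum of the leading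
        1 and of the 1 in the harmonic bound.\<close>
      define a where "a = 2 / ln 2 + (1 :: real)"
      have "(S n)\<^sup>2 / sqrt (real n) \<le> a\<^sup>2 * decay_rate \<beta> n" if n: "n > 1" for n
      proof -
        have "\<gamma> = 1" using 2 by (simp add: \<gamma>_def)
        then have "S n = 1 + (\<Sum>k=1..n. 1 / real k)"
          by (simp add: S_def powr_minus_divide)
        also have "\<dots> \<le> 2 + ln (real n)" using sum_inverse_le_ln[of n] n by simp
        also have "\<dots> \<le> a * ln (real n)"
        proof -
          have "ln 2 \<le> ln (real n)" using n by simp
          then have "2 \<le> 2 / ln 2 * ln (real n)" by (simp add: field_simps)
          then show ?thesis by (simp add: a_def distrib_right)
        qed
        finally have "S n \<le> a * ln (real n)" .
        from sq[OF this n] show ?thesis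
          using 2 by (simp add: decay_rate_def mult_ac)
      qed
      moreover have "a > 0" unfolding a_def by (intro add_pos_pos divide_pos_pos) auto
      then have "a\<^sup>2 > 0" by simp
      ultimately show ?thesis by blast
    next
      case 3
      have "summable (\<lambda>k. real k powr (- \<gamma>))"
        using 3 by (subst summable_real_powr_iff) (simp add: \<gamma>_def)
      then have "(\<Sum>k=1..n. real k powr (- \<gamma>)) \<le> (\<Sum>k. real k powr (- \<gamma>))" for n
        by (intro sum_le_suminf) auto
      moreover define a where "a = 1 + (\<Sum>k. real k powr (- \<gamma>))"
      ultimately have Sa: "S n \<le> a * 1" for n by (simp add: S_def)
      have "(S n)\<^sup>2 / sqrt (real n) \<le> a\<^sup>2 * decay_rate \<beta> n" if n: "n > 1" for n
        using sq[OF Sa n] 3 by (simp add: decay_rate_def)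
      moreover have "a > 0" using Sa[of 0] by (simp add: S_def)
      then have "a\<^sup>2 > 0" by simp
      ultimately show ?thesis by blast
    qed
  qed
  then show ?thesis using that unfolding S_def \<gamma>_def by blast
qed

text \<open>The finitely many integers below the range of the asymptotic bound are absorbed into the
  constant, which is possible because k^(-\<beta>) is positive for k >= 1.\<close>

lemma bigo_at_infinity_powr_nat_bound:
  fixes \<rho> :: "real \<Rightarrow> real"
  assumes "\<rho> \<in> O[at_infinity](\<lambda>t. \<bar>t\<bar> powr (- \<beta>))"
  obtains D where "D > 0" "\<And>k::nat. k \<ge> 1 \<Longrightarrow> \<bar>\<rho> (real k)\<bar> \<le> D * real k powr (- \<beta>)"
proof -
  obtain c where c: "c > 0" "eventually (\<lambda>t. norm (\<rho> t) \<le> c * norm (\<bar>t\<bar> powr (- \<beta>))) at_infinity"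
    using assms by (elim landau_o.bigE)
  then obtain b where b: "\<And>t. b \<le> norm t \<Longrightarrow> \<bar>\<rho> t\<bar> \<le> c * \<bar>t\<bar> powr (- \<beta>)"
    unfolding eventually_at_infinity by auto
  obtain m :: nat where m: "b \<le> real m" using real_arch_simple by blast
  define D where "D = c + (\<Sum>k<m. \<bar>\<rho> (real k)\<bar> * real k powr \<beta>)"
  have D: "c \<le> D" unfolding D_def by (simp add: sum_nonneg)
  have "\<bar>\<rho> (real k)\<bar> \<le> D * real k powr (- \<beta>)" if k: "k \<ge> 1" for k
  proof (cases "k < m")
    case True
    have "\<bar>\<rho> (real k)\<bar> * real k powr \<beta> \<le> (\<Sum>k<m. \<bar>\<rho> (real k)\<bar> * real k powr \<beta>)"
      using True by (intro member_le_sum) auto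
    then have "\<bar>\<rho> (real k)\<bar> * real k powr \<beta> \<le> D" using c(1) by (simp add: D_def)
    then have "\<bar>\<rho> (real k)\<bar> * real k powr \<beta> * real k powr (- \<beta>) \<le> D * real k powr (- \<beta>)"
      by (rule mult_right_mono) simp
    then show ?thesis using k by (simp add: mult.assoc flip: powr_add)
  next
    case False
    then have "\<bar>\<rho> (real k)\<bar> \<le> c * real k powr (- \<beta>)" using b[of "real k"] m by simp
    also have "\<dots> \<le> D * real k powr (- \<beta>)" using D by (intro mult_right_mono) auto
    finally show ?thesis .
  qed
  then show ?thesis using that[of D] c(1) D by simp
qed

text \<open>The right-hand sum runs to n instead of n - 1: the surplus nonnegative terms explain the
  inequality, and the range matches that of the power sums.\<close>

lemma sum_int_even_le:
  fixes r :: "int \<Rightarrow> real"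
  assumes even: "\<And>k. r (- k) = r k" and nonneg: "\<And>k. 0 \<le> r k"
  shows "(\<Sum>k\<in>{k. \<bar>k\<bar> < int n}. r k) \<le> r 0 + 2 * (\<Sum>k=1..n. r (int k))"
proof -
  have "(\<Sum>k\<in>{k. \<bar>k\<bar> < int n}. r k) \<le> (\<Sum>k\<in>insert 0 (int ` {1..n} \<union> (\<lambda>k. - int k) ` {1..n}). r k)"
  proof (rule sum_mono2)
    show "{k. \<bar>k\<bar> < int n} \<subseteq> insert 0 (int ` {1..n} \<union> (\<lambda>k. - int k) ` {1..n})"
    proof
      fix k :: int assume k: "k \<in> {k. \<bar>k\<bar> < int n}"
      consider "k = 0" | "k > 0" | "k < 0" by linarith
      then show "k \<in> insert 0 (int ` {1..n} \<union> (\<lambda>k. - int k) ` {1..n})"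
      proof cases
        case 2
        then have "k = int (nat k)" "nat k \<in> {1..n}" using k by auto
        then show ?thesis by blast
      next
        case 3
        then have "k = - int (nat (- k))" "nat (- k) \<in> {1..n}" using k by auto
        then show ?thesis by blast
      qed simp
    qed
  qed (auto simp: nonneg)
  also have "\<dots> = r 0 + (\<Sum>k\<in>int ` {1..n} \<union> (\<lambda>k. - int k) ` {1..n}. r k)"
    by (rule sum.insert) auto
  also have "(\<Sum>k\<in>int ` {1..n} \<union> (\<lambda>k. - int k) ` {1..n}. r k) = (\<Sum>k\<in>int ` {1..n}. r k) + (\<Sum>k\<in>(\<lambda>k. - int k) ` {1..n}. r k)"
    by (rule sum.union_disjoint) auto
  also have "\<dots> = 2 * (\<Sum>k=1..n. r (int k))"
    by (simp add: sum.reindex inj_on_def even)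
  finally show ?thesis .
qed

lemma sum_powr_square_bigo_le:
  fixes \<rho> :: "real \<Rightarrow> real"
  assumes even: "\<And>x. \<rho> (- x) = \<rho> x" and \<rho>0: "\<rho> 0 = 1"
    and \<beta>: "1/2 \<le> \<beta>" and O: "\<rho> \<in> O[at_infinity](\<lambda>t. \<bar>t\<bar> powr (- \<beta>))"
  obtains c where "0 < c" "\<And>n. n > 1 \<Longrightarrow>
    (\<Sum>k\<in>{k::int. \<bar>k\<bar> < int n}. \<bar>\<rho> (of_int k)\<bar> powr (3/2))\<^sup>2 / sqrt (real n) \<le> c * decay_rate \<beta> n"
proof -
  obtain D where D: "D > 0" "\<And>k::nat. k \<ge> 1 \<Longrightarrow> \<bar>\<rho> (real k)\<bar> \<le> D * real k powr (- \<beta>)"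
    using bigo_at_infinity_powr_nat_bound[OF O] by blast
  obtain c where c: "0 < c" "\<And>n. n > 1 \<Longrightarrow> (1 + (\<Sum>k=1..n. real k powr (- (3/2 * \<beta>))))\<^sup>2 / sqrt (real n) \<le> c * decay_rate \<beta> n"
    using sum_powr_square_le_decay_rate[OF \<beta>] by blast
  \<comment> \<open>With H the power sum, 1 + 2 D^(3/2) H <= E (1 + H). The leading 1 is the term k
    = 0, where \<rho> equals 1.\<close>
  define E where "E = 1 + 2 * D powr (3/2)"
  have E: "E > 0" by (simp add: E_def add_pos_nonneg)
  have "(\<Sum>k\<in>{k::int. \<bar>k\<bar> < int n}. \<bar>\<rho> (of_int k)\<bar> powr (3/2))\<^sup>2 / sqrt (real n) \<le> (E\<^sup>2 * c) * decay_rate \<beta> n"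
    if n: "n > 1" for n
  proof -
    define H where "H = (\<Sum>k=1..n. real k powr (- (3/2 * \<beta>)))"
    have H0: "0 \<le> H" unfolding H_def by (intro sum_nonneg) auto
    have "(\<Sum>k\<in>{k::int. \<bar>k\<bar> < int n}. \<bar>\<rho> (of_int k)\<bar> powr (3/2)) \<le>
      \<bar>\<rho> (of_int 0)\<bar> powr (3/2) + 2 * (\<Sum>k=1..n. \<bar>\<rho> (of_int (int k))\<bar> powr (3/2))"
      by (rule sum_int_even_le) (auto simp: even)
    also have "\<dots> \<le> 1 + 2 * (\<Sum>k=1..n. D powr (3/2) * real k powr (- (3/2 * \<beta>)))"
    proof -
      have "\<bar>\<rho> (of_int (int k))\<bar> powr (3/2) \<le> D powr (3/2) * real k powr (- (3/2 * \<beta>))" if "k \<in> {1..n}" for k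
      proof -
        have "\<bar>\<rho> (of_int (int k))\<bar> powr (3/2) \<le> (D * real k powr (- \<beta>)) powr (3/2)"
          using D(2)[of k] that by (intro powr_mono2) auto
        also have "\<dots> = D powr (3/2) * real k powr (- (3/2 * \<beta>))"
          using D(1) by (simp add: powr_mult powr_powr mult.commute)
        finally show ?thesis .
      qed
      then show ?thesis
        by (intro add_mono mult_left_mono sum_mono) (use \<rho>0 in auto)
    qed
    also have "\<dots> = 1 + 2 * D powr (3/2) * H"
      by (simp add: H_def sum_distrib_left mult.assoc)
    also have "\<dots> \<le> E * (1 + H)"
      using H0 D(1) by (simp add: E_def algebra_simps)
    finally have "(\<Sum>k\<in>{k::int. \<bar>k\<bar> < int n}. \<bar>\<rho> (of_int k)\<bar> powr (3/2))\<^sup>2 \<le> (E * (1 + H))\<^sup>2"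
      by (intro power_mono sum_nonneg) auto
    then have "(\<Sum>k\<in>{k::int. \<bar>k\<bar> < int n}. \<bar>\<rho> (of_int k)\<bar> powr (3/2))\<^sup>2 / sqrt (real n) \<le> (E * (1 + H))\<^sup>2 / sqrt (real n)"
      by (rule divide_right_mono) simp
    also have "\<dots> = E\<^sup>2 * ((1 + H)\<^sup>2 / sqrt (real n))"
      by (simp add: power_mult_distrib)
    also have "\<dots> \<le> E\<^sup>2 * (c * decay_rate \<beta> n)"
      unfolding H_def using c(2)[OF n] by (intro mult_left_mono) auto
    finally show ?thesis by (simp add: mult.assoc)
  qed
  moreover have "E\<^sup>2 * c > 0" using E c(1) by simp
  ultimately show ?thesis using that by blast
qed

lemma decay_rate_nonneg: "0 \<le> decay_rate \<beta> n"
  by (simp add: decay_rate_def)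

theorem theorem4:
  fixes M :: "'a measure" and G :: "real \<Rightarrow> 'a \<Rightarrow> real"
    and ind :: "real \<Rightarrow> 'h::{real_inner, complete_space}"
    and I\<^sub>1 :: "'h \<Rightarrow> 'a \<Rightarrow> real"
    and h :: "nat \<Rightarrow> 'h" and X :: "nat \<Rightarrow> 'a \<Rightarrow> real"
    and Q :: "'b measure" and N :: "'b \<Rightarrow> real"
    and \<rho> :: "real \<Rightarrow> real" and C\<^sub>0 :: real
  assumes "wiener_integral M G ind I\<^sub>1"
    and "\<And>n. X n \<in> borel_measurable M"
    and "\<And>n. AE \<omega> in M. X n \<omega> = I\<^sub>1 (h n) \<omega>"
    and "prob_space Q"
    and "distributed Q lborel N (\<lambda>x. ennreal (std_normal_density x))"
    and "\<And>x. \<rho> (- x) = \<rho> x"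
    and "\<And>x. \<rho> x > 0"
    and "\<rho> 0 = 1"
    and "C\<^sub>0 > 0"
    and "\<And>s t. \<bar>integral\<^sup>L M (\<lambda>\<omega>. X t \<omega> * X s \<omega>)\<bar> \<le> C\<^sub>0 * \<rho> \<bar>real t - real s\<bar>"
  shows "(\<exists>C>0. \<forall>n>1. quad_var_variance M X n > 0 \<longrightarrow>
            tv_dist M (normalized_quad_var M X n) Q N
              \<le> C * max
                  (1 / (quad_var_variance M X n powr (3/2) * sqrt (real n))
                     * (\<Sum>k\<in>{k::int. \<bar>k\<bar> < int n}. \<bar>\<rho> (of_int k)\<bar> powr (3/2))\<^sup>2)
                  (1 / ((quad_var_variance M X n)\<^sup>2 * real n)
                     * (\<Sum>k\<in>{k::int. \<bar>k\<bar> < int n}. \<bar>\<rho> (of_int k)\<bar> powr (4/3)) ^ 3))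
       \<and> (\<forall>\<beta>\<ge>1/2. \<rho> \<in> O[at_infinity](\<lambda>t. \<bar>t\<bar> powr (- \<beta>)) \<longrightarrow>
            (\<exists>C>0. \<forall>n>1. quad_var_variance M X n > 0 \<longrightarrow>
               tv_dist M (normalized_quad_var M X n) Q N
                 \<le> C / min ((quad_var_variance M X n)\<^sup>2) (quad_var_variance M X n powr (3/2))
                     * decay_rate \<beta> n))"
proof -
  interpret wiener_integral M G ind I\<^sub>1 by fact
  let ?v = "quad_var_variance M X"
  let ?S = "\<lambda>n::nat. \<Sum>k\<in>{k::int. \<bar>k\<bar> < int n}. \<bar>\<rho> (of_int k)\<bar> powr (3/2)"
  let ?d = "\<lambda>n. tv_dist M (normalized_quad_var M X n) Q N"
  define K where "K = 229376 * C\<^sub>0 ^ 3"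
  have K: "K > 0" using assms(9) by (simp add: K_def)
  \<comment> \<open>The single analytic estimate behind both conclusions: the maximum dominates its
    first entry, and under power decay the sum over k is replaced by the rate.\<close>
  have main: "?d n \<le> K * (1 / (?v n powr (3/2) * sqrt (real n)) * (?S n)\<^sup>2)" if "n > 1" "?v n > 0" for n
    unfolding K_def
    by (rule tv_dist_normalized_quad_var_le[OF assms(2,3,4,5,6,7,9,10)]) (use that in auto)
  show ?thesis
  proof (rule conjI)
    show "\<exists>C>0. \<forall>n>1. ?v n > 0 \<longrightarrow> ?d n
        \<le> C * max (1 / (?v n powr (3/2) * sqrt (real n)) * (?S n)\<^sup>2)
            (1 / ((?v n)\<^sup>2 * real n) * (\<Sum>k\<in>{k::int. \<bar>k\<bar> < int n}. \<bar>\<rho> (of_int k)\<bar> powr (4/3)) ^ 3)"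
    proof (intro exI[of _ K] conjI allI impI)
      fix n :: nat assume "1 < n" "?v n > 0"
      from main[OF this] show "?d n \<le> K * max (1 / (?v n powr (3/2) * sqrt (real n)) * (?S n)\<^sup>2)
            (1 / ((?v n)\<^sup>2 * real n) * (\<Sum>k\<in>{k::int. \<bar>k\<bar> < int n}. \<bar>\<rho> (of_int k)\<bar> powr (4/3)) ^ 3)"
        by (rule order_trans) (intro mult_left_mono max.cobounded1 less_imp_le[OF K])
    qed (rule K)
    show "\<forall>\<beta>\<ge>1/2. \<rho> \<in> O[at_infinity](\<lambda>t. \<bar>t\<bar> powr (- \<beta>)) \<longrightarrow>
      (\<exists>C>0. \<forall>n>1. ?v n > 0 \<longrightarrow> ?d n \<le> C / min ((?v n)\<^sup>2) (?v n powr (3/2)) * decay_rate \<beta> n)"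
    proof (intro allI impI)
      fix \<beta> :: real assume "1/2 \<le> \<beta>" "\<rho> \<in> O[at_infinity](\<lambda>t. \<bar>t\<bar> powr (- \<beta>))"
      then obtain c where c: "c > 0" "\<And>n. n > 1 \<Longrightarrow> (?S n)\<^sup>2 / sqrt (real n) \<le> c * decay_rate \<beta> n"
        using sum_powr_square_bigo_le[OF assms(6,8)] by metis
      have "?d n \<le> (K * c) / min ((?v n)\<^sup>2) (?v n powr (3/2)) * decay_rate \<beta> n"
        if n: "n > 1" and v: "?v n > 0" for n
      proof -
        have "?d n \<le> K / ?v n powr (3/2) * ((?S n)\<^sup>2 / sqrt (real n))"
          using main[OF n v] by simp
        also have "\<dots> \<le> K / ?v n powr (3/2) * (c * decay_rate \<beta> n)"
          using c(2)[OF n] K by (intro mult_left_mono) auto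
        also have "\<dots> = (K * c) / ?v n powr (3/2) * decay_rate \<beta> n"
          by simp
        \<comment> \<open>The minimum is at most v^(3/2) and is positive, so passing to it only
          enlarges the quotient.\<close>
        also have "\<dots> \<le> (K * c) / min ((?v n)\<^sup>2) (?v n powr (3/2)) * decay_rate \<beta> n"
          using K c(1) v by (intro mult_right_mono divide_left_mono decay_rate_nonneg) auto
        finally show ?thesis .
      qed
      then show "\<exists>C>0. \<forall>n>1. ?v n > 0 \<longrightarrow> ?d n \<le> C / min ((?v n)\<^sup>2) (?v n powr (3/2)) * decay_rate \<beta> n"
        using K c(1) by (intro exI[of _ "K * c"]) auto
    qed
  qed
qed

end
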